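(* Let $(W,S)$ be a finite Coxeter group with identity $1$, longest element $w_0$, and shard intersection order $\preceq$. Then the Möbius number $\mu_\preceq(1,w_0)$ of $(W,\preceq)$ equals $(-1)^{|S|}$ times the number of elements of $W$ not contained in any proper standard parabolic subgroup $W_J$ ($J\subsetneq S$). Equivalently, \[\mu_\preceq(1,w_0)=\sum_{J\subseteq S}(-1)^{|J|}\,|W_J|.\]
   Context: Let $(W,S)$ be a finite Coxeter group acting faithfully by orthogonal transformations on a Euclidean space $V$ as a reflection group. Let $T=\{wsw^{-1}\}$ be the reflections, $H_t$ the hyperplane fixed by $t$, $\mathcal A=\{H_t:t\in T\}$. A region is the closure of a connected component of $V\setminus\bigcup\mathcal A$; $B$ is the region whose facet hyperplanes are $\{H_s:s\in S\}$, and $w\mapsto wB$ is a bijection from $W$ to regions. $S(R)$ is the set of hyperplanes separating region $R$ from $B$. For distinct $H,H'\in\mathcal A$, let $\mathcal A(H,H')$ be the hyperplanes of $\mathcal A$ containing $H\cap H'$; its basic hyperplanes are the two facet-defining hyperplanes of the region of $\mathcal A(H,H')$ containing $B$. $H$ cuts $H'$ if $H$ is basic in $\mathcal A(H,H')$ and $H'$ is not. The shards in $H$ are the closures of the connected components of $H$ minus all hyperplanes cutting $H$; $H(\Sigma)$ is the hyperplane containing shard $\Sigma$. $\Psi$ is the set of all intersections of sets of shards ($V$ = empty intersection). $\Sigma$ is a lower shard of region $R$ if $\dim(R\cap\Sigma)=\dim V-1$ and $H(\Sigma)\in S(R)$; $\psi(w)$ is the intersection of the lower shards of $wB$. The map $\psi:W\to\Psi$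 is a bijection, and the shard intersection order is $u\preceq w$ iff $\psi(u)\supseteq\psi(w)$; it is a lattice with minimum $1$ and maximum $w_0$. For $J\subseteq S$, $W_J$ is the subgroup generated by $J$. *)

theory Defs
  imports
    "HOL-Analysis.Analysis"
    "HOL-Algebra.Generated_Groups"
    "HOL-Algebra.Multiplicative_Group"
    "HOL-Algebra.Group_Action"
begin

section \<open>Coxeter systems\<close>

definition word_prod :: "('g, 'm) monoid_scheme \<Rightarrow> 'g list \<Rightarrow> 'g" where
  "word_prod W xs = foldr (\<otimes>\<^bsub>W\<^esub>) xs \<one>\<^bsub>W\<^esub>"

text \<open>
  Deletion of one relator \<open>(s t)^m(s,t)\<close>, where \<open>m(s,t)\<close> is the order of \<open>s t\<close> in \<open>W\<close>.
  An infinite order is represented by \<open>group.ord\<close> as \<open>0\<close> and then gives the empty relator.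
\<close>

definition coxeter_step :: "('g, 'm) monoid_scheme \<Rightarrow> 'g set \<Rightarrow> 'g list \<Rightarrow> 'g list \<Rightarrow> bool" where
  "coxeter_step W S xs ys \<longleftrightarrow>
     (\<exists>us vs. \<exists>s\<in>S. \<exists>t\<in>S.
        xs = us @ concat (replicate (group.ord W (s \<otimes>\<^bsub>W\<^esub> t)) [s, t]) @ vs \<and>
        ys = us @ vs)"

text \<open>
  \<open>W\<close> is presented by generators \<open>S\<close> and relators \<open>(s t)^m(s,t)\<close>. Since \<open>m(s,s) = 1\<close> makes every
  generator its own inverse, the group presentation is the quotient of the free monoid of words
  in \<open>S\<close> by the congruence that the relators generate.
\<close>

locale coxeter_system = group W for W :: "('g, 'm) monoid_scheme" (structure) +
  fixes S :: "'g set"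
  assumes S_carrier: "S \<subseteq> carrier W"
    and S_order_two: "s \<in> S \<Longrightarrow> s \<noteq> \<one> \<and> s \<otimes> s = \<one>"
    and S_generates: "generate W S = carrier W"
    and S_presentation:
      "\<lbrakk>xs \<in> lists S; ys \<in> lists S; word_prod W xs = word_prod W ys\<rbrakk>
        \<Longrightarrow> equivclp (coxeter_step W S) xs ys"

definition coxeter_length :: "('g, 'm) monoid_scheme \<Rightarrow> 'g set \<Rightarrow> 'g \<Rightarrow> nat" where
  "coxeter_length W S w = (LEAST n. \<exists>xs\<in>lists S. length xs = n \<and> word_prod W xs = w)"

definition longest_element :: "('g, 'm) monoid_scheme \<Rightarrow> 'g set \<Rightarrow> 'g" where
  "longest_element W S = arg_max_on (coxeter_length W S) (carrier W)"

definition parabolic :: "('g, 'm) monoid_scheme \<Rightarrow> 'g set \<Rightarrow> 'g set" where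
  "parabolic W J = generate W J"

definition coxeter_reflections :: "('g, 'm) monoid_scheme \<Rightarrow> 'g set \<Rightarrow> 'g set" where
  "coxeter_reflections W S = {w \<otimes>\<^bsub>W\<^esub> s \<otimes>\<^bsub>W\<^esub> inv\<^bsub>W\<^esub> w | w s. w \<in> carrier W \<and> s \<in> S}"


section \<open>Regions of hyperplane arrangements\<close>

definition regions :: "'v::euclidean_space set set \<Rightarrow> 'v set set" where
  "regions \<A> = closure ` components (UNIV - \<Union>\<A>)"

definition facet_hyperplanes :: "'v::euclidean_space set \<Rightarrow> 'v set set" where
  "facet_hyperplanes R = {affine hull F | F. F facet_of R}"

text \<open>
  Regions are full-dimensional, so lying in opposite closed half-spaces bounded by \<open>H\<close> means
  that \<open>H\<close> separates the interiors.
\<close>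

definition separating_hyperplanes ::
    "'v::euclidean_space set set \<Rightarrow> 'v set \<Rightarrow> 'v set \<Rightarrow> 'v set set" where
  "separating_hyperplanes \<A> B R =
     {H \<in> \<A>. \<exists>a b. a \<noteq> 0 \<and> H = {x. a \<bullet> x = b} \<and>
                    R \<subseteq> {x. a \<bullet> x \<le> b} \<and> B \<subseteq> {x. a \<bullet> x \<ge> b}}"


section \<open>Shards\<close>

definition rank_two_subarrangement ::
    "'v::euclidean_space set set \<Rightarrow> 'v set \<Rightarrow> 'v set \<Rightarrow> 'v set set" where
  "rank_two_subarrangement \<A> H H' = {K \<in> \<A>. H \<inter> H' \<subseteq> K}"

definition basic_hyperplanes ::
    "'v::euclidean_space set set \<Rightarrow> 'v set \<Rightarrow> 'v set \<Rightarrow> 'v set \<Rightarrow> 'v set set" where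
  "basic_hyperplanes \<A> B H H' =
     facet_hyperplanes (THE R. R \<in> regions (rank_two_subarrangement \<A> H H') \<and> B \<subseteq> R)"

definition cuts ::
    "'v::euclidean_space set set \<Rightarrow> 'v set \<Rightarrow> 'v set \<Rightarrow> 'v set \<Rightarrow> bool" where
  "cuts \<A> B H H' \<longleftrightarrow>
     H \<in> \<A> \<and> H' \<in> \<A> \<and> H \<noteq> H' \<and>
     H \<in> basic_hyperplanes \<A> B H H' \<and> H' \<notin> basic_hyperplanes \<A> B H H'"

definition shards_in ::
    "'v::euclidean_space set set \<Rightarrow> 'v set \<Rightarrow> 'v set \<Rightarrow> 'v set set" where
  "shards_in \<A> B H = closure ` components (H - \<Union>{K \<in> \<A>. cuts \<A> B K H})"

definition shards :: "'v::euclidean_space set set \<Rightarrow> 'v set \<Rightarrow> 'v set set" where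
  "shards \<A> B = (\<Union>H\<in>\<A>. shards_in \<A> B H)"

definition shard_hyperplane :: "'v::euclidean_space set set \<Rightarrow> 'v set \<Rightarrow> 'v set" where
  "shard_hyperplane \<A> \<Sigma> = (THE H. H \<in> \<A> \<and> \<Sigma> \<subseteq> H)"

definition lower_shards ::
    "'v::euclidean_space set set \<Rightarrow> 'v set \<Rightarrow> 'v set \<Rightarrow> 'v set set" where
  "lower_shards \<A> B R =
     {\<Sigma> \<in> shards \<A> B. aff_dim (R \<inter> \<Sigma>) = int DIM('v) - 1 \<and>
                       shard_hyperplane \<A> \<Sigma> \<in> separating_hyperplanes \<A> B R}"


section \<open>Coxeter groups acting as reflection groups and the shard intersection order\<close>

definition is_reflection :: "('v::euclidean_space \<Rightarrow> 'v) \<Rightarrow> bool" where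
  "is_reflection f \<longleftrightarrow> (\<exists>a. a \<noteq> 0 \<and> (\<forall>x. f x = x - (2 * (a \<bullet> x) / (a \<bullet> a)) *\<^sub>R a))"

definition fixed_hyperplane :: "('g \<Rightarrow> 'v \<Rightarrow> 'v) \<Rightarrow> 'g \<Rightarrow> 'v::euclidean_space set" where
  "fixed_hyperplane \<rho> t = {x. \<rho> t x = x}"

definition reflection_arrangement ::
    "('g, 'm) monoid_scheme \<Rightarrow> 'g set \<Rightarrow> ('g \<Rightarrow> 'v \<Rightarrow> 'v) \<Rightarrow> 'v::euclidean_space set set" where
  "reflection_arrangement W S \<rho> = fixed_hyperplane \<rho> ` coxeter_reflections W S"

text \<open>
  A base region \<open>B\<close> with walls \<open>{H_s : s \<in> S}\<close> is a datum: it is not determined by \<open>(W, S)\<close> and the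
  action (\<open>-B\<close> has the same walls), and it need not exist for an arbitrary faithful orthogonal
  action in which the elements of \<open>S\<close> act as reflections (take the dihedral group of order \<open>10\<close>,
  with simple reflections whose mirrors are at angle \<open>2\<pi>/5\<close>).
\<close>

locale finite_coxeter_reflection_group =
  coxeter_system W S + faithful_action W UNIV \<rho>
  for W :: "('g, 'm) monoid_scheme" (structure)
    and S :: "'g set"
    and \<rho> :: "'g \<Rightarrow> 'v::euclidean_space \<Rightarrow> 'v" +
  fixes B :: "'v set"
  assumes finite_W: "finite (carrier W)"
    and orthogonal: "w \<in> carrier W \<Longrightarrow> orthogonal_transformation (\<rho> w)"
    and reflection: "s \<in> S \<Longrightarrow> is_reflection (\<rho> s)"
    and base_region: "B \<in> regions (reflection_arrangement W S \<rho>)"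
    and base_region_walls: "facet_hyperplanes B = fixed_hyperplane \<rho> ` S"

text \<open>The intersection of the empty set of shards is \<open>\<Inter>{} = UNIV\<close>, the whole space.\<close>

definition shard_intersection ::
    "('g, 'm) monoid_scheme \<Rightarrow> 'g set \<Rightarrow> ('g \<Rightarrow> 'v \<Rightarrow> 'v) \<Rightarrow> 'v::euclidean_space set
      \<Rightarrow> 'g \<Rightarrow> 'v set" where
  "shard_intersection W S \<rho> B w = \<Inter>(lower_shards (reflection_arrangement W S \<rho>) B (\<rho> w ` B))"

definition shard_order ::
    "('g, 'm) monoid_scheme \<Rightarrow> 'g set \<Rightarrow> ('g \<Rightarrow> 'v \<Rightarrow> 'v) \<Rightarrow> 'v::euclidean_space set
      \<Rightarrow> 'g rel" where
  "shard_order W S \<rho> B =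
     {(u, w). u \<in> carrier W \<and> w \<in> carrier W \<and>
              shard_intersection W S \<rho> B u \<supseteq> shard_intersection W S \<rho> B w}"


section \<open>Moebius function of a finite poset\<close>

text \<open>
  A relation that is not a finite partial order gets the junk value \<open>0\<close>, which makes the
  recursion terminate; for a finite partial order the value \<open>0\<close> off the relation is the usual
  convention.
\<close>

function poset_moebius :: "'a rel \<Rightarrow> 'a \<Rightarrow> 'a \<Rightarrow> int" where
  "poset_moebius r x y =
     (if finite r \<and> Partial_order r \<and> (x, y) \<in> r
      then if x = y then 1
           else - (\<Sum>z\<in>{z. (x, z) \<in> r \<and> (z, y) \<in> r \<and> z \<noteq> y}. poset_moebius r x z)
      else 0)"
  by pat_completeness auto

termination
proof (relation "Wellfounded.measure (\<lambda>(r, x, y). card {z. (z, y) \<in> r})", goal_cases)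
  case 1
  show ?case by simp
next
  case (2 r x y z)
  then have "finite r" by simp
  then have fin: "finite {z. (z, y) \<in> r}"
    by (rule finite_surj[of _ _ fst]) force
  have po: "trans r" "antisym r" "refl_on (Field r) r"
    using 2 by (auto dest: partial_order_onD)
  have "y \<in> Field r" using 2 by (auto simp: Field_def)
  then have "(y, y) \<in> r" using po(3) by (auto dest: refl_onD)
  moreover have "(y, z) \<notin> r" using 2 po(2) by (auto dest: antisymD)
  moreover have "{v. (v, z) \<in> r} \<subseteq> {v. (v, y) \<in> r}" using 2 po(1) by (auto dest: transD)
  ultimately have "{v. (v, z) \<in> r} \<subset> {v. (v, y) \<in> r}" by blast
  then show ?case using fin by (auto intro: psubset_card_mono)
qed

declare poset_moebius.simps [simp del]

end

theory Submission
  imports Defs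
begin

text \<open>
  Identify \<open>w\<close> with the positive system of the chamber \<open>wB\<close>. Its lower walls span a flat, and \<open>\<psi>(w)\<close> is
  the full-dimensional cone in the orthogonal complement of that flat cut out by the signs which \<open>w\<close>
  gives to the roots that cut its lower walls. Such a datum (lower walls, signs) determines \<open>w\<close>: among
  the chambers compatible with it, one may pass downwards through any further lower wall; this
  rewriting terminates, is confluent because a wall that is basic in a parabolic subsystem is not cut
  inside it, and all compatible chambers are connected, so there is exactly one normal form.

  Hence the interval below \<open>w\<close> corresponds to the chambers of the parabolic subsystem \<open>\<Phi>\<^sub>L\<close> of the roots
  in the flat, in a way that preserves lower walls. Put \<open>f(w) = \<Sum>\<^sub>I (-1)\<^bsup>|I|\<^esup> |W\<^sub>I|\<close> over the sets \<open>I\<close> of lower walls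
  of \<open>w\<close>, where \<open>|W\<^sub>I|\<close> is the number of chambers of \<open>\<Phi>\<^sub>I\<close>. Summed over all chambers of a nonempty root system, \<open>f\<close>
  counts pairs (chamber, face of it) with the sign of the codimension of the face, which gives \<open>0\<close>.
  So \<open>f\<close> satisfies the recursion of \<open>w \<mapsto> \<mu>(1, w)\<close>, and \<open>f(w\<^sub>0)\<close> is the alternating sum over all \<open>J \<subseteq> S\<close>.
\<close>

section \<open>Root systems and their chambers\<close>

text \<open>A face of a chamber \<open>C\<close> is recorded by a set \<open>I\<close> of simple
  roots of \<open>C\<close>, and the chambers around it are the sets
  \<open>(C - span I) \<union> E\<close> with \<open>E\<close> a chamber of
  \<open>\<Phi> \<inter> span I\<close>. So local geometry becomes set algebra, and parabolic
  subsystems obey the same lemmas as the full system. If \<open>I\<close> consists of lower walls of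
  \<open>C\<close>, then \<open>C\<close> induces on \<open>span I\<close> the negative of what
  \<open>P\<close> induces, so \<open>C\<close> is the top chamber around the face and the pair
  \<open>(C, I)\<close> amounts to that face. The factor counting the chambers of
  \<open>\<Phi> \<inter> span I\<close> then chooses a chamber having this face, which is why the
  sum of \<open>f\<close> runs over pairs of a chamber and a subset of its simple roots and vanishes
  chamber by chamber. Injectivity of \<psi> and the matching of an interval with a smaller system
  both come from uniqueness of the normal form. Its delicate case is that of two compatible chambers
  separated along a face: every root of the enlarged flat outside the old one changes sign, so it
  has no prescribed sign and cuts no wall of the datum, and this makes the neighbouring chambers
  comparable.\<close>

definition root_system :: "'v::euclidean_space set \<Rightarrow> bool" where
  "root_system \<Phi> \<longleftrightarrow> finite \<Phi> \<and> (\<forall>a\<in>\<Phi>. norm a = 1) \<and>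
     (\<forall>a\<in>\<Phi>. \<forall>c\<in>\<Phi>. c - (2 * (a \<bullet> c)) *\<^sub>R a \<in> \<Phi>)"

text \<open>A chamber is encoded by its set of positive roots.\<close>

definition chamber :: "'v::euclidean_space set \<Rightarrow> 'v set \<Rightarrow> bool" where
  "chamber \<Phi> C \<longleftrightarrow> (\<exists>z. (\<forall>a\<in>\<Phi>. a \<bullet> z \<noteq> 0) \<and> C = {a \<in> \<Phi>. a \<bullet> z > 0})"

text \<open>Indecomposability with respect to two terms suffices, see \<open>simples_basis\<close>.\<close>

definition simples :: "'v::euclidean_space set \<Rightarrow> 'v set" where
  "simples C = {a \<in> C. \<not> (\<exists>c\<in>C. \<exists>d\<in>C. \<exists>p>0. \<exists>q>0. c \<noteq> a \<and> a = p *\<^sub>R c + q *\<^sub>R d)}"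

definition nncone :: "'v::euclidean_space set \<Rightarrow> 'v set" where
  "nncone D = {x. \<exists>f. (\<forall>d\<in>D. 0 \<le> f d) \<and> x = (\<Sum>d\<in>D. f d *\<^sub>R d)}"

lemma root_system_norm: "root_system \<Phi> \<Longrightarrow> a \<in> \<Phi> \<Longrightarrow> norm a = 1"
  by (auto simp: root_system_def)

lemma root_system_inner_self: "root_system \<Phi> \<Longrightarrow> a \<in> \<Phi> \<Longrightarrow> a \<bullet> a = 1"
  by (simp add: root_system_norm dot_square_norm)

lemma root_system_nonzero: "root_system \<Phi> \<Longrightarrow> a \<in> \<Phi> \<Longrightarrow> a \<noteq> 0"
  by (auto simp: root_system_def)

lemma root_system_finite: "root_system \<Phi> \<Longrightarrow> finite \<Phi>"
  by (auto simp: root_system_def)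

lemma root_system_reflect:
  "root_system \<Phi> \<Longrightarrow> a \<in> \<Phi> \<Longrightarrow> c \<in> \<Phi> \<Longrightarrow> c - (2 * (a \<bullet> c)) *\<^sub>R a \<in> \<Phi>"
  by (auto simp: root_system_def)

lemma root_system_uminus:
  assumes "root_system \<Phi>" "a \<in> \<Phi>" shows "- a \<in> \<Phi>"
proof -
  have "a - (2 * (a \<bullet> a)) *\<^sub>R a = - a"
    using root_system_inner_self[OF assms] by (simp add: scaleR_2)
  then show ?thesis using root_system_reflect[OF assms(1) assms(2) assms(2)] by simp
qed

lemma root_system_parallel:
  assumes "root_system \<Phi>" "a \<in> \<Phi>" "c \<in> \<Phi>" "c = t *\<^sub>R a" shows "c = a \<or> c = - a"
proof -
  have "\<bar>t\<bar> = 1" using assms root_system_norm[OF assms(1)] by (metis mult.right_neutral norm_scaleR)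
  then show ?thesis using assms(4) by (auto simp: abs_if split: if_splits)
qed

lemma root_system_span: "root_system \<Phi> \<Longrightarrow> root_system (\<Phi> \<inter> span I)"
  unfolding root_system_def by (auto intro: span_diff span_scale)

lemma chamber_subset: "chamber \<Phi> C \<Longrightarrow> C \<subseteq> \<Phi>"
  by (auto simp: chamber_def)

lemma chamber_finite: "root_system \<Phi> \<Longrightarrow> chamber \<Phi> C \<Longrightarrow> finite C"
  using chamber_subset root_system_finite finite_subset by blast

lemma chamber_span: "chamber \<Phi> C \<Longrightarrow> chamber (\<Phi> \<inter> span I) (C \<inter> span I)"
  unfolding chamber_def by blast

lemma chamber_uminus_iff:
  assumes "root_system \<Phi>" "chamber \<Phi> C" "a \<in> \<Phi>" shows "- a \<in> C \<longleftrightarrow> a \<notin> C"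
proof -
  obtain z where "\<forall>a\<in>\<Phi>. a \<bullet> z \<noteq> 0" "C = {a \<in> \<Phi>. a \<bullet> z > 0}"
    using assms(2) by (auto simp: chamber_def)
  then show ?thesis using assms root_system_uminus[OF assms(1)]
    by (auto simp: not_less order_less_le)
qed

lemma chamber_uminus:
  assumes "root_system \<Phi>" "chamber \<Phi> C" shows "chamber \<Phi> (uminus ` C)"
proof -
  obtain z where z: "\<forall>a\<in>\<Phi>. a \<bullet> z \<noteq> 0" "C = {a \<in> \<Phi>. a \<bullet> z > 0}"
    using assms(2) by (auto simp: chamber_def)
  have "uminus ` C = {a \<in> \<Phi>. a \<bullet> (- z) > 0}"
    using z root_system_uminus[OF assms(1)] by (force simp: image_iff)
  then show ?thesis unfolding chamber_def using z by (intro exI[of _ "- z"]) auto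
qed

lemma uminus_eq_image_iff: "(- a \<in> uminus ` C) = (a \<in> (C::'v::euclidean_space set))"
  by (metis image_eqI image_iff minus_minus)

lemma uminus_mem_image_iff: "(a \<in> uminus ` C) = (- a \<in> (C::'v::euclidean_space set))"
  using uminus_eq_image_iff[of "- a" C] by simp

lemma uminus_uminus_image: "uminus ` uminus ` C = (C::'v::euclidean_space set)"
  by (simp add: image_image)

lemma simples_subset: "simples C \<subseteq> C"
  by (auto simp: simples_def)

lemma simples_uminus: "simples (uminus ` C) = uminus ` simples C"
proof -
  have *: "simples (uminus ` C) \<subseteq> uminus ` simples C" for C :: "'a set"
  proof
    fix a assume a: "a \<in> simples (uminus ` C)"
    have "- a \<in> simples C"
    proof (rule ccontr)
      assume "- a \<notin> simples C"
      moreover have "- a \<in> C" using a simples_subset by (fastforce simp: uminus_mem_image_iff)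
      ultimately obtain c d p q where c: "c \<in> C" "d \<in> C" "p > 0" "q > 0" "c \<noteq> - a"
        "- a = p *\<^sub>R c + q *\<^sub>R d" by (auto simp: simples_def)
      then have "a = p *\<^sub>R (- c) + q *\<^sub>R (- d)" by (metis add.inverse_inverse minus_add_distrib scaleR_minus_right)
      moreover have "- c \<in> uminus ` C" "- d \<in> uminus ` C" "- c \<noteq> a" using c by auto
      ultimately show False using a c(3,4) unfolding simples_def by blast
    qed
    then show "a \<in> uminus ` simples C" by (simp add: uminus_mem_image_iff)
  qed
  have "uminus ` simples C \<subseteq> simples (uminus ` C)"
    using *[of "uminus ` C"] by (auto simp: uminus_uminus_image uminus_mem_image_iff subset_iff)
  then show ?thesis using * by blast
qed

lemma simples_mono: "a \<in> simples C \<Longrightarrow> a \<in> D \<Longrightarrow> D \<subseteq> C \<Longrightarrow> a \<in> simples D"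
  unfolding simples_def by blast

section \<open>Nonnegative cones and the basis of simple roots\<close>

lemma nncone_add: "x \<in> nncone D \<Longrightarrow> y \<in> nncone D \<Longrightarrow> x + y \<in> nncone D"
  unfolding nncone_def
proof clarsimp
  fix f g :: "'a \<Rightarrow> real" assume "\<forall>d\<in>D. 0 \<le> f d" "\<forall>d\<in>D. 0 \<le> g d"
  then show "\<exists>h. (\<forall>d\<in>D. 0 \<le> h d) \<and> (\<Sum>d\<in>D. f d *\<^sub>R d) + (\<Sum>d\<in>D. g d *\<^sub>R d) = (\<Sum>d\<in>D. h d *\<^sub>R d)"
    by (intro exI[of _ "\<lambda>d. f d + g d"]) (auto simp: scaleR_add_left sum.distrib)
qed

lemma nncone_scale: "x \<in> nncone D \<Longrightarrow> 0 \<le> t \<Longrightarrow> t *\<^sub>R x \<in> nncone D"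
  unfolding nncone_def
proof clarsimp
  fix f :: "'a \<Rightarrow> real" assume "\<forall>d\<in>D. 0 \<le> f d" "0 \<le> t"
  then show "\<exists>h. (\<forall>d\<in>D. 0 \<le> h d) \<and> t *\<^sub>R (\<Sum>d\<in>D. f d *\<^sub>R d) = (\<Sum>d\<in>D. h d *\<^sub>R d)"
    by (intro exI[of _ "\<lambda>d. t * f d"]) (auto simp: scaleR_sum_right)
qed

lemma nncone_base: assumes "finite D" "d \<in> D" shows "d \<in> nncone D"
proof -
  have "d = (\<Sum>e\<in>D. (if e = d then 1 else 0) *\<^sub>R e)"
    using assms by (simp add: if_distrib[of "\<lambda>t. t *\<^sub>R _"] sum.delta cong: if_cong)
  then show ?thesis unfolding nncone_def by (intro CollectI exI[of _ "\<lambda>e. if e = d then 1 else 0"]) auto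
qed

lemma nncone_zero: "0 \<in> nncone D"
  unfolding nncone_def by (intro CollectI exI[of _ "\<lambda>_. 0"]) auto

lemma nncone_sum:
  "(\<And>d. d \<in> E \<Longrightarrow> 0 \<le> f d) \<Longrightarrow> (\<And>d. d \<in> E \<Longrightarrow> d \<in> nncone D) \<Longrightarrow> (\<Sum>d\<in>E. f d *\<^sub>R d) \<in> nncone D"
  by (induction E rule: infinite_finite_induct) (auto intro: nncone_zero nncone_add nncone_scale)

lemma nncone_trans: "D \<subseteq> nncone E \<Longrightarrow> nncone D \<subseteq> nncone E"
  unfolding nncone_def[of D] by (auto intro!: nncone_sum)

lemma nncone_split:
  assumes "x \<in> nncone D" "finite D" "c \<in> D"
  obtains t y where "t \<ge> 0" "y \<in> nncone (D - {c})" "x = t *\<^sub>R c + y"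
proof -
  obtain f where f: "\<forall>d\<in>D. 0 \<le> f d" "x = (\<Sum>d\<in>D. f d *\<^sub>R d)"
    using assms by (auto simp: nncone_def)
  have "(\<Sum>d\<in>D-{c}. f d *\<^sub>R d) \<in> nncone (D - {c})"
    using f(1) unfolding nncone_def by auto
  moreover have "x = f c *\<^sub>R c + (\<Sum>d\<in>D-{c}. f d *\<^sub>R d)"
    using f assms by (simp add: sum.remove)
  ultimately show ?thesis using that f(1) assms(3) by blast
qed

lemma nncone_inner_nonneg:
  assumes "x \<in> nncone D" "\<And>d. d \<in> D \<Longrightarrow> 0 \<le> d \<bullet> z" shows "0 \<le> x \<bullet> z"
  using assms by (auto simp: nncone_def inner_sum_left intro!: sum_nonneg)

text \<open>A linear relation splits into its positive and negative parts, which give two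
  expressions for one vector \<open>v\<close>. Obtuse angles force
  \<open>v \<bullet> v \<le> 0\<close>, so \<open>v = 0\<close>; pairing either part with
  \<open>z\<close> then leaves a vanishing sum of positive terms, so both parts are empty.\<close>

lemma obtuse_independent:
  fixes D :: "'v::euclidean_space set"
  assumes fin: "finite D" and pos: "\<And>d. d \<in> D \<Longrightarrow> d \<bullet> z > 0"
    and obt: "\<And>d e. d \<in> D \<Longrightarrow> e \<in> D \<Longrightarrow> d \<noteq> e \<Longrightarrow> d \<bullet> e \<le> 0"
  shows "independent D"
proof (rule independent_if_scalars_zero[OF fin])
  fix u x assume z: "(\<Sum>d\<in>D. u d *\<^sub>R d) = 0" and x: "x \<in> D"
  define P where "P = {d\<in>D. u d > 0}"
  define N where "N = {d\<in>D. u d < 0}"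
  define v where "v = (\<Sum>d\<in>P. u d *\<^sub>R d)"
  have "(\<Sum>d\<in>D. u d *\<^sub>R d) = (\<Sum>d\<in>P \<union> N. u d *\<^sub>R d)"
    by (rule sum.mono_neutral_right) (auto simp: P_def N_def fin)
  also have "\<dots> = v + (\<Sum>d\<in>N. u d *\<^sub>R d)" unfolding v_def
    by (rule sum.union_disjoint) (auto simp: P_def N_def fin)
  finally have v2: "v = (\<Sum>d\<in>N. (- u d) *\<^sub>R d)" using z by (simp add: sum_negf eq_neg_iff_add_eq_0)
  have "v \<bullet> v = (\<Sum>d\<in>P. u d *\<^sub>R d) \<bullet> (\<Sum>e\<in>N. (- u e) *\<^sub>R e)"
    using v2 unfolding v_def by simp
  also have "\<dots> = (\<Sum>d\<in>P. (u d *\<^sub>R d) \<bullet> (\<Sum>e\<in>N. (- u e) *\<^sub>R e))"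
    by (rule inner_sum_left)
  also have "\<dots> = (\<Sum>d\<in>P. \<Sum>e\<in>N. (u d * - u e) * (d \<bullet> e))"
    by (intro sum.cong refl) (simp add: inner_sum_right sum_distrib_left mult.assoc mult.left_commute)
  also have "\<dots> \<le> 0"
  proof (intro sum_nonpos)
    fix d e assume "d \<in> P" "e \<in> N"
    then have "u d * - u e \<ge> 0" "d \<bullet> e \<le> 0"
      using obt[of d e] by (cases "d = e"; auto simp: P_def N_def mult_nonneg_nonpos)+
    then show "(u d * - u e) * (d \<bullet> e) \<le> 0" by (rule mult_nonneg_nonpos)
  qed
  finally have v0: "v = 0" by (metis inner_eq_zero_iff inner_ge_zero order_antisym)
  have "v \<bullet> z = (\<Sum>d\<in>P. u d * (d \<bullet> z))" unfolding v_def by (simp add: inner_sum_left)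
  then have "0 = (\<Sum>d\<in>P. u d * (d \<bullet> z))" using v0 by simp
  then have "P = {}" using fin pos sum_pos[of P "\<lambda>d. u d * (d \<bullet> z)"] by (force simp: P_def)
  moreover have "0 = (\<Sum>d\<in>N. - u d * (d \<bullet> z))"
    using arg_cong[OF v2, of "\<lambda>y. y \<bullet> z"] v0 by (simp add: inner_sum_left del: )
  then have "N = {}" using fin pos sum_pos[of N "\<lambda>d. - u d * (d \<bullet> z)"]
    by (force simp: N_def mult_less_0_iff)
  ultimately show "u x = 0" using x by (force simp: P_def N_def not_less intro: antisym)
qed

text \<open>The basis is found as a subset \<open>D\<close> of \<open>C\<close> of least cardinality
  whose cone contains \<open>C\<close>. Minimality makes its angles obtuse, hence \<open>D\<close>
  is independent, and uniqueness of coefficients then identifies \<open>D\<close> with the two-term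
  indecomposable roots.\<close>

lemma simples_basis:
  fixes \<Phi> :: "'v::euclidean_space set"
  assumes R: "root_system \<Phi>" and ch: "chamber \<Phi> C"
  shows "independent (simples C)" "C \<subseteq> nncone (simples C)"
proof -
  obtain z where z: "\<And>a. a \<in> \<Phi> \<Longrightarrow> a \<bullet> z \<noteq> 0" "C = {a \<in> \<Phi>. a \<bullet> z > 0}"
    using ch by (auto simp: chamber_def)
  have finC: "finite C" using R ch by (rule chamber_finite)
  have C\<Phi>: "a \<in> \<Phi>" "a \<bullet> z > 0" if "a \<in> C" for a using that z by auto
  have neg: "- a \<in> C" if "a \<in> \<Phi>" "a \<notin> C" for a
    using chamber_uminus_iff[OF R ch] that by blast
  define Q where "Q D \<longleftrightarrow> D \<subseteq> C \<and> C \<subseteq> nncone D" for D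
  have "Q C" unfolding Q_def using nncone_base[OF finC] by blast
  then obtain D where D: "Q D" "\<And>E. card E < card D \<Longrightarrow> \<not> Q E"
    by (metis exists_least_iff[of "\<lambda>n. \<exists>D. card D = n \<and> Q D"])
  have DC: "D \<subseteq> C" "C \<subseteq> nncone D" and finD: "finite D"
    using D finC finite_subset by (auto simp: Q_def)
  have irred: "a \<notin> nncone (D - {a})" if "a \<in> D" for a
  proof
    assume "a \<in> nncone (D - {a})"
    then have "D \<subseteq> nncone (D - {a})" using nncone_base[of "D - {a}"] finD by blast
    then have "C \<subseteq> nncone (D - {a})" using nncone_trans[of D "D - {a}"] DC(2) by (meson subset_trans)
    then have "Q (D - {a})" using DC(1) unfolding Q_def by blast
    then show False using D(2)[OF card_Diff1_less[OF finD that]] by simp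
  qed
  have irred': False if "a \<in> D" "t *\<^sub>R a \<in> nncone (D - {a})" "(t *\<^sub>R a) \<bullet> z > 0" for t a
  proof -
    have "t > 0" using that DC C\<Phi>(2)[of a] by (auto simp: zero_less_mult_iff)
    then have "(1/t) *\<^sub>R (t *\<^sub>R a) \<in> nncone (D - {a})" using nncone_scale[OF that(2), of "1/t"] by simp
    then show False using irred[OF that(1)] \<open>t > 0\<close> by simp
  qed
  have nnz: "0 \<le> y \<bullet> z" if "y \<in> nncone (D - {a})" for y a
  proof (rule nncone_inner_nonneg[OF that])
    fix d assume "d \<in> D - {a}"
    then show "0 \<le> d \<bullet> z" using DC(1) C\<Phi>(2)[of d] by auto
  qed
  \<comment> \<open>If \<open>a \<bullet> c\<close> were positive, reflect \<open>c\<close> in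
    \<open>a\<close> to get a root \<open>e\<close>. When \<open>e\<close> is positive,
    \<open>c\<close> lies in the cone of the other generators; when \<open>- e\<close> is positive,
    \<open>a\<close> does. Both contradict minimality.\<close>
  have obt: "a \<bullet> c \<le> 0" if ac: "a \<in> D" "c \<in> D" "a \<noteq> c" for a c
  proof (rule ccontr)
    assume "\<not> a \<bullet> c \<le> 0"
    then have k: "2 * (a \<bullet> c) > 0" by simp
    define e where "e = c - (2 * (a \<bullet> c)) *\<^sub>R a"
    have e\<Phi>: "e \<in> \<Phi>" unfolding e_def using ac DC C\<Phi> R by (intro root_system_reflect) auto
    show False
    proof (cases "e \<in> C")
      case True
      then obtain t y where ty: "t \<ge> 0" "y \<in> nncone (D - {c})" "e = t *\<^sub>R c + y"
        using DC finD ac nncone_split by (metis subsetD)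
      have eq: "(1 - t) *\<^sub>R c = (2 * (a \<bullet> c)) *\<^sub>R a + y"
        using ty(3) by (simp add: e_def algebra_simps)
      have "(2 * (a \<bullet> c)) *\<^sub>R a + y \<in> nncone (D - {c})"
        using ty k ac finD by (intro nncone_add[OF nncone_scale[OF nncone_base]]) auto
      moreover have "((2 * (a \<bullet> c)) *\<^sub>R a + y) \<bullet> z > 0"
        using k C\<Phi>(2)[of a] ac DC nnz[OF ty(2)] by (simp add: inner_add_left add_pos_nonneg subset_iff)
      ultimately show False using irred'[of c "1 - t"] ac eq by simp
    next
      case False
      then have "- e \<in> C" using e\<Phi> neg by blast
      then obtain t y where ty: "t \<ge> 0" "y \<in> nncone (D - {a})" "- e = t *\<^sub>R a + y"
        using DC finD ac nncone_split by (metis subsetD)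
      have eq: "(2 * (a \<bullet> c) - t) *\<^sub>R a = c + y"
        using ty(3) by (simp add: e_def algebra_simps)
      have "c + y \<in> nncone (D - {a})"
        using ty k ac finD by (intro nncone_add[OF nncone_base]) auto
      moreover have "(c + y) \<bullet> z > 0"
        using k C\<Phi>(2)[of c] ac DC nnz[OF ty(2)] by (simp add: inner_add_left add_pos_nonneg subset_iff)
      ultimately show False using irred'[of a] ac eq by metis
    qed
  qed
  have ind: "independent D"
    using obtuse_independent[of D z] finD DC C\<Phi> obt by blast
  have coeff: "f d = g d" if "(\<Sum>d\<in>D. f d *\<^sub>R d) = (\<Sum>d\<in>D. g d *\<^sub>R d)" "d \<in> D" for f g d
  proof -
    have "(\<Sum>d\<in>D. (f d - g d) *\<^sub>R d) = 0" using that by (simp add: scaleR_diff_left sum_subtractf)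
    then have "f d - g d = 0" using independentD[OF ind finD subset_refl _ that(2), of "\<lambda>d. f d - g d"] by blast
    then show ?thesis by simp
  qed
  have single: "(\<Sum>d\<in>D. (if d = a then t else 0) *\<^sub>R d) = t *\<^sub>R a" if "a \<in> D" for a t
    using finD that by (simp add: if_distrib[of "\<lambda>t. t *\<^sub>R _"] cong: if_cong)
  have "D = simples C"
  proof (intro equalityI subsetI)
    fix a assume a: "a \<in> D"
    show "a \<in> simples C"
    proof (rule ccontr)
      assume "a \<notin> simples C"
      then obtain c d p q where c: "c \<in> C" "d \<in> C" "p > 0" "q > 0" "c \<noteq> a" "a = p *\<^sub>R c + q *\<^sub>R d"
        using a DC by (auto simp: simples_def)
      obtain f where f: "\<forall>d\<in>D. 0 \<le> f d" "c = (\<Sum>d\<in>D. f d *\<^sub>R d)" using c DC by (auto simp: nncone_def)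
      obtain g where g: "\<forall>d\<in>D. 0 \<le> g d" "d = (\<Sum>d\<in>D. g d *\<^sub>R d)" using c DC by (auto simp: nncone_def)
      have "(\<Sum>d\<in>D. (p * f d + q * g d) *\<^sub>R d) = (\<Sum>d\<in>D. (if d = a then 1 else 0) *\<^sub>R d)"
        using c(6) f(2) g(2) single[OF a, of 1]
        by (simp add: scaleR_add_left sum.distrib scaleR_sum_right)
      then have "p * f e + q * g e = (if e = a then 1 else 0)" if "e \<in> D" for e
        using that by (intro coeff)
      then have "f e = 0" if "e \<in> D" "e \<noteq> a" for e
        using that f(1) g(1) c(3,4)
        by (smt (verit, best) mult_nonneg_nonneg mult_pos_pos)
      then have "c = (\<Sum>d\<in>D. (if d = a then f a else 0) *\<^sub>R d)" unfolding f(2)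
        by (intro sum.cong) auto
      then have "c = f a *\<^sub>R a" using single a by simp
      then have "c = a \<or> c = - a" using root_system_parallel[OF R] c(1) a DC C\<Phi> by blast
      then show False using c(5) C\<Phi>(2)[of a] C\<Phi>(2)[OF c(1)] a DC(1) by auto
    qed
  next
    fix a assume a: "a \<in> simples C"
    then have aC: "a \<in> C" using simples_subset by blast
    obtain f where f: "\<forall>d\<in>D. 0 \<le> f d" "a = (\<Sum>d\<in>D. f d *\<^sub>R d)" using aC DC by (auto simp: nncone_def)
    \<comment> \<open>Expanding \<open>a \<bullet> a = 1\<close> over \<open>D\<close> yields some
      \<open>d\<close> with positive coefficient and positive inner product with \<open>a\<close>.
      Reflecting \<open>a\<close> in \<open>d\<close> either splits \<open>a\<close> into two
      positive terms or forces \<open>a = d\<close>.\<close>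
    have "a \<bullet> a = (\<Sum>d\<in>D. f d * (d \<bullet> a))" by (subst f(2)) (simp add: inner_sum_left)
    then have "(\<Sum>d\<in>D. f d * (d \<bullet> a)) > 0" using root_system_inner_self[OF R] aC C\<Phi> by simp
    then obtain d where d: "d \<in> D" "f d * (d \<bullet> a) > 0"
      by (meson not_less sum_nonpos)
    then have k: "2 * (d \<bullet> a) > 0" using f(1) by (auto simp: zero_less_mult_iff)
    define e where "e = a - (2 * (d \<bullet> a)) *\<^sub>R d"
    have e\<Phi>: "e \<in> \<Phi>" unfolding e_def using aC d DC C\<Phi> R by (intro root_system_reflect) auto
    show "a \<in> D"
    proof (cases "e \<in> C")
      case True
      moreover have "a = 1 *\<^sub>R e + (2 * (d \<bullet> a)) *\<^sub>R d" by (simp add: e_def)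
      moreover have "e \<noteq> a" using k root_system_nonzero[OF R, of d] d DC C\<Phi> by (auto simp: e_def)
      moreover have "d \<in> C" using d DC by auto
      ultimately have "\<exists>c\<in>C. \<exists>d\<in>C. \<exists>p>0. \<exists>q>0. c \<noteq> a \<and> a = p *\<^sub>R c + q *\<^sub>R d"
        using k zero_less_one by blast
      then have False using a unfolding simples_def by blast
      then show ?thesis ..
    next
      case False
      then have "- e \<in> C" using e\<Phi> neg by blast
      then obtain g where g: "\<forall>d\<in>D. 0 \<le> g d" "- e = (\<Sum>d\<in>D. g d *\<^sub>R d)" using DC by (auto simp: nncone_def)
      have "(2 * (d \<bullet> a)) *\<^sub>R d = a + - e" by (simp add: e_def)
      then have "(\<Sum>e\<in>D. (if e = d then (2 * (d \<bullet> a)) else 0) *\<^sub>R e) = (\<Sum>d\<in>D. (f d + g d) *\<^sub>R d)"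
        using f(2) g(2) single[OF d(1), of "2 * (d \<bullet> a)"] by (simp add: scaleR_add_left sum.distrib)
      then have "(if e = d then (2 * (d \<bullet> a)) else 0) = f e + g e" if "e \<in> D" for e
        using that by (intro coeff)
      then have "f e = 0" if "e \<in> D" "e \<noteq> d" for e
        using that f(1) g(1) by (smt (verit, best))
      then have "a = (\<Sum>e\<in>D. (if e = d then f d else 0) *\<^sub>R e)" by (subst f(2), intro sum.cong) auto
      then have "a = f d *\<^sub>R d" using single d by simp
      then have "a = d \<or> a = - d" using root_system_parallel[OF R] aC d DC C\<Phi> by blast
      then show ?thesis using d aC C\<Phi>(2)[of d] C\<Phi>(2)[of a] DC by auto
    qed
  qed
  then show "independent (simples C)" "C \<subseteq> nncone (simples C)" using ind DC by auto
qed

section \<open>Faces of a chamber and the chambers around them\<close>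

lemma independent_dual_point:
  fixes D :: "'v::euclidean_space set"
  assumes "independent D" shows "\<exists>x. \<forall>d\<in>D. d \<bullet> x = g d"
proof -
  obtain f :: "'v \<Rightarrow> real" where f: "linear f" "\<forall>d\<in>D. f d = g d"
    using linear_independent_extend[OF assms] by blast
  have "d \<bullet> adjoint f 1 = f d" for d using adjoint_works[OF f(1), of d 1] by simp
  then show ?thesis using f(2) by metis
qed

lemma span_inner_zero:
  fixes I :: "'v::euclidean_space set"
  assumes "c \<in> span I" "\<And>d. d \<in> I \<Longrightarrow> d \<bullet> x = 0" shows "c \<bullet> x = 0"
  using orthogonal_to_span[of c I x] assms by (auto simp: orthogonal_def inner_commute)

lemma span_uminus_image: "span (uminus ` L) = span (L :: 'v::euclidean_space set)"
proof
  show "span (uminus ` L) \<subseteq> span L" by (intro span_minimal) (auto intro: span_neg span_base)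
  have "- (- a) \<in> span (uminus ` L)" if "a \<in> L" for a
    using that by (intro span_neg span_base) auto
  then show "span L \<subseteq> span (uminus ` L)" by (intro span_minimal) auto
qed

lemma chamber_eqI:
  assumes "root_system \<Phi>" "chamber \<Phi> C" "chamber \<Phi> D" "C \<subseteq> D" shows "C = D"
proof
  show "D \<subseteq> C"
  proof
    fix a assume a: "a \<in> D"
    then have "a \<in> \<Phi>" using chamber_subset assms by blast
    then show "a \<in> C" using chamber_uminus_iff[OF assms(1,2), of a] chamber_uminus_iff[OF assms(1,3), of a] a assms(4) by blast
  qed
qed fact

lemma chamber_parallel:
  assumes "root_system \<Phi>" "chamber \<Phi> C" "a \<in> C" "c \<in> C" "c \<in> span {a}" shows "c = a"
proof -
  obtain t where "c = t *\<^sub>R a" using assms(5) by (auto simp: span_singleton)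
  moreover have "a \<in> \<Phi>" "c \<in> \<Phi>" using assms chamber_subset by blast+
  ultimately have "c = a \<or> c = - a" using root_system_parallel[OF assms(1)] by blast
  then show ?thesis using chamber_uminus_iff[OF assms(1,2) \<open>a \<in> \<Phi>\<close>] assms by auto
qed

lemma chamber_eq_of_simples:
  assumes R: "root_system \<Phi>" and C: "chamber \<Phi> C" and D: "chamber \<Phi> D" and s: "simples C \<subseteq> D"
  shows "C = D"
proof (rule chamber_eqI[OF R C D])
  obtain z where z: "\<forall>a\<in>\<Phi>. a \<bullet> z \<noteq> 0" "D = {a \<in> \<Phi>. a \<bullet> z > 0}"
    using D by (auto simp: chamber_def)
  show "C \<subseteq> D"
  proof
    fix c assume c: "c \<in> C"
    have "0 \<le> c \<bullet> z"
      by (rule nncone_inner_nonneg[of _ "simples C"]) (use simples_basis[OF R C] c s z in auto)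
    then show "c \<in> D" using z c chamber_subset[OF C] by (auto simp: order_less_le)
  qed
qed

text \<open>The point \<open>x\<close> lies in the relative interior of the face of \<open>C\<close>
  on which \<open>I\<close> vanishes. A dual vector with value 0 on \<open>I\<close> and 1 on the
  other simple roots works, because a root of \<open>C\<close> outside \<open>span I\<close> has a
  positive coefficient at some simple root outside \<open>I\<close>.\<close>

lemma face_point:
  assumes R: "root_system \<Phi>" and C: "chamber \<Phi> C" and I: "I \<subseteq> simples C"
  obtains x where "\<And>d. d \<in> span I \<Longrightarrow> d \<bullet> x = 0"
    "\<And>a. a \<in> \<Phi> \<Longrightarrow> a \<notin> span I \<Longrightarrow> a \<bullet> x \<noteq> 0"
    "\<And>a. a \<in> \<Phi> \<Longrightarrow> a \<notin> span I \<Longrightarrow> a \<in> C \<longleftrightarrow> a \<bullet> x > 0"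
    "\<And>a. a \<in> C \<Longrightarrow> a \<bullet> x \<ge> 0"
proof -
  obtain x where x: "\<forall>d\<in>simples C. d \<bullet> x = (if d \<in> I then 0 else 1)"
    using independent_dual_point[OF simples_basis(1)[OF R C], of "\<lambda>d. if d \<in> I then 0 else 1"] by auto
  have sp: "d \<bullet> x = 0" if "d \<in> span I" for d
    using that I x by (intro span_inner_zero[OF that]) auto
  have fin: "finite (simples C)" using chamber_finite[OF R C] simples_subset finite_subset by blast
  have pos: "c \<bullet> x > 0" if "c \<in> C" "c \<notin> span I" for c
  proof -
    obtain f where f: "\<forall>d\<in>simples C. 0 \<le> f d" "c = (\<Sum>d\<in>simples C. f d *\<^sub>R d)"
      using simples_basis(2)[OF R C] \<open>c \<in> C\<close> by (auto simp: nncone_def)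
    obtain d where d: "d \<in> simples C" "d \<notin> I" "f d \<noteq> 0"
    proof (cases "\<exists>d\<in>simples C. d \<notin> I \<and> f d \<noteq> 0")
      case False
      then have "f d *\<^sub>R d \<in> span I" if "d \<in> simples C" for d
        using that by (cases "d \<in> I") (auto intro: span_scale span_base simp: span_zero)
      then have "c \<in> span I" unfolding f(2) by (rule span_sum)
      then show ?thesis using \<open>c \<notin> span I\<close> by blast
    qed (use that in blast)
    have "c \<bullet> x = (\<Sum>d\<in>simples C. f d * (if d \<in> I then 0 else 1))"
      unfolding f(2) inner_sum_left using x by (intro sum.cong) auto
    also have "\<dots> > 0"
      by (rule sum_pos2[OF fin d(1)]) (use d f(1) in \<open>auto simp: order_less_le\<close>)
    finally show ?thesis .
  qed
  have neg: "a \<bullet> x < 0" if "a \<in> \<Phi>" "a \<notin> C" "a \<notin> span I" for a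
  proof -
    have "- a \<in> C" using chamber_uminus_iff[OF R C] that by blast
    moreover have "- a \<notin> span I" using that span_neg[of "- a" I] by auto
    ultimately show ?thesis using pos[of "- a"] by simp
  qed
  show ?thesis
  proof (rule that[OF sp])
    fix a assume a: "a \<in> \<Phi>" "a \<notin> span I"
    show "a \<bullet> x \<noteq> 0" using pos[of a] neg[of a] a by fastforce
    show "a \<in> C \<longleftrightarrow> a \<bullet> x > 0" using pos[of a] neg[of a] a by fastforce
  next
    fix a assume "a \<in> C"
    then show "a \<bullet> x \<ge> 0" using pos[of a] sp[of a] by fastforce
  qed
qed

text \<open>Indecomposability passes to subsets, so \<open>I\<close> is contained in the left side;
  the left side is independent and lies in \<open>span I\<close>, so it cannot be larger.\<close>

lemma simples_span:
  assumes R: "root_system \<Phi>" and C: "chamber \<Phi> C" and I: "I \<subseteq> simples C"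
  shows "simples (C \<inter> span I) = I"
proof
  show sub: "I \<subseteq> simples (C \<inter> span I)"
    using I simples_subset[of C] by (auto intro!: simples_mono[of _ C "C \<inter> span I"] span_base)
  have ind: "independent (simples (C \<inter> span I))"
    using simples_basis(1)[OF root_system_span[OF R] chamber_span[OF C]] .
  show "simples (C \<inter> span I) \<subseteq> I"
  proof
    fix a assume a: "a \<in> simples (C \<inter> span I)"
    then have "a \<in> span I" using simples_subset by blast
    show "a \<in> I"
    proof (rule ccontr)
      assume "a \<notin> I"
      moreover have "independent (insert a I)" using ind independent_mono a sub by blast
      ultimately show False using \<open>a \<in> span I\<close> independent_insert[of a I] by auto
    qed
  qed
qed

lemma finite_perturbation:
  fixes f g :: "'a \<Rightarrow> real"
  assumes "finite A" "\<And>a. a \<in> A \<Longrightarrow> f a > 0"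
  obtains e where "e > 0" "\<And>a. a \<in> A \<Longrightarrow> f a + e * g a > 0"
proof -
  have "\<forall>\<^sub>F e in at_right 0. f a + e * g a > 0" if "a \<in> A" for a
  proof -
    have "((\<lambda>e. f a + e * g a) \<longlongrightarrow> f a + 0 * g a) (at_right 0)"
      by (intro tendsto_intros)
    then show ?thesis using order_tendstoD(1)[of _ "f a" _ 0] assms(2)[OF that] by simp
  qed
  then have "\<forall>\<^sub>F e in at_right 0. \<forall>a\<in>A. f a + e * g a > 0"
    using assms(1) by (intro eventually_ball_finite) auto
  then have "\<forall>\<^sub>F e in at_right 0. (0::real) < e \<and> (\<forall>a\<in>A. f a + e * g a > 0)"
    using eventually_at_right_less by (intro eventually_conj) auto
  then show ?thesis using that eventually_happens'[OF trivial_limit_at_right_real] by blast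
qed

text \<open>A generic point of the new chamber is a point of the face of \<open>C\<close> given by
  \<open>I\<close>, moved slightly in a direction \<open>y\<close> that represents \<open>E\<close>:
  the face point decides the signs outside \<open>span I\<close>, and \<open>y\<close> those
  inside.\<close>

lemma chamber_replace:
  assumes R: "root_system \<Phi>" and C: "chamber \<Phi> C" and I: "I \<subseteq> simples C"
    and E: "chamber (\<Phi> \<inter> span I) E"
  shows "chamber \<Phi> ((C - span I) \<union> E)"
proof -
  obtain x where x: "\<And>d. d \<in> span I \<Longrightarrow> d \<bullet> x = 0"
    "\<And>a. a \<in> \<Phi> \<Longrightarrow> a \<notin> span I \<Longrightarrow> a \<bullet> x \<noteq> 0"
    "\<And>a. a \<in> \<Phi> \<Longrightarrow> a \<notin> span I \<Longrightarrow> a \<in> C \<longleftrightarrow> a \<bullet> x > 0"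
    using face_point[OF R C I] by metis
  obtain y where y: "\<forall>a\<in>\<Phi> \<inter> span I. a \<bullet> y \<noteq> 0" "E = {a \<in> \<Phi> \<inter> span I. a \<bullet> y > 0}"
    using E by (auto simp: chamber_def)
  have "finite (C - span I)" using chamber_finite[OF R C] by simp
  then obtain e where e: "e > 0" "\<And>a. a \<in> C - span I \<Longrightarrow> a \<bullet> x + e * (a \<bullet> y) > 0"
    using finite_perturbation[of "C - span I" "\<lambda>a. a \<bullet> x" "\<lambda>a. a \<bullet> y"] x(3) chamber_subset[OF C]
    by (metis DiffD1 DiffD2 subsetD)
  define z where "z = x + e *\<^sub>R y"
  have ins: "a \<bullet> z = e * (a \<bullet> y)" if "a \<in> span I" for a
    using x(1)[OF that] by (simp add: z_def inner_add_right)
  have pos: "a \<bullet> z > 0" if "a \<in> C" "a \<notin> span I" for a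
    using e(2)[of a] that by (simp add: z_def inner_add_right)
  have neg: "a \<bullet> z < 0" if "a \<in> \<Phi>" "a \<notin> C" "a \<notin> span I" for a
  proof -
    have "- a \<in> C" using chamber_uminus_iff[OF R C] that by blast
    moreover have "- a \<notin> span I" using that span_neg[of "- a" I] by auto
    ultimately show ?thesis using pos[of "- a"] by simp
  qed
  have nz: "a \<bullet> z \<noteq> 0" if "a \<in> \<Phi>" for a
    using that ins[of a] pos[of a] neg[of a] e(1) y(1) by (cases "a \<in> span I"; fastforce)
  have "a \<in> (C - span I) \<union> E \<longleftrightarrow> a \<in> \<Phi> \<and> a \<bullet> z > 0" for a
  proof (cases "a \<in> span I")
    case True
    then show ?thesis using chamber_subset[OF C] ins[of a] e(1) y by (auto simp: zero_less_mult_iff)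
  next
    case False
    then have "a \<notin> E" using y(2) by blast
    then show ?thesis using False chamber_subset[OF C] pos[of a] neg[of a] by fastforce
  qed
  then have "(C - span I) \<union> E = {a \<in> \<Phi>. a \<bullet> z > 0}" by blast
  then show ?thesis unfolding chamber_def using nz by blast
qed

text \<open>A face point vanishes on \<open>span I\<close> and is positive on the rest of the new
  chamber, so a decomposition of a root of \<open>E\<close> can only use roots of
  \<open>E\<close>.\<close>

lemma simples_replace:
  assumes R: "root_system \<Phi>" and C: "chamber \<Phi> C" and I: "I \<subseteq> simples C"
    and E: "E \<subseteq> span I" and a: "a \<in> simples E"
  shows "a \<in> simples ((C - span I) \<union> E)"
proof (rule ccontr)
  assume n: "a \<notin> simples ((C - span I) \<union> E)"
  have aE: "a \<in> E" using a simples_subset by blast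
  obtain c d p q where c: "c \<in> (C - span I) \<union> E" "d \<in> (C - span I) \<union> E" "p > 0" "q > 0"
    "c \<noteq> a" "a = p *\<^sub>R c + q *\<^sub>R d" using n aE unfolding simples_def by blast
  obtain x where x: "\<And>d. d \<in> span I \<Longrightarrow> d \<bullet> x = 0"
    "\<And>a. a \<in> \<Phi> \<Longrightarrow> a \<notin> span I \<Longrightarrow> a \<in> C \<longleftrightarrow> a \<bullet> x > 0"
    using face_point[OF R C I] by metis
  have nn: "e \<bullet> x \<ge> 0" "e \<notin> E \<Longrightarrow> e \<bullet> x > 0" if "e \<in> (C - span I) \<union> E" for e
    using that x(1)[of e] x(2)[of e] E chamber_subset[OF C] by (auto simp: subset_iff)
  have "p * (c \<bullet> x) + q * (d \<bullet> x) = 0"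
    using x(1)[of a] aE E c(6) by (auto simp: inner_add_left)
  then have "c \<bullet> x = 0" "d \<bullet> x = 0"
    using nn(1)[OF c(1)] nn(1)[OF c(2)] c(3,4)
    by (smt (verit) mult_nonneg_nonneg mult_pos_pos)+
  then have "c \<in> E" "d \<in> E" using nn(2) c(1,2) by fastforce+
  then show False using a c(3-6) unfolding simples_def by blast
qed

text \<open>Modulo \<open>span L\<close> the root \<open>k\<close> is a multiple of
  \<open>t\<close>, and the face points of \<open>C\<close> and of \<open>D\<close> both vanish on
  \<open>span L\<close>. So in both chambers the sign of \<open>k\<close> is obtained from that of
  \<open>t\<close> by the same factor.\<close>

lemma chamber_agree:
  assumes R: "root_system \<Phi>" and C: "chamber \<Phi> C" and D: "chamber \<Phi> D"
    and L: "L \<subseteq> simples C" "L \<subseteq> simples D" and t: "t \<in> \<Phi>" "t \<notin> span L"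
    and k: "k \<in> \<Phi>" "k \<notin> span L" "k \<in> span (insert t L)"
  shows "(k \<in> C \<longleftrightarrow> k \<in> D) \<longleftrightarrow> (t \<in> C \<longleftrightarrow> t \<in> D)"
proof -
  obtain x where x: "\<And>d. d \<in> span L \<Longrightarrow> d \<bullet> x = 0"
    "\<And>a. a \<in> \<Phi> \<Longrightarrow> a \<notin> span L \<Longrightarrow> a \<bullet> x \<noteq> 0"
    "\<And>a. a \<in> \<Phi> \<Longrightarrow> a \<notin> span L \<Longrightarrow> a \<in> C \<longleftrightarrow> a \<bullet> x > 0"
    using face_point[OF R C L(1)] by metis
  obtain y where y: "\<And>d. d \<in> span L \<Longrightarrow> d \<bullet> y = 0"
    "\<And>a. a \<in> \<Phi> \<Longrightarrow> a \<notin> span L \<Longrightarrow> a \<bullet> y \<noteq> 0"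
    "\<And>a. a \<in> \<Phi> \<Longrightarrow> a \<notin> span L \<Longrightarrow> a \<in> D \<longleftrightarrow> a \<bullet> y > 0"
    using face_point[OF R D L(2)] by metis
  obtain r where r: "k - r *\<^sub>R t \<in> span L" using k(3) by (auto simp: span_breakdown_eq)
  have kx: "k \<bullet> x = r * (t \<bullet> x)" "k \<bullet> y = r * (t \<bullet> y)"
    using x(1)[OF r] y(1)[OF r] by (auto simp: inner_diff_left)
  show ?thesis
    unfolding x(3)[OF k(1,2)] y(3)[OF k(1,2)] x(3)[OF t] y(3)[OF t] kx
    using x(2)[OF k(1,2)] y(2)[OF k(1,2)] x(2)[OF t] y(2)[OF t] unfolding kx
    by (auto simp: zero_less_mult_iff)
qed

section \<open>Cutting and lower walls\<close>

text \<open>Positive normals of the walls of \<open>C\<close> that separate it from the base chamber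
  \<open>P\<close>.\<close>

definition lower :: "'v::euclidean_space set \<Rightarrow> 'v set \<Rightarrow> 'v set" where
  "lower P C = {a \<in> P. - a \<in> simples C}"

text \<open>The relation \<open>cuts\<close> expressed by positive roots; the equivalence is
  \<open>cuts_iff_cut\<close>.\<close>

definition cut :: "'v::euclidean_space set \<Rightarrow> 'v \<Rightarrow> 'v \<Rightarrow> bool" where
  "cut P k h \<longleftrightarrow> k \<in> P \<and> h \<in> P \<and> k \<noteq> h \<and>
     k \<in> simples (P \<inter> span {h, k}) \<and> h \<notin> simples (P \<inter> span {h, k})"

definition cutters :: "'v::euclidean_space set \<Rightarrow> 'v set \<Rightarrow> 'v set" where
  "cutters P L = {k. \<exists>h\<in>L. cut P k h}"

text \<open>A root indecomposable in a flat stays indecomposable in every smaller flat that contains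
  it, in particular in the plane of \<open>h\<close> and \<open>k\<close>.\<close>

lemma cutters_notin_span:
  assumes "L \<subseteq> simples (P \<inter> span I)" "k \<in> cutters P L" shows "k \<notin> span I"
proof
  assume k: "k \<in> span I"
  obtain h where h: "h \<in> L" "cut P k h" using assms(2) by (auto simp: cutters_def)
  have hI: "h \<in> span I" "h \<in> P" using h assms(1) simples_subset by blast+
  have "span {h, k} \<subseteq> span I" using k hI by (intro span_minimal) auto
  then have "P \<inter> span {h, k} \<subseteq> P \<inter> span I" by blast
  moreover have "h \<in> P \<inter> span {h, k}" using hI by (simp add: span_base)
  moreover have "h \<in> simples (P \<inter> span I)" using h(1) assms(1) by blast
  ultimately have "h \<in> simples (P \<inter> span {h, k})" using simples_mono by blast
  then show False using h by (auto simp: cut_def)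
qed

text \<open>If \<open>h\<close> decomposes in the larger flat, its summand \<open>c\<close> leaves
  \<open>span L\<close>. The plane of \<open>h\<close> and \<open>c\<close> then has a simple root
  outside \<open>span L\<close>, and that root cuts \<open>h\<close>.\<close>

lemma simples_of_uncut:
  assumes R: "root_system \<Phi>" and P: "chamber \<Phi> P" and L: "simples (P \<inter> span L) = L"
    and nc: "\<And>k h. k \<in> P \<Longrightarrow> k \<in> span (insert t L) \<Longrightarrow> k \<notin> span L \<Longrightarrow> h \<in> L \<Longrightarrow> \<not> cut P k h"
  shows "L \<subseteq> simples (P \<inter> span (insert t L))"
proof
  fix h assume h: "h \<in> L"
  have hP: "h \<in> P" "h \<in> span L" using h L simples_subset by blast+
  have LL: "span L \<subseteq> span (insert t L)" by (intro span_mono) auto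
  show "h \<in> simples (P \<inter> span (insert t L))"
  proof (rule ccontr)
    assume "h \<notin> simples (P \<inter> span (insert t L))"
    then obtain c d p q where c: "c \<in> P" "c \<in> span (insert t L)" "d \<in> P" "d \<in> span (insert t L)"
      "p > 0" "q > 0" "c \<noteq> h" "h = p *\<^sub>R c + q *\<^sub>R d"
      using hP LL unfolding simples_def by blast
    have cL: "c \<notin> span L"
    proof
      assume cs: "c \<in> span L"
      have "q *\<^sub>R d = h - p *\<^sub>R c" using c(8) by simp
      then have "q *\<^sub>R d \<in> span L" using hP cs by (simp add: span_diff span_scale)
      then have "(1/q) *\<^sub>R (q *\<^sub>R d) \<in> span L" by (rule span_scale)
      then have "d \<in> span L" using c(6) by simp
      then have "h \<notin> simples (P \<inter> span L)" using c cs unfolding simples_def by blast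
      then show False using h L by blast
    qed
    define A where "A = P \<inter> span {h, c}"
    have hcs: "span {h, c} \<subseteq> span (insert t L)" using c(2) hP LL by (intro span_minimal) auto
    have RA: "root_system (\<Phi> \<inter> span {h, c})" "chamber (\<Phi> \<inter> span {h, c}) A"
      unfolding A_def using root_system_span[OF R] chamber_span[OF P] by auto
    have hA: "h \<in> A" and cA: "c \<in> A" unfolding A_def using hP c by (auto intro: span_base)
    have dA: "d \<in> A"
    proof -
      have "q *\<^sub>R d = h - p *\<^sub>R c" using c(8) by simp
      then have "q *\<^sub>R d \<in> span {h, c}" by (simp add: span_diff span_scale span_base)
      then have "(1/q) *\<^sub>R (q *\<^sub>R d) \<in> span {h, c}" by (rule span_scale)
      then show ?thesis unfolding A_def using c(3,6) by simp
    qed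
    have hns: "h \<notin> simples A" using c hA cA dA unfolding simples_def by blast
    have "\<not> simples A \<subseteq> span L"
    proof
      assume "simples A \<subseteq> span L"
      then have "nncone (simples A) \<subseteq> span L"
        unfolding nncone_def by (auto intro!: span_sum span_scale)
      then show False using simples_basis(2)[OF RA] cA cL by blast
    qed
    then obtain k where k: "k \<in> simples A" "k \<notin> span L" by blast
    then have kA: "k \<in> P" "k \<in> span {h, c}" using simples_subset unfolding A_def by blast+
    have kh: "k \<noteq> h" using k hP by blast
    have "span {h, k} = span {h, c}"
    proof
      show "span {h, k} \<subseteq> span {h, c}" using kA by (intro span_minimal) (auto intro: span_base)
      obtain r where r: "k - r *\<^sub>R c \<in> span {h}"
        using kA(2) by (metis insert_commute span_breakdown_eq)
      have "r \<noteq> 0" using r chamber_parallel[OF R P hP(1) kA(1)] kh by auto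
      have "k - r *\<^sub>R c \<in> span {h, k}" using r span_mono[of "{h}" "{h, k}"] by auto
      moreover have "k \<in> span {h, k}" by (simp add: span_base)
      ultimately have "k - (k - r *\<^sub>R c) \<in> span {h, k}" using span_diff by blast
      moreover have "k - (k - r *\<^sub>R c) = r *\<^sub>R c" by simp
      ultimately have "r *\<^sub>R c \<in> span {h, k}" by metis
      then have "(1/r) *\<^sub>R (r *\<^sub>R c) \<in> span {h, k}" by (rule span_scale)
      then have "c \<in> span {h, k}" using \<open>r \<noteq> 0\<close> by simp
      then show "span {h, c} \<subseteq> span {h, k}" by (intro span_minimal) (auto intro: span_base)
    qed
    then have "cut P k h" using kA hP kh k(1) hns unfolding cut_def A_def by simp
    then show False using nc[of k h] kA hcs k(2) h by blast
  qed
qed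

text \<open>Some point vanishes at exactly those roots of \<open>P \<inter> span M\<close> that lie
  in \<open>span L\<close> and is positive at the others. So \<open>a\<close> has no decomposition
  with a summand outside \<open>span L\<close>, whereas \<open>k\<close> cutting \<open>a\<close>
  would provide one.\<close>

lemma not_cut_of_simples:
  assumes R: "root_system \<Phi>" and P: "chamber \<Phi> P" and L: "L \<subseteq> simples (P \<inter> span M)"
    and a: "a \<in> span L" and k: "k \<in> span M" "k \<notin> span L"
  shows "\<not> cut P k a"
proof
  assume cut: "cut P k a"
  then have ak: "a \<in> P" "k \<in> P" by (auto simp: cut_def)
  have LM: "span L \<subseteq> span M" using L simples_subset by (intro span_minimal) blast+
  have M: "span {a, k} \<subseteq> span M" using k a LM by (intro span_minimal) auto
  obtain c d p q where c: "c \<in> P" "c \<in> span {a, k}" "d \<in> P" "d \<in> span {a, k}"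
      "p > 0" "q > 0" "c \<noteq> a" "a = p *\<^sub>R c + q *\<^sub>R d"
    using cut unfolding cut_def simples_def by (auto intro: span_base)
  have cL: "c \<notin> span L"
  proof
    assume cs: "c \<in> span L"
    obtain r where r: "c - r *\<^sub>R k \<in> span {a}"
      using c(2) by (metis insert_commute span_breakdown_eq)
    have "r \<noteq> 0" using r chamber_parallel[OF R P ak(1) c(1)] c(7) by auto
    have "c - r *\<^sub>R k \<in> span L" using r a span_minimal[of "{a}" "span L"] by auto
    then have "c - (c - r *\<^sub>R k) \<in> span L" using cs span_diff by blast
    moreover have "c - (c - r *\<^sub>R k) = r *\<^sub>R k" by simp
    ultimately have "r *\<^sub>R k \<in> span L" by metis
    then have "(1/r) *\<^sub>R (r *\<^sub>R k) \<in> span L" by (rule span_scale)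
    then show False using \<open>r \<noteq> 0\<close> k(2) by simp
  qed
  obtain x where x: "\<And>d. d \<in> span L \<Longrightarrow> d \<bullet> x = 0"
    "\<And>a. a \<in> \<Phi> \<inter> span M \<Longrightarrow> a \<notin> span L \<Longrightarrow> a \<in> P \<inter> span M \<longleftrightarrow> a \<bullet> x > 0"
    "\<And>a. a \<in> P \<inter> span M \<Longrightarrow> a \<bullet> x \<ge> 0"
    using face_point[OF root_system_span[OF R] chamber_span[OF P] L] by metis
  have "c \<bullet> x > 0" using x(2)[of c] c cL M chamber_subset[OF P] by blast
  moreover have "d \<bullet> x \<ge> 0" using x(3)[of d] c M by blast
  moreover have "p * (c \<bullet> x) + q * (d \<bullet> x) = 0"
    using x(1)[OF a] c(8) by (metis inner_add_left inner_scaleR_left)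
  ultimately show False using c(5,6) by (smt (verit) mult_nonneg_nonneg mult_pos_pos)
qed

text \<open>Without a cutter of \<open>L\<close> in \<open>span (insert k L)\<close>, the set
  \<open>L\<close> stays simple there, and then \<open>k\<close> cuts nothing in
  \<open>span L\<close>. This reduces the signs imposed by cutters of arbitrary roots of a flat to
  those imposed by cutters of its basis.\<close>

lemma cut_basic_of_cut:
  assumes R: "root_system \<Phi>" and P: "chamber \<Phi> P" and L: "simples (P \<inter> span L) = L"
    and a: "a \<in> span L" and k: "k \<notin> span L" "cut P k a"
  obtains k' h where "k' \<in> P" "k' \<in> span (insert k L)" "k' \<notin> span L" "h \<in> L" "cut P k' h"
proof (rule ccontr)
  assume "\<not> thesis"
  then have "L \<subseteq> simples (P \<inter> span (insert k L))"
    using that by (intro simples_of_uncut[OF R P L]) blast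
  then show False using not_cut_of_simples[OF R P _ a _ k(1)] k(2) by (auto intro: span_base)
qed

text \<open>The simple roots of \<open>C\<close> in \<open>span L\<close> are the negatives of the
  elements of \<open>L\<close>, which are also negative for \<open>P\<close>; a chamber is
  determined by its simple roots.\<close>

lemma lower_simples_span:
  assumes R: "root_system \<Phi>" and P: "chamber \<Phi> P" and C: "chamber \<Phi> C"
    and L: "L \<subseteq> lower P C"
  shows "C \<inter> span L = uminus ` (P \<inter> span L)" "simples (P \<inter> span L) = L"
proof -
  have sp: "span (uminus ` L) = span L"
    by (rule span_uminus_image)
  have UL: "uminus ` L \<subseteq> simples C" using L by (auto simp: lower_def)
  have s: "simples (C \<inter> span L) = uminus ` L" using simples_span[OF R C UL] sp by simp
  have ch: "chamber (\<Phi> \<inter> span L) (uminus ` (P \<inter> span L))"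
    using chamber_uminus[OF root_system_span[OF R] chamber_span[OF P]] .
  have "simples (C \<inter> span L) \<subseteq> uminus ` (P \<inter> span L)"
    unfolding s using L by (auto simp: lower_def intro: span_base)
  then show eq: "C \<inter> span L = uminus ` (P \<inter> span L)"
    by (rule chamber_eq_of_simples[OF root_system_span[OF R] chamber_span[OF C] ch])
  have "P \<inter> span L = uminus ` (C \<inter> span L)" unfolding eq uminus_uminus_image ..
  then show "simples (P \<inter> span L) = L" using s simples_uminus[of "C \<inter> span L"]
    by (simp add: uminus_uminus_image)
qed

section \<open>Chambers with prescribed lower walls and shard signs\<close>

text \<open>The chambers compatible with the data of a shard intersection: \<open>D\<close> enters
  only through its signs at the cutters of \<open>L\<close>. Lower walls beyond \<open>L\<close> are
  allowed; a chamber without any is a normal form.\<close>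

definition shard_class :: "'v::euclidean_space set \<Rightarrow> 'v set \<Rightarrow> 'v set \<Rightarrow> 'v set \<Rightarrow> 'v set set" where
  "shard_class \<Phi> P L D =
     {C. chamber \<Phi> C \<and> L \<subseteq> lower P C \<and> (\<forall>k\<in>cutters P L. k \<in> C \<longleftrightarrow> k \<in> D)}"

text \<open>When \<open>L\<close> and \<open>T\<close> are lower walls of \<open>C\<close>, it is
  the top chamber around the face they define. It is replaced by the lowest chamber around that face
  that still has \<open>L\<close> as lower walls: positive inside the flat except on
  \<open>span L\<close>.\<close>

definition descend :: "'v::euclidean_space set \<Rightarrow> 'v set \<Rightarrow> 'v set \<Rightarrow> 'v set \<Rightarrow> 'v set" where
  "descend P L C T =
     (C - span (L \<union> T)) \<union> ((P \<inter> span (L \<union> T) - span L) \<union> uminus ` (P \<inter> span L))"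

locale based_root_system =
  fixes \<Phi> P :: "'v::euclidean_space set"
  assumes R: "root_system \<Phi>" and P: "chamber \<Phi> P"
begin

lemma fin: "finite P" using chamber_finite[OF R P] .

lemma P_uminus: "a \<in> P \<Longrightarrow> - a \<notin> P"
  using chamber_uminus_iff[OF R P, of a] chamber_subset[OF P] by blast

lemma lower_subset: "lower P C \<subseteq> P - C" if "chamber \<Phi> C"
  using that chamber_uminus_iff[OF R that] chamber_subset[OF P] simples_subset
  unfolding lower_def by blast

lemma P_opposite: assumes "C \<inter> span L = uminus ` (P \<inter> span L)" shows "P \<inter> span L \<subseteq> P - C"
proof
  fix x assume x: "x \<in> P \<inter> span L"
  have "x \<notin> C"
  proof
    assume "x \<in> C"
    then have "x \<in> uminus ` (P \<inter> span L)" using assms x by blast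
    then show False using P_uminus x by (auto simp: uminus_mem_image_iff)
  qed
  then show "x \<in> P - C" using x by blast
qed

text \<open>Two nested replacements: \<open>E\<close> arises from \<open>P\<close> on the larger
  flat by taking the negative on \<open>span L\<close>, and then replaces the part of
  \<open>C\<close> in that flat. The prescribed signs survive because \<open>L\<close> is part of
  the basis of the flat, so by \<open>cutters_notin_span\<close> no cutter of \<open>L\<close> lies
  in it.\<close>

lemma descend_class:
  assumes C: "C \<in> shard_class \<Phi> P L D" and T: "T \<subseteq> lower P C"
  shows "descend P L C T \<in> shard_class \<Phi> P L D"
    and "P - descend P L C T = (P - C - span (L \<union> T)) \<union> (P \<inter> span L)"
    and "simples (P \<inter> span (L \<union> T)) = L \<union> T"
proof -
  let ?I = "L \<union> T"
  have ch: "chamber \<Phi> C" and L: "L \<subseteq> lower P C" and sg: "\<forall>k\<in>cutters P L. k \<in> C \<longleftrightarrow> k \<in> D"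
    using C by (auto simp: shard_class_def)
  have IC: "?I \<subseteq> lower P C" using L T by blast
  note I = lower_simples_span[OF R P ch IC]
  note LS = lower_simples_span[OF R P ch L]
  show "simples (P \<inter> span ?I) = ?I" by (rule I(2))
  have LI: "span L \<subseteq> span ?I" by (intro span_mono) auto
  have inL: "span ?I \<inter> span L = span L" using LI by blast
  have eqL: "\<Phi> \<inter> span ?I \<inter> span L = \<Phi> \<inter> span L" using LI by blast
  define E where "E = (P \<inter> span ?I - span L) \<union> uminus ` (P \<inter> span L)"
  have chE: "chamber (\<Phi> \<inter> span ?I) E" unfolding E_def
  proof (rule chamber_replace[OF root_system_span[OF R] chamber_span[OF P]])
    show "L \<subseteq> simples (P \<inter> span ?I)" using I(2) by blast
    show "chamber (\<Phi> \<inter> span ?I \<inter> span L) (uminus ` (P \<inter> span L))"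
      unfolding eqL using chamber_uminus[OF root_system_span[OF R] chamber_span[OF P]] .
  qed
  have spI: "span (uminus ` ?I) = span ?I" by (rule span_uminus_image)
  have UI: "uminus ` ?I \<subseteq> simples C" using IC by (auto simp: lower_def)
  have D': "descend P L C T = (C - span (uminus ` ?I)) \<union> E"
    by (simp only: descend_def E_def spI)
  have ch': "chamber \<Phi> (descend P L C T)" unfolding D'
    by (rule chamber_replace[OF R ch UI]) (use chE spI in simp)
  have "L \<subseteq> lower P (descend P L C T)"
  proof
    fix a assume a: "a \<in> L"
    have "- a \<in> simples (uminus ` (P \<inter> span L))"
      unfolding simples_uminus LS(2) using a by blast
    then have "- a \<in> simples E" unfolding E_def
      by (intro simples_replace[OF root_system_span[OF R] chamber_span[OF P]])
        (use I(2) in \<open>auto intro: span_neg\<close>)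
    moreover have "E \<subseteq> span ?I" using LI by (auto simp: E_def intro: span_neg)
    ultimately have "- a \<in> simples (descend P L C T)" unfolding D'
      by (intro simples_replace[OF R ch UI]) (simp_all add: spI)
    then show "a \<in> lower P (descend P L C T)" using a L by (auto simp: lower_def)
  qed
  moreover have "k \<in> descend P L C T \<longleftrightarrow> k \<in> D" if "k \<in> cutters P L" for k
  proof -
    have "k \<notin> span ?I" using cutters_notin_span[OF _ that] I(2) by blast
    then have "k \<in> descend P L C T \<longleftrightarrow> k \<in> C" using LI
      by (auto simp: descend_def dest: span_neg)
    then show ?thesis using sg that by blast
  qed
  ultimately show "descend P L C T \<in> shard_class \<Phi> P L D"
    using ch' by (auto simp: shard_class_def)
  have "P \<inter> span L \<inter> descend P L C T = {}"
    using LI P_uminus by (auto simp: descend_def)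
  moreover have "uminus ` (P \<inter> span L) \<inter> P = {}" using P_uminus by auto
  ultimately show "P - descend P L C T = (P - C - span ?I) \<union> (P \<inter> span L)"
    using LI by (auto simp: descend_def dest: span_neg)
qed

text \<open>The inversion \<open>t\<close> is lost, and none is gained because the positive roots in
  \<open>span L\<close> are inversions of \<open>C\<close> already. This is the termination of the
  rewriting.\<close>

lemma descend_less:
  assumes C: "C \<in> shard_class \<Phi> P L D" and T: "T \<subseteq> lower P C" and t: "t \<in> T" "t \<notin> L"
  shows "P - descend P L C T \<subset> P - C"
proof -
  have ch: "chamber \<Phi> C" and L: "L \<subseteq> lower P C" using C by (auto simp: shard_class_def)
  have "t \<notin> span L"
  proof
    assume "t \<in> span L"
    then have sp: "- t \<in> span L" by (rule span_neg)
    have s: "- t \<in> simples C" using T t by (auto simp: lower_def)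
    then have "- t \<in> C" using simples_subset by blast
    then have "- t \<in> simples (C \<inter> span L)" using simples_mono[OF s, of "C \<inter> span L"] sp by blast
    then show False using t(2) lower_simples_span[OF R P ch L]
      by (simp add: simples_uminus uminus_eq_image_iff)
  qed
  moreover have "t \<in> P - C" using T t lower_subset[OF ch] by blast
  moreover have "P \<inter> span L \<subseteq> P - C"
    using P_opposite lower_simples_span(1)[OF R P ch L] .
  moreover have "t \<in> span (L \<union> T)" using t by (auto intro: span_base)
  ultimately show ?thesis unfolding descend_class(2)[OF C T] by blast
qed

lemma class_span:
  assumes C: "C \<in> shard_class \<Phi> P L D" shows "C \<inter> span L = uminus ` (P \<inter> span L)"
    "P \<inter> span L \<subseteq> P - C" "simples (P \<inter> span L) = L" "uminus ` L \<subseteq> simples C" "chamber \<Phi> C"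
proof -
  have ch: "chamber \<Phi> C" and L: "L \<subseteq> lower P C" using C by (auto simp: shard_class_def)
  show eq: "C \<inter> span L = uminus ` (P \<inter> span L)" "simples (P \<inter> span L) = L"
    using lower_simples_span[OF R P ch L] by auto
  show "P \<inter> span L \<subseteq> P - C" using P_opposite eq(1) .
  show "uminus ` L \<subseteq> simples C" using L by (auto simp: lower_def)
  show "chamber \<Phi> C" by fact
qed

text \<open>Some simple root of \<open>C\<close> is not in \<open>N\<close>, and its negative
  \<open>t\<close> is a lower wall of \<open>C\<close>. Descending through \<open>t\<close> stays
  above \<open>N\<close>: the only signs left to compare are those in
  \<open>span (L \<union> {t})\<close> off \<open>span L\<close>.\<close>

lemma class_below:
  assumes C: "C \<in> shard_class \<Phi> P L D" and N: "N \<in> shard_class \<Phi> P L D"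
    and le: "P - N \<subseteq> P - C" and ne: "N \<noteq> C"
  obtains t where "t \<in> lower P C" "t \<notin> L" "P - N \<subseteq> P - descend P L C {t}"
proof -
  note cC = class_span[OF C] and cN = class_span[OF N]
  have "\<not> simples C \<subseteq> N" using chamber_eq_of_simples[OF R cC(5) cN(5)] ne by blast
  then obtain s where s: "s \<in> simples C" "s \<notin> N" by blast
  have s\<Phi>: "s \<in> \<Phi>" "s \<in> C" using s simples_subset chamber_subset[OF cC(5)] by blast+
  have sN: "- s \<in> N" using chamber_uminus_iff[OF R cN(5) s\<Phi>(1)] s by blast
  have "s \<notin> P" using le s s\<Phi> by blast
  then have sP: "- s \<in> P" using chamber_uminus_iff[OF R P s\<Phi>(1)] by blast
  define t where "t = - s"
  have t: "t \<in> lower P C" "t \<in> N" "t \<in> P" using s sN sP by (auto simp: t_def lower_def)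
  have tL: "t \<notin> span L" using t cN(2) by blast
  have tL': "t \<notin> L" using tL span_base by blast
  note d = descend_class[OF C, of "{t}"] and dc = class_span[OF descend_class(1)[OF C, of "{t}"]]
  have T: "{t} \<subseteq> lower P C" using t by auto
  have td: "t \<in> descend P L C {t}" using d(2)[OF T] tL t(3) by (auto intro: span_base)
  have "P - N \<subseteq> P - descend P L C {t}"
  proof
    fix a assume a: "a \<in> P - N"
    have a\<Phi>: "a \<in> \<Phi>" using a chamber_subset[OF P] by blast
    consider "a \<notin> span (L \<union> {t})" | "a \<in> span L" | "a \<in> span (L \<union> {t})" "a \<notin> span L" by blast
    then show "a \<in> P - descend P L C {t}"
    proof cases
      case 1 then show ?thesis unfolding d(2)[OF T] using a le by blast
    next
      case 2 then show ?thesis unfolding d(2)[OF T] using a by blast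
    next
      case 3
      \<comment> \<open>Both chambers contain \<open>t\<close>, and off \<open>span L\<close> every
        root of this flat is a multiple of \<open>t\<close> modulo \<open>span L\<close>.\<close>
      have "(a \<in> N \<longleftrightarrow> a \<in> descend P L C {t}) \<longleftrightarrow> (t \<in> N \<longleftrightarrow> t \<in> descend P L C {t})"
        by (rule chamber_agree[OF R cN(5) dc(5)[OF T] cN(4) dc(4)[OF T]])
          (use t tL a\<Phi> 3 chamber_subset[OF P] in \<open>auto simp: span_insert span_uminus_image\<close>)
      then show ?thesis using t td a by blast
    qed
  qed
  then show ?thesis using that t tL' by blast
qed

definition normal_forms :: "'v set \<Rightarrow> 'v set \<Rightarrow> 'v set set" where
  "normal_forms L D = {C \<in> shard_class \<Phi> P L D. lower P C = L}"

lemma normal_form_exists: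
  assumes "C \<in> shard_class \<Phi> P L D"
  shows "\<exists>N\<in>normal_forms L D. P - N \<subseteq> P - C"
  using assms
proof (induction "card (P - C)" arbitrary: C rule: less_induct)
  case less
  show ?case
  proof (cases "lower P C = L")
    case True then show ?thesis using less.prems by (auto simp: normal_forms_def)
  next
    case False
    then obtain t where t: "t \<in> lower P C" "t \<notin> L" using less.prems by (auto simp: shard_class_def)
    have lt: "P - descend P L C {t} \<subset> P - C"
      using descend_less[OF less.prems, of "{t}" t] t by auto
    then have "card (P - descend P L C {t}) < card (P - C)"
      using fin by (intro psubset_card_mono) auto
    then obtain N where "N\<in>normal_forms L D" "P - N \<subseteq> P - descend P L C {t}"
      using less.hyps descend_class(1)[OF less.prems, of "{t}"] t by blast
    then show ?thesis using lt by blast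
  qed
qed

text \<open>Newman's diamond argument: the descents through \<open>t\<close> and through
  \<open>r\<close> both lie above the common descent through \<open>{t, r}\<close>, and a normal
  form below the latter is compared with \<open>N\<close> and with \<open>M\<close>.\<close>

lemma normal_form_unique_below:
  assumes "C \<in> shard_class \<Phi> P L D" "N \<in> normal_forms L D" "M \<in> normal_forms L D"
    "P - N \<subseteq> P - C" "P - M \<subseteq> P - C"
  shows "N = M"
  using assms
proof (induction "card (P - C)" arbitrary: C N M rule: less_induct)
  case less
  note C = less.prems(1)
  have NM: "N \<in> shard_class \<Phi> P L D" "M \<in> shard_class \<Phi> P L D" "lower P N = L" "lower P M = L"
    using less.prems by (auto simp: normal_forms_def)
  show ?case
  proof (cases "N = C \<or> M = C")
    case True
    then have "lower P C = L" using NM by auto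
    then have "N = C" "M = C" using class_below[OF C NM(1) less.prems(4)] class_below[OF C NM(2) less.prems(5)] by metis+
    then show ?thesis by simp
  next
    case False
    obtain t where t: "t \<in> lower P C" "t \<notin> L" "P - N \<subseteq> P - descend P L C {t}"
      using class_below[OF C NM(1) less.prems(4)] False by blast
    obtain r where r: "r \<in> lower P C" "r \<notin> L" "P - M \<subseteq> P - descend P L C {r}"
      using class_below[OF C NM(2) less.prems(5)] False by blast
    have T: "{t} \<subseteq> lower P C" "{r} \<subseteq> lower P C" "{t, r} \<subseteq> lower P C" using t r by auto
    note c = descend_class[OF C T(1)] descend_class[OF C T(2)] descend_class[OF C T(3)]
    obtain Q where Q: "Q \<in> normal_forms L D" "P - Q \<subseteq> P - descend P L C {t, r}"
      using normal_form_exists[OF c(7)] by blast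
    have sp: "span (L \<union> {t}) \<subseteq> span (L \<union> {t, r})" "span (L \<union> {r}) \<subseteq> span (L \<union> {t, r})"
      by (intro span_mono; auto)+
    have le: "P - descend P L C {t, r} \<subseteq> P - descend P L C {t}"
      "P - descend P L C {t, r} \<subseteq> P - descend P L C {r}"
      unfolding c(2) c(5) c(8) using sp by blast+
    have "card (P - descend P L C {t}) < card (P - C)" "card (P - descend P L C {r}) < card (P - C)"
      using descend_less[OF C T(1) _ t(2)] descend_less[OF C T(2) _ r(2)] fin
      by (auto intro!: psubset_card_mono)
    then have "N = Q" "M = Q"
      using less.hyps[OF _ c(1) less.prems(2) Q(1) t(3)] less.hyps[OF _ c(4) less.prems(3) Q(1) r(3)]
        Q(2) le by blast+
    then show ?thesis by simp
  qed
qed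

text \<open>Induction along a gallery from \<open>C\<close> to \<open>C'\<close> inside the class.
  The next chamber \<open>E\<close> takes the signs of \<open>C'\<close> on the flat spanned by
  \<open>L\<close> and one simple root \<open>s\<close> of \<open>C\<close> that is negative in
  \<open>C'\<close>; it is comparable with \<open>C\<close>, so the normal forms below the two
  coincide.\<close>

lemma normal_form_unique:
  assumes "C \<in> shard_class \<Phi> P L D" "C' \<in> shard_class \<Phi> P L D"
    "N \<in> normal_forms L D" "M \<in> normal_forms L D" "P - N \<subseteq> P - C" "P - M \<subseteq> P - C'"
  shows "N = M"
  using assms
proof (induction "card (C - C')" arbitrary: C N rule: less_induct)
  case less
  note C = class_span[OF less.prems(1)] and C' = class_span[OF less.prems(2)]
  show ?case
  proof (cases "simples C \<subseteq> C'")
    case True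
    then have "C = C'" using chamber_eq_of_simples[OF R C(5) C'(5)] by blast
    then show ?thesis using normal_form_unique_below less.prems by blast
  next
    case False
    then obtain s where s: "s \<in> simples C" "s \<notin> C'" by blast
    have s\<Phi>: "s \<in> \<Phi>" "s \<in> C" using s simples_subset chamber_subset[OF C(5)] by blast+
    have sL: "s \<notin> span L" using s s\<Phi> C(1) C'(1) by blast
    let ?I = "insert s (uminus ` L)" and ?S = "span (insert s L)"
    have spL: "span (uminus ` L) = span L" by (rule span_uminus_image)
    have spI: "span ?I = ?S" by (simp add: span_insert spL)
    have IC: "?I \<subseteq> simples C" using s C(4) by blast
    have LS: "span L \<subseteq> ?S" by (intro span_mono) auto
    define E where "E = (C - ?S) \<union> (C' \<inter> ?S)"
    have chE: "chamber \<Phi> E" unfolding E_def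
      using chamber_replace[OF R C(5) IC, of "C' \<inter> ?S"] chamber_span[OF C'(5), of ?I] spI
      by (metis Int_absorb Int_assoc chamber_span C'(5))
    \<comment> \<open>Modulo \<open>span L\<close> all roots of the enlarged flat are multiples of
      \<open>s\<close>, so off \<open>span L\<close> all of them change sign together with
      \<open>s\<close>.\<close>
    have opp: "k \<in> C \<longleftrightarrow> k \<notin> C'" if "k \<in> \<Phi>" "k \<in> ?S" "k \<notin> span L" for k
      using chamber_agree[OF R C(5) C'(5) C(4) C'(4) s\<Phi>(1), of k] spI spL sL that s s\<Phi> by auto
    have LE: "L \<subseteq> lower P E"
    proof
      fix a assume a: "a \<in> L"
      have "- a \<in> simples C'" using a C'(4) by blast
      then have "- a \<in> simples (C' \<inter> ?S)"
        by (rule simples_mono) (use a C'(4) simples_subset span_neg[OF span_base[of a "insert s L"]] in auto)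
      then have "- a \<in> simples E" unfolding E_def using simples_replace[OF R C(5) IC, of "C' \<inter> ?S" "- a"] spI by simp
      then show "a \<in> lower P E" using a less.prems(1) by (auto simp: lower_def shard_class_def)
    qed
    have EZ: "E \<in> shard_class \<Phi> P L D"
      using chE LE less.prems(1,2) by (auto simp: shard_class_def E_def)
    have "E - C' \<subset> C - C'" using s s\<Phi> by (auto simp: E_def intro: span_base)
    then have cd: "card (E - C') < card (C - C')"
      using chamber_finite[OF R C(5)] by (intro psubset_card_mono) auto
    \<comment> \<open>A cutter of \<open>L\<close> in the enlarged flat has the same prescribed sign
      in \<open>C\<close> and \<open>C'\<close>, against \<open>opp\<close>. Hence \<open>L\<close>
      stays basic in that flat.\<close>
    have unc: "\<not> cut P k h" if "k \<in> P" "k \<in> ?S" "k \<notin> span L" "h \<in> L" for k h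
    proof
      assume "cut P k h"
      then have "k \<in> cutters P L" using that by (auto simp: cutters_def)
      then have "k \<in> C \<longleftrightarrow> k \<in> C'" using less.prems(1,2) by (auto simp: shard_class_def)
      then show False using opp[of k] that chamber_subset[OF P] by blast
    qed
    have LP: "L \<subseteq> simples (P \<inter> ?S)" using simples_of_uncut[OF R P C(3)] unc by blast
    have chU: "chamber (\<Phi> \<inter> ?S) (uminus ` (C \<inter> ?S))"
      using chamber_uminus[OF root_system_span[OF R] chamber_span[OF C(5)]] .
    have LU: "L \<subseteq> simples (uminus ` (C \<inter> ?S))"
    proof
      fix a assume a: "a \<in> L"
      have "- a \<in> simples C" using a C(4) by blast
      then have "- a \<in> simples (C \<inter> ?S)"
        by (rule simples_mono) (use a C(4) simples_subset span_neg[OF span_base[of a "insert s L"]] in auto)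
      then show "a \<in> simples (uminus ` (C \<inter> ?S))" unfolding simples_uminus by (simp add: uminus_mem_image_iff)
    qed
    \<comment> \<open>Now \<open>L\<close> is simple on this flat both for \<open>P\<close> and for
      the negative of \<open>C\<close>. So off \<open>span L\<close> the signs of \<open>C\<close>
      are either all those of \<open>P\<close> or all opposite, as decided by \<open>s\<close>; this
      yields the comparability \<open>comp\<close>.\<close>
    have agree: "(k \<in> P \<longleftrightarrow> - k \<in> C) \<longleftrightarrow> (s \<in> P \<longleftrightarrow> - s \<in> C)" if "k \<in> \<Phi>" "k \<in> ?S" "k \<notin> span L" for k
    proof -
      have "(k \<in> P \<inter> ?S \<longleftrightarrow> k \<in> uminus ` (C \<inter> ?S)) \<longleftrightarrow> (s \<in> P \<inter> ?S \<longleftrightarrow> s \<in> uminus ` (C \<inter> ?S))"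
        by (rule chamber_agree[OF root_system_span[OF R] chamber_span[OF P] chU LP LU])
          (use that s\<Phi> sL in \<open>auto intro: span_base\<close>)
      moreover have "s \<in> ?S" "- s \<in> ?S" "- k \<in> ?S"
        using that span_neg[OF that(2)] span_base[of s "insert s L"] span_neg[OF span_base[of s "insert s L"]] by auto
      ultimately show ?thesis using that by (simp add: uminus_mem_image_iff)
    qed
    have agree': "(k \<in> P \<longleftrightarrow> k \<notin> C) \<longleftrightarrow> s \<notin> P" if "k \<in> \<Phi>" "k \<in> ?S" "k \<notin> span L" for k
      using agree[OF that] chamber_uminus_iff[OF R C(5)] that s\<Phi> by blast
    have comp: "P - E \<subseteq> P - C \<or> P - C \<subseteq> P - E"
    proof (cases "s \<in> P")
      case True
      have "P - C \<subseteq> P - E"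
      proof
        fix a assume a: "a \<in> P - C"
        have a\<Phi>: "a \<in> \<Phi>" using a chamber_subset[OF P] by blast
        have "a \<notin> C'" if "a \<in> ?S"
        proof (cases "a \<in> span L")
          case True then show ?thesis using a C(1) C'(1) by blast
        next
          case False then show ?thesis using agree'[OF a\<Phi> that] a True by blast
        qed
        then show "a \<in> P - E" using a by (auto simp: E_def)
      qed
      then show ?thesis ..
    next
      case False
      have "P - E \<subseteq> P - C"
      proof
        fix a assume a: "a \<in> P - E"
        have a\<Phi>: "a \<in> \<Phi>" using a chamber_subset[OF P] by blast
        have "a \<notin> C" if "a \<in> ?S"
        proof (cases "a \<in> span L")
          case True then show ?thesis using a that C(1) C'(1) by (auto simp: E_def)
        next
          case False then show ?thesis using agree'[OF a\<Phi> that] a \<open>s \<notin> P\<close> by blast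
        qed
        then show "a \<in> P - C" using a by (auto simp: E_def)
      qed
      then show ?thesis ..
    qed
    show ?thesis
    proof (cases "P - E \<subseteq> P - C")
      case True
      obtain Q where Q: "Q \<in> normal_forms L D" "P - Q \<subseteq> P - E" using normal_form_exists[OF EZ] by blast
      then have "N = Q" using normal_form_unique_below[OF less.prems(1,3) Q(1) less.prems(5)] True by blast
      moreover have "Q = M" using less.hyps[OF cd EZ less.prems(2) Q(1) less.prems(4) Q(2) less.prems(6)] .
      ultimately show ?thesis by simp
    next
      case False
      then have "P - N \<subseteq> P - E" using comp less.prems(5) by blast
      then show ?thesis using less.hyps[OF cd EZ less.prems(2) less.prems(3,4) _ less.prems(6)] by blast
    qed
  qed
qed

theorem shard_class_unique:
  assumes "shard_class \<Phi> P L D \<noteq> {}"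
  shows "\<exists>!C. C \<in> shard_class \<Phi> P L D \<and> lower P C = L"
proof -
  obtain C where "C \<in> shard_class \<Phi> P L D" using assms by blast
  then obtain N where "N \<in> normal_forms L D" using normal_form_exists by blast
  moreover have "N = M" if "N \<in> normal_forms L D" "M \<in> normal_forms L D" for N M
    using normal_form_unique[of N L D M N M] that by (auto simp: normal_forms_def)
  ultimately show ?thesis unfolding normal_forms_def by blast
qed

text \<open>This is the injectivity of \<psi>, read off lower walls and signs.\<close>

lemma lower_inject:
  assumes C: "chamber \<Phi> C" and D: "chamber \<Phi> D" and L: "lower P C = lower P D"
    and s: "\<forall>k\<in>cutters P (lower P D). k \<in> C \<longleftrightarrow> k \<in> D"
  shows "C = D"
proof -
  have "C \<in> shard_class \<Phi> P (lower P D) D" "D \<in> shard_class \<Phi> P (lower P D) D"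
    using assms by (auto simp: shard_class_def)
  then show ?thesis using shard_class_unique[of "lower P D" D] L by blast
qed

end

section \<open>The shard order on chambers\<close>

definition chambers :: "'v::euclidean_space set \<Rightarrow> 'v set set" where
  "chambers \<Phi> = {C. chamber \<Phi> C}"

text \<open>The shard intersection order read off lower walls and signs, see \<open>Inter_shards_subset_iff\<close>.\<close>

definition shard_le :: "'v::euclidean_space set \<Rightarrow> 'v set \<Rightarrow> 'v set \<Rightarrow> bool" where
  "shard_le P C D \<longleftrightarrow> lower P C \<subseteq> span (lower P D) \<and>
     (\<forall>k\<in>cutters P (lower P C). k \<notin> span (lower P D) \<longrightarrow> (k \<in> C \<longleftrightarrow> k \<in> D))"

definition face_sum :: "'v::euclidean_space set \<Rightarrow> 'v set \<Rightarrow> 'v set \<Rightarrow> int" where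
  "face_sum \<Phi> P C = (\<Sum>I\<in>Pow (lower P C). (-1) ^ card I * int (card (chambers (\<Phi> \<inter> span I))))"

lemma finite_chambers: "finite \<Phi> \<Longrightarrow> finite (chambers \<Phi>)"
  by (rule finite_subset[of _ "Pow \<Phi>"]) (auto simp: chambers_def dest: chamber_subset)

lemma chambers_empty: "chambers {} = {{}}"
  by (auto simp: chambers_def chamber_def)

lemma alternating_sum_Pow:
  assumes "finite A" "A \<noteq> {}" shows "(\<Sum>X\<in>Pow A. (-1) ^ card X) = (0::int)"
proof -
  \<comment> \<open>Expand a product of zero factors \<open>1 - 1\<close> over the subsets of
    \<open>A\<close>.\<close>
  have "(\<Prod>x\<in>A. 1 - 1) = (\<Sum>X\<in>Pow A. (-1) ^ card X * (\<Prod>x\<in>X. 1) * (\<Prod>x\<in>A-X. (1::int)))"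
    by (rule prod_diff_conv_sum) (rule assms)
  then show ?thesis using assms by (simp add: power_0_left card_gt_0_iff)
qed

text \<open>Matching by a relation instead of a map, so that \<open>sum_shard_interval\<close> rests
  on two uniqueness statements and no explicit inverse.\<close>

lemma sum_by_relation:
  assumes "\<And>x. x \<in> A \<Longrightarrow> \<exists>!y. y \<in> B \<and> r x y" "\<And>y. y \<in> B \<Longrightarrow> \<exists>!x. x \<in> A \<and> r x y"
    "\<And>x y. x \<in> A \<Longrightarrow> y \<in> B \<Longrightarrow> r x y \<Longrightarrow> f x = g y"
  shows "sum f A = sum g B"
proof -
  define h where "h x = (THE y. y \<in> B \<and> r x y)" for x
  have h: "h x \<in> B" "r x (h x)" if "x \<in> A" for x
    using theI'[OF assms(1)[OF that]] by (auto simp: h_def)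
  have "inj_on h A" using h assms(2) by (intro inj_onI) metis
  moreover have "h ` A = B"
  proof
    show "B \<subseteq> h ` A"
    proof
      fix y assume y: "y \<in> B"
      then obtain x where x: "x \<in> A" "r x y" using assms(2) by blast
      then have "h x = y" using h[OF x(1)] assms(1)[OF x(1)] y by blast
      then show "y \<in> h ` A" using x by blast
    qed
  qed (use h in blast)
  ultimately have "bij_betw h A B" by (simp add: bij_betw_def)
  then have "sum g B = (\<Sum>x\<in>A. g (h x))" by (rule sum.reindex_bij_betw[symmetric])
  also have "\<dots> = sum f A" using h assms(3) by (intro sum.cong refl) (metis)
  finally show ?thesis ..
qed

text \<open>Cutting is decided in the plane of the two roots, so it is the same in a flat and in the
  whole system.\<close>

lemma cut_span:
  assumes "h \<in> span L" shows "cut (P \<inter> span L) k h \<longleftrightarrow> k \<in> span L \<and> cut P k h"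
proof (cases "k \<in> span L")
  case True
  then have "span {h, k} \<subseteq> span L" using assms by (intro span_minimal) auto
  then have "P \<inter> span L \<inter> span {h, k} = P \<inter> span {h, k}" by blast
  then show ?thesis using True assms by (auto simp: cut_def)
qed (auto simp: cut_def)

lemma cutters_span:
  assumes "M \<subseteq> span L" shows "cutters (P \<inter> span L) M = cutters P M \<inter> span L"
  using assms cut_span[of _ L P] by (fastforce simp: cutters_def)

lemma span_simples:
  assumes R: "root_system \<Phi>" and C: "chamber \<Phi> C" shows "span (simples C) = span \<Phi>"
proof
  show "span (simples C) \<subseteq> span \<Phi>"
    using simples_subset chamber_subset[OF C] by (intro span_mono) blast
  have "a \<in> span (simples C)" if aC: "a \<in> C" for a
  proof -
    obtain f where f: "a = (\<Sum>d\<in>simples C. f d *\<^sub>R d)"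
      using subsetD[OF simples_basis(2)[OF R C] aC] unfolding nncone_def by blast
    show ?thesis unfolding f by (intro span_sum span_scale span_base)
  qed
  moreover have "a \<in> C \<or> - a \<in> C" if "a \<in> \<Phi>" for a using chamber_uminus_iff[OF R C that] by blast
  ultimately have "\<Phi> \<subseteq> span (simples C)" using span_neg by fastforce
  then show "span \<Phi> \<subseteq> span (simples C)" by (intro span_minimal) auto
qed

lemma span_Int_span: assumes "I \<subseteq> \<Phi>" shows "span (\<Phi> \<inter> span I) = span I"
proof
  show "span (\<Phi> \<inter> span I) \<subseteq> span I" by (intro span_minimal) auto
  show "span I \<subseteq> span (\<Phi> \<inter> span I)" using assms span_superset by (intro span_mono) blast
qed

lemma card_simples_span:
  assumes R: "root_system \<Phi>" and I: "independent I" "I \<subseteq> \<Phi>" and E: "chamber (\<Phi> \<inter> span I) E"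
  shows "card (simples E) = card I" "span (simples E) = span I"
proof -
  show s: "span (simples E) = span I"
    using span_simples[OF root_system_span[OF R] E] span_Int_span[OF I(2)] by simp
  have "independent (simples E)" using simples_basis(1)[OF root_system_span[OF R] E] .
  then show "card (simples E) = card I" using I(1) s by (metis dim_span_eq_card_independent)
qed

context based_root_system
begin

lemma based_span: "based_root_system (\<Phi> \<inter> span L) (P \<inter> span L)"
  using root_system_span[OF R] chamber_span[OF P] by unfold_locales

lemma lower_flat:
  assumes "chamber \<Phi> C" shows "simples (P \<inter> span (lower P C)) = lower P C"
  using lower_simples_span(2)[OF R P assms] by blast

lemma lower_self: "lower P P = {}"
  using P_uminus simples_subset unfolding lower_def by blast

lemma lower_eq_empty: assumes "chamber \<Phi> C" "lower P C = {}" shows "C = P"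
proof -
  have "simples C \<subseteq> P"
  proof
    fix a assume a: "a \<in> simples C"
    then have "a \<in> \<Phi>" using simples_subset chamber_subset[OF assms(1)] by blast
    show "a \<in> P"
    proof (rule ccontr)
      assume "a \<notin> P"
      then have "- a \<in> P" using chamber_uminus_iff[OF R P \<open>a \<in> \<Phi>\<close>] by blast
      then have "- a \<in> lower P C" using a by (simp add: lower_def)
      then show False using assms(2) by blast
    qed
  qed
  then show ?thesis using chamber_eq_of_simples[OF R assms(1) P] by blast
qed

lemma shard_le_self: "shard_le P P C"
  unfolding shard_le_def lower_self by (simp add: cutters_def)

text \<open>Equal spans give equal lower walls, as these are the simple roots of their flat. No
  cutter of them lies in that flat, so the second clause of \<open>shard_le\<close> makes all
  prescribed signs equal.\<close>

lemma shard_le_antisym: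
  assumes C: "chamber \<Phi> C" and D: "chamber \<Phi> D" and le: "shard_le P C D" "shard_le P D C"
  shows "C = D"
proof -
  have "span (lower P C) = span (lower P D)"
    using le span_minimal[OF _ subspace_span] unfolding shard_le_def by blast
  then have L: "lower P C = lower P D" using lower_flat[OF C] lower_flat[OF D] by metis
  have "k \<notin> span (lower P D)" if "k \<in> cutters P (lower P D)" for k
    using cutters_notin_span[OF _ that, of "lower P D"] lower_flat[OF D] by simp
  then show ?thesis using le(1) L by (intro lower_inject[OF C D L]) (auto simp: shard_le_def)
qed

lemma replace_lower:
  assumes C: "chamber \<Phi> C" and I: "I \<subseteq> lower P C" and E: "chamber (\<Phi> \<inter> span I) E"
  shows "chamber \<Phi> ((C - span I) \<union> E)" "simples E \<subseteq> simples ((C - span I) \<union> E)"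
proof -
  have UI: "uminus ` I \<subseteq> simples C" using I by (auto simp: lower_def)
  show "chamber \<Phi> ((C - span I) \<union> E)"
    using chamber_replace[OF R C UI] E by (simp add: span_uminus_image)
  have "E \<subseteq> span I" using chamber_subset[OF E] by blast
  then show "simples E \<subseteq> simples ((C - span I) \<union> E)"
    using simples_replace[OF R C UI] by (auto simp: span_uminus_image)
qed

text \<open>Partners have the same lower walls, and the signs at their cutters come from
  \<open>E\<close> inside the flat and from \<open>D\<close> outside it. Such a datum has exactly
  one normal form in \<open>\<Phi>\<close> as well as in \<open>\<Phi> \<inter> span L\<close>, so
  partners exist and are unique both ways.\<close>

lemma sum_shard_interval:
  assumes D: "chamber \<Phi> D" and L: "L = lower P D"
  shows "(\<Sum>C\<in>{C. chamber \<Phi> C \<and> shard_le P C D}. g (lower P C))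
       = (\<Sum>E\<in>chambers (\<Phi> \<inter> span L). g (lower (P \<inter> span L) E))"
proof -
  let ?Q = "P \<inter> span L"
  interpret B: based_root_system "\<Phi> \<inter> span L" ?Q by (rule based_span)
  define r where "r C E \<longleftrightarrow> lower P C = lower ?Q E \<and>
    (\<forall>k\<in>cutters P (lower P C). k \<in> C \<longleftrightarrow> (if k \<in> span L then k \<in> E else k \<in> D))" for C E
  have a: "\<exists>!C. C \<in> {C. chamber \<Phi> C \<and> shard_le P C D} \<and> r C E" if "E \<in> chambers (\<Phi> \<inter> span L)" for E
  proof -
    have E: "chamber (\<Phi> \<inter> span L) E" using that by (simp add: chambers_def)
    have EL: "E \<subseteq> span L" using chamber_subset[OF E] by blast
    define M where "M = lower ?Q E"
    \<comment> \<open>\<open>U\<close> realises the signs of \<open>E\<close> inside the flat and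
      those of \<open>D\<close> outside, which makes the class in \<open>\<Phi>\<close>
      nonempty.\<close>
    define U where "U = (D - span L) \<union> E"
    have sub_L: "M \<subseteq> ?Q" by (auto simp: M_def lower_def)
    have U: "chamber \<Phi> U" "simples E \<subseteq> simples U"
      unfolding U_def using replace_lower[OF D _ E] L by auto
    then have "U \<in> shard_class \<Phi> P M U" by (auto simp: shard_class_def M_def lower_def)
    then have ex1: "\<exists>!C. C \<in> shard_class \<Phi> P M U \<and> lower P C = M" by (intro shard_class_unique) auto
    have "C \<in> shard_class \<Phi> P M U \<and> lower P C = M \<longleftrightarrow> C \<in> {C. chamber \<Phi> C \<and> shard_le P C D} \<and> r C E" for C
      using sub_L EL by (auto simp: shard_class_def r_def U_def M_def[symmetric] shard_le_def L[symmetric])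
    then show ?thesis using ex1 by auto
  qed
  have b: "\<exists>!E. E \<in> chambers (\<Phi> \<inter> span L) \<and> r C E" if "C \<in> {C. chamber \<Phi> C \<and> shard_le P C D}" for C
  proof -
    have C: "chamber \<Phi> C" and le: "shard_le P C D" using that by auto
    define M where "M = lower P C"
    have sub_L: "M \<subseteq> span L" using le by (simp add: M_def shard_le_def L)
    \<comment> \<open>The restriction of \<open>C\<close> satisfies the datum within the flat, so
      the class there is nonempty.\<close>
    have "M \<subseteq> lower ?Q (C \<inter> span L)"
    proof
      fix a assume a: "a \<in> M"
      then have "- a \<in> simples C" "a \<in> ?Q" using sub_L by (auto simp: M_def lower_def)
      moreover have "- a \<in> C \<inter> span L"
        using a sub_L simples_subset span_neg[of a L] calculation(1) by blast
      ultimately have "- a \<in> simples (C \<inter> span L)" using simples_mono by blast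
      then show "a \<in> lower ?Q (C \<inter> span L)" using \<open>a \<in> ?Q\<close> by (simp add: lower_def)
    qed
    then have "C \<inter> span L \<in> shard_class (\<Phi> \<inter> span L) ?Q M (C \<inter> span L)"
      using chamber_span[OF C] by (auto simp: shard_class_def)
    then have ex1: "\<exists>!E. E \<in> shard_class (\<Phi> \<inter> span L) ?Q M (C \<inter> span L) \<and> lower ?Q E = M"
      by (intro B.shard_class_unique) auto
    have "E \<in> shard_class (\<Phi> \<inter> span L) ?Q M (C \<inter> span L) \<and> lower ?Q E = M
      \<longleftrightarrow> E \<in> chambers (\<Phi> \<inter> span L) \<and> r C E" for E
      using le cutters_span[OF sub_L, of P]
      by (auto simp: shard_class_def r_def chambers_def M_def[symmetric] shard_le_def L[symmetric])
    then show ?thesis using ex1 by auto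
  qed
  show ?thesis
    by (rule sum_by_relation[of _ _ "r"]) (use a b in \<open>auto simp: r_def\<close>)
qed

lemma sum_face_sum:
  assumes ne: "\<Phi> \<noteq> {}"
  shows "(\<Sum>C\<in>chambers \<Phi>. face_sum \<Phi> P C) = 0"
proof -
  note finR = root_system_finite[OF R]
  have finch: "finite (chambers \<Phi>)" "finite (chambers (\<Phi> \<inter> span I))" for I
    using finR by (auto intro: finite_chambers)
  have finl: "finite (lower P C)" for C using fin by (auto simp: lower_def)
  define A where "A = Sigma (chambers \<Phi>) (\<lambda>C. Sigma (Pow (lower P C)) (\<lambda>I. chambers (\<Phi> \<inter> span I)))"
  define A' where "A' = Sigma (chambers \<Phi>) (\<lambda>C. Pow (simples C))"
  have "(\<Sum>C\<in>chambers \<Phi>. face_sum \<Phi> P C)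
      = (\<Sum>C\<in>chambers \<Phi>. \<Sum>I\<in>Pow (lower P C). \<Sum>E\<in>chambers (\<Phi> \<inter> span I). (-1) ^ card I)"
    unfolding face_sum_def by (simp add: mult.commute)
  also have "\<dots> = (\<Sum>C\<in>chambers \<Phi>. \<Sum>(I, E)\<in>Sigma (Pow (lower P C)) (\<lambda>I. chambers (\<Phi> \<inter> span I)). (-1) ^ card I)"
    using finch finl by (intro sum.cong refl sum.Sigma) auto
  also have "\<dots> = (\<Sum>(C, I, E)\<in>A. (-1) ^ card I)"
    unfolding A_def using finch finl by (subst sum.Sigma) (auto intro: finite_SigmaI)
  \<comment> \<open>Forwards, the top chamber \<open>C\<close> around the face \<open>I\<close> has
    its part in \<open>span I\<close> exchanged for \<open>E\<close>, and \<open>simples E\<close>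
    records the face. Backwards, take the top chamber around the face \<open>J\<close>, the lower
    walls that span the same flat, and the part in \<open>span J\<close> that was overwritten. The
    sign is kept because two bases of one flat have equally many elements.\<close>
  also have "\<dots> = (\<Sum>(C, J)\<in>A'. (-1) ^ card J)"
  proof (rule sum.reindex_bij_witness[of _
        "\<lambda>(C, J). ((C - span J) \<union> uminus ` (P \<inter> span J), simples (P \<inter> span J), C \<inter> span J)"
        "\<lambda>(C, I, E). ((C - span I) \<union> E, simples E)"])
    fix x assume "x \<in> A"
    then obtain C I E where x: "x = (C, I, E)" and C: "chamber \<Phi> C" and I: "I \<subseteq> lower P C"
      and E: "chamber (\<Phi> \<inter> span I) E" by (auto simp: A_def chambers_def)
    note LS = lower_simples_span[OF R P C I]
    have EI: "E \<subseteq> span I" using chamber_subset[OF E] by blast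
    have indI: "independent I"
      using simples_basis(1)[OF root_system_span[OF R] chamber_span[OF P], of I] LS(2) by simp
    have I\<Phi>: "I \<subseteq> \<Phi>" using I chamber_subset[OF P] by (auto simp: lower_def)
    note cs = card_simples_span[OF R indI I\<Phi> E]
    have "((C - span I) \<union> E - span I) \<union> uminus ` (P \<inter> span I) = C"
      using EI LS(1) by blast
    moreover have "((C - span I) \<union> E) \<inter> span I = E" using EI by blast
    ultimately show "(case case x of (C, I, E) \<Rightarrow> ((C - span I) \<union> E, simples E) of
        (C, J) \<Rightarrow> ((C - span J) \<union> uminus ` (P \<inter> span J), simples (P \<inter> span J), C \<inter> span J)) = x"
      using x cs(2) LS(2) by simp
    show "(case x of (C, I, E) \<Rightarrow> ((C - span I) \<union> E, simples E)) \<in> A'"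
      using x replace_lower[OF C I E] by (simp add: A'_def chambers_def)
    show "(case case x of (C, I, E) \<Rightarrow> ((C - span I) \<union> E, simples E) of (C, J) \<Rightarrow> (-1) ^ card J) =
       (case x of (C, I, E) \<Rightarrow> (-1::int) ^ card I)" using x cs(1) by simp
  next
    fix y assume "y \<in> A'"
    then obtain C J where y: "y = (C, J)" and C: "chamber \<Phi> C" and J: "J \<subseteq> simples C"
      by (auto simp: A'_def chambers_def)
    define I where "I = simples (P \<inter> span J)"
    have J\<Phi>: "J \<subseteq> \<Phi>" using J simples_subset chamber_subset[OF C] by blast
    have sp: "span I = span J" unfolding I_def
      using span_simples[OF root_system_span[OF R] chamber_span[OF P]] span_Int_span[OF J\<Phi>] by simp
    have s: "simples (C \<inter> span J) = J" by (rule simples_span[OF R C J])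
    let ?E0 = "uminus ` (P \<inter> span J)"
    have E0: "chamber (\<Phi> \<inter> span J) ?E0"
      using chamber_uminus[OF root_system_span[OF R] chamber_span[OF P]] .
    have ch: "chamber \<Phi> ((C - span J) \<union> ?E0)" by (rule chamber_replace[OF R C J E0])
    have "I \<subseteq> lower P ((C - span J) \<union> ?E0)"
    proof
      fix a assume a: "a \<in> I"
      then have "- a \<in> simples ?E0" unfolding simples_uminus I_def by blast
      then have "- a \<in> simples ((C - span J) \<union> ?E0)"
        using simples_replace[OF R C J, of ?E0] chamber_subset[OF E0] by blast
      then show "a \<in> lower P ((C - span J) \<union> ?E0)" using a simples_subset by (auto simp: I_def lower_def)
    qed
    moreover have "chamber (\<Phi> \<inter> span I) (C \<inter> span J)" unfolding sp using chamber_span[OF C] .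
    ultimately show "(case y of (C, J) \<Rightarrow> ((C - span J) \<union> uminus ` (P \<inter> span J), simples (P \<inter> span J), C \<inter> span J)) \<in> A"
      using y ch by (simp add: A_def chambers_def I_def[symmetric])
    have "((C - span J) \<union> ?E0 - span J) \<union> (C \<inter> span J) = C"
      using chamber_subset[OF E0] by blast
    then show "(case case y of (C, J) \<Rightarrow> ((C - span J) \<union> uminus ` (P \<inter> span J), simples (P \<inter> span J), C \<inter> span J) of
        (C, I, E) \<Rightarrow> ((C - span I) \<union> E, simples E)) = y"
      using y s sp by (simp add: I_def[symmetric])
  qed
  also have "\<dots> = (\<Sum>C\<in>chambers \<Phi>. \<Sum>J\<in>Pow (simples C). (-1) ^ card J)"
    unfolding A'_def
  proof (rule sum.Sigma[symmetric])
    show "\<forall>C\<in>chambers \<Phi>. finite (Pow (simples C))"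
      using finite_subset[OF simples_subset chamber_finite[OF R]] by (simp add: chambers_def)
  qed (rule finch)
  also have "\<dots> = 0"
  proof (rule sum.neutral, rule ballI, rule alternating_sum_Pow)
    fix C assume "C \<in> chambers \<Phi>"
    then have C: "chamber \<Phi> C" by (simp add: chambers_def)
    show "finite (simples C)" using chamber_finite[OF R C] simples_subset finite_subset by blast
    show "simples C \<noteq> {}"
    proof
      assume "simples C = {}"
      then have "span \<Phi> = {0}" using span_simples[OF R C] by simp
      then show False using ne root_system_nonzero[OF R] span_superset[of \<Phi>] by blast
    qed
  qed
  finally show ?thesis .
qed

theorem sum_face_sum_interval:
  assumes D: "chamber \<Phi> D" and ne: "D \<noteq> P"
  shows "(\<Sum>C\<in>{C. chamber \<Phi> C \<and> shard_le P C D}. face_sum \<Phi> P C) = 0"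
proof -
  define L where "L = lower P D"
  let ?Q = "P \<inter> span L"
  interpret B: based_root_system "\<Phi> \<inter> span L" ?Q by (rule based_span)
  have "L \<noteq> {}" using lower_eq_empty[OF D] ne by (auto simp: L_def)
  moreover have "L \<subseteq> \<Phi> \<inter> span L" using chamber_subset[OF P] by (auto simp: L_def lower_def intro: span_base)
  ultimately have "\<Phi> \<inter> span L \<noteq> {}" by blast
  have "(\<Sum>C\<in>{C. chamber \<Phi> C \<and> shard_le P C D}. face_sum \<Phi> P C) =
    (\<Sum>E\<in>chambers (\<Phi> \<inter> span L). \<Sum>I\<in>Pow (lower ?Q E). (-1) ^ card I * int (card (chambers (\<Phi> \<inter> span I))))"
    unfolding face_sum_def by (rule sum_shard_interval[OF D L_def])
  also have "\<dots> = (\<Sum>E\<in>chambers (\<Phi> \<inter> span L). face_sum (\<Phi> \<inter> span L) ?Q E)"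
    unfolding face_sum_def
  proof (intro sum.cong refl)
    fix E I assume "I \<in> Pow (lower ?Q E)"
    then have "span I \<subseteq> span L" by (intro span_minimal) (auto simp: lower_def)
    then have "\<Phi> \<inter> span L \<inter> span I = \<Phi> \<inter> span I" by blast
    then show "(-1) ^ card I * int (card (chambers (\<Phi> \<inter> span I)))
        = (-1) ^ card I * int (card (chambers (\<Phi> \<inter> span L \<inter> span I)))" by simp
  qed
  also have "\<dots> = 0" by (rule B.sum_face_sum) fact
  finally show ?thesis .
qed

text \<open>Only the empty set of lower walls contributes; its flat \<open>{0}\<close> contains no
  root, and the empty system has one chamber.\<close>

lemma face_sum_self: "face_sum \<Phi> P P = 1"
proof -
  have "\<Phi> \<inter> {0} = {}" using root_system_nonzero[OF R] by blast
  then show ?thesis by (simp add: face_sum_def lower_self chambers_empty)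
qed

end

section \<open>Regions, facets and shards of a root system\<close>

definition hyp :: "'v::euclidean_space \<Rightarrow> 'v set" where
  "hyp a = {x. a \<bullet> x = 0}"

definition region :: "'v::euclidean_space set \<Rightarrow> 'v set" where
  "region C = {x. \<forall>a\<in>C. 0 \<le> a \<bullet> x}"

text \<open>A connected set avoiding the hyperplanes cannot change a sign, by the intermediate value
  property, and the points with given signs form a convex set. \<open>V\<close> is the whole space
  for regions and a hyperplane for shards.\<close>

lemma components_sign_cells:
  fixes V :: "'v::euclidean_space set"
  assumes "convex V"
  shows "components {x \<in> V. \<forall>k\<in>K. k \<bullet> x \<noteq> 0} =
    (\<lambda>z. {x \<in> V. \<forall>k\<in>K. 0 < (k \<bullet> x) * (k \<bullet> z)}) ` {z \<in> V. \<forall>k\<in>K. k \<bullet> z \<noteq> 0}"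
proof -
  let ?U = "{x \<in> V. \<forall>k\<in>K. k \<bullet> x \<noteq> 0}"
  let ?c = "\<lambda>z. {x \<in> V. \<forall>k\<in>K. 0 < (k \<bullet> x) * (k \<bullet> z)}"
  have "connected_component_set ?U z = ?c z" if z: "z \<in> ?U" for z
  proof
    show "connected_component_set ?U z \<subseteq> ?c z"
    proof
      fix y assume "y \<in> connected_component_set ?U z"
      then obtain T where T: "connected T" "T \<subseteq> ?U" "z \<in> T" "y \<in> T"
        by (auto simp: connected_component_def)
      have "0 < (k \<bullet> y) * (k \<bullet> z)" if k: "k \<in> K" for k
      proof (rule ccontr)
        assume "\<not> 0 < (k \<bullet> y) * (k \<bullet> z)"
        then have "k \<bullet> y \<le> 0 \<and> 0 \<le> k \<bullet> z \<or> k \<bullet> z \<le> 0 \<and> 0 \<le> k \<bullet> y"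
          by (auto simp: zero_less_mult_iff not_less)
        then have "\<exists>x\<in>T. k \<bullet> x = 0"
          using connected_ivt_hyperplane[OF T(1) T(3) T(4), of k 0]
            connected_ivt_hyperplane[OF T(1) T(4) T(3), of k 0] by blast
        then show False using T(2) k by blast
      qed
      then show "y \<in> ?c z" using T by auto
    qed
    have eq: "?c z = V \<inter> (\<Inter>k\<in>K. {x. ((k \<bullet> z) *\<^sub>R k) \<bullet> x > 0})"
      by (auto simp: mult.commute)
    have "convex (?c z)" unfolding eq
      by (intro convex_Int assms convex_INT convex_halfspace_gt)
    then have "connected (?c z)" by (rule convex_connected)
    moreover have "z \<in> ?c z" using z by (auto simp: zero_less_mult_iff not_less order_less_le)
    moreover have "?c z \<subseteq> ?U" by auto
    ultimately show "?c z \<subseteq> connected_component_set ?U z"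
      by (intro connected_component_maximal)
  qed
  then show ?thesis unfolding components_def by auto
qed

text \<open>A point with weak signs is a limit of points on the segment towards \<open>z\<close>,
  where all signs are strict.\<close>

lemma closure_sign_cell:
  fixes V :: "'v::euclidean_space set"
  assumes V: "convex V" "closed V" and z: "z \<in> V" "\<forall>k\<in>K. k \<bullet> z \<noteq> 0"
  shows "closure {x \<in> V. \<forall>k\<in>K. 0 < (k \<bullet> x) * (k \<bullet> z)} = {x \<in> V. \<forall>k\<in>K. 0 \<le> (k \<bullet> x) * (k \<bullet> z)}"
    (is "closure ?c = ?d")
proof
  have eq: "?d = V \<inter> (\<Inter>k\<in>K. {x. ((k \<bullet> z) *\<^sub>R k) \<bullet> x \<ge> 0})"
    by (auto simp: mult.commute)
  have "closed ?d" unfolding eq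
    by (intro closed_Int V closed_INT ballI closed_halfspace_ge)
  moreover have "?c \<subseteq> ?d" by (auto intro: less_imp_le)
  ultimately show "closure ?c \<subseteq> ?d" by (rule closure_minimal[rotated])
  show "?d \<subseteq> closure ?c"
  proof
    fix x assume x: "x \<in> ?d"
    define y where "y n = (1 - inverse (real (Suc n))) *\<^sub>R x + inverse (real (Suc n)) *\<^sub>R z" for n
    have "y n \<in> ?c" for n
    proof -
      let ?t = "inverse (real (Suc n))"
      have t: "0 < ?t" "?t \<le> 1" by (auto simp: inverse_eq_divide)
      have "y n \<in> V" unfolding y_def using x z t by (intro convexD[OF V(1)]) auto
      moreover have "0 < (k \<bullet> y n) * (k \<bullet> z)" if "k \<in> K" for k
      proof -
        have "(k \<bullet> y n) * (k \<bullet> z) = (1 - ?t) * ((k \<bullet> x) * (k \<bullet> z)) + ?t * ((k \<bullet> z) * (k \<bullet> z))"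
          by (simp add: y_def inner_add_right distrib_right mult.assoc)
        moreover have "0 < (k \<bullet> z) * (k \<bullet> z)" using z that by (auto simp: zero_less_mult_iff)
        moreover have "0 \<le> (k \<bullet> x) * (k \<bullet> z)" using x that by auto
        ultimately show ?thesis using t by (metis add_nonneg_pos diff_ge_0_iff_ge mult_nonneg_nonneg mult_pos_pos)
      qed
      ultimately show ?thesis by auto
    qed
    moreover have "y \<longlonglongrightarrow> (1 - 0) *\<^sub>R x + 0 *\<^sub>R z"
      unfolding y_def by (intro tendsto_intros LIMSEQ_inverse_real_of_nat)
    ultimately show "x \<in> closure ?c" unfolding closure_sequential by (intro exI[of _ y]) auto
  qed
qed

lemma hyp_uminus: "hyp (- a) = hyp a"
  by (auto simp: hyp_def)

lemma zero_in_hyp: "0 \<in> hyp a"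
  by (simp add: hyp_def)

text \<open>Double orthogonal complement; it turns inclusions between intersections of hyperplanes
  into membership in spans.\<close>

lemma mem_span_iff_orthogonal:
  fixes M :: "'v::euclidean_space set"
  shows "k \<in> span M \<longleftrightarrow> (\<forall>x. (\<forall>h\<in>M. h \<bullet> x = 0) \<longrightarrow> k \<bullet> x = 0)"
proof
  assume "k \<in> span M" then show "\<forall>x. (\<forall>h\<in>M. h \<bullet> x = 0) \<longrightarrow> k \<bullet> x = 0"
    using span_inner_zero by blast
next
  assume *: "\<forall>x. (\<forall>h\<in>M. h \<bullet> x = 0) \<longrightarrow> k \<bullet> x = 0"
  obtain y z where yz: "y \<in> span M" "\<And>w. w \<in> span M \<Longrightarrow> orthogonal z w" "k = y + z"
    using orthogonal_subspace_decomp_exists[of M k] by blast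
  have "\<forall>h\<in>M. h \<bullet> z = 0" using yz(2) by (auto simp: orthogonal_def inner_commute span_base)
  then have "k \<bullet> z = 0" using * by blast
  moreover have "y \<bullet> z = 0" using yz(1,2) by (auto simp: orthogonal_def inner_commute)
  ultimately have "z \<bullet> z = 0" using yz(3) by (simp add: inner_add_left)
  then show "k \<in> span M" using yz by simp
qed

lemma hyp_subset_iff: "hyp c \<subseteq> hyp a \<longleftrightarrow> a \<in> span {c}"
  unfolding mem_span_iff_orthogonal by (auto simp: hyp_def)

lemma hyp_Int_subset_iff: "hyp h \<inter> hyp h' \<subseteq> hyp k \<longleftrightarrow> k \<in> span {h, h'}"
  unfolding mem_span_iff_orthogonal by (auto simp: hyp_def)

lemma affine_hyp: "affine (hyp a)"
  unfolding hyp_def by (rule affine_hyperplane)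

lemma hyp_eq_of_aff_dim:
  fixes h c :: "'v::euclidean_space"
  assumes X: "X \<subseteq> hyp h" "aff_dim X = int DIM('v) - 1" and h: "h \<noteq> 0"
  shows "affine hull X = hyp h"
proof (rule affine_dim_equal)
  show "affine hull X \<noteq> {}" using X(2) DIM_positive[where 'a='v] by (auto simp: aff_dim_empty_eq[symmetric])
  show "affine hull X \<subseteq> hyp h" using X(1) affine_hyp by (rule hull_minimal)
  show "aff_dim (affine hull X) = aff_dim (hyp h)"
    using X(2) aff_dim_hyperplane[OF h, of 0] by (simp add: hyp_def)
qed (auto simp: affine_hyp)

section \<open>Regions and their facets\<close>

lemma regions_root_system:
  assumes R: "root_system \<Phi>" shows "regions (hyp ` \<Phi>) = region ` chambers \<Phi>"
proof -
  have U: "UNIV - \<Union>(hyp ` \<Phi>) = {x \<in> UNIV. \<forall>k\<in>\<Phi>. k \<bullet> x \<noteq> 0}" by (auto simp: hyp_def)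
  have cl: "closure {x \<in> UNIV. \<forall>k\<in>\<Phi>. 0 < (k \<bullet> x) * (k \<bullet> z)} = region {a \<in> \<Phi>. a \<bullet> z > 0}"
    if z: "\<forall>k\<in>\<Phi>. k \<bullet> z \<noteq> 0" for z
  proof -
    have "{x \<in> UNIV. \<forall>k\<in>\<Phi>. 0 \<le> (k \<bullet> x) * (k \<bullet> z)} = region {a \<in> \<Phi>. a \<bullet> z > 0}"
    proof (intro equalityI subsetI)
      fix x assume "x \<in> {x \<in> UNIV. \<forall>k\<in>\<Phi>. 0 \<le> (k \<bullet> x) * (k \<bullet> z)}"
      then show "x \<in> region {a \<in> \<Phi>. a \<bullet> z > 0}" by (auto simp: region_def zero_le_mult_iff)
    next
      fix x assume x: "x \<in> region {a \<in> \<Phi>. a \<bullet> z > 0}"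
      have "0 \<le> (k \<bullet> x) * (k \<bullet> z)" if k: "k \<in> \<Phi>" for k
      proof (cases "k \<bullet> z > 0")
        case True then show ?thesis using x k by (auto simp: region_def)
      next
        case False
        then have "(- k) \<bullet> z > 0" using z k by (auto simp: order_less_le)
        then have "0 \<le> (- k) \<bullet> x" using x root_system_uminus[OF R k] unfolding region_def by blast
        then show ?thesis using \<open>(- k) \<bullet> z > 0\<close> by (simp add: mult_nonpos_nonpos)
      qed
      then show "x \<in> {x \<in> UNIV. \<forall>k\<in>\<Phi>. 0 \<le> (k \<bullet> x) * (k \<bullet> z)}" by auto
    qed
    then show ?thesis using closure_sign_cell[of UNIV z \<Phi>] z by simp
  qed
  have "regions (hyp ` \<Phi>) = (\<lambda>z. region {a \<in> \<Phi>. a \<bullet> z > 0}) ` {z \<in> UNIV. \<forall>k\<in>\<Phi>. k \<bullet> z \<noteq> 0}"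
    unfolding regions_def U components_sign_cells[OF convex_UNIV] image_image
    using cl by (intro image_cong) auto
  also have "\<dots> = region ` chambers \<Phi>"
    unfolding chambers_def chamber_def by auto
  finally show ?thesis .
qed

lemma chamber_point:
  assumes "root_system \<Phi>" "chamber \<Phi> C"
  obtains z where "\<And>a. a \<in> \<Phi> \<Longrightarrow> a \<in> C \<longleftrightarrow> a \<bullet> z > 0" "\<And>a. a \<in> \<Phi> \<Longrightarrow> a \<bullet> z \<noteq> 0" "z \<in> region C"
  using assms(2) unfolding chamber_def region_def by (auto intro!: less_imp_le)

lemma region_subset_chamber:
  assumes R: "root_system \<Phi>" and C: "chamber \<Phi> C" and D: "D \<subseteq> \<Phi>" and s: "region C \<subseteq> region D"
  shows "D \<subseteq> C"
proof -
  obtain z where z: "\<And>a. a \<in> \<Phi> \<Longrightarrow> a \<in> C \<longleftrightarrow> a \<bullet> z > 0" "\<And>a. a \<in> \<Phi> \<Longrightarrow> a \<bullet> z \<noteq> 0" "z \<in> region C"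
    using chamber_point[OF R C] by metis
  then show ?thesis using s D by (force simp: region_def)
qed

lemma region_simples:
  assumes R: "root_system \<Phi>" and C: "chamber \<Phi> C" shows "region C = region (simples C)"
proof
  show "region C \<subseteq> region (simples C)" using simples_subset unfolding region_def by blast
  show "region (simples C) \<subseteq> region C"
    using simples_basis(2)[OF R C] nncone_inner_nonneg unfolding region_def by blast
qed

lemma affine_hull_region:
  assumes R: "root_system \<Phi>" and C: "chamber \<Phi> C" shows "affine hull (region C) = UNIV"
proof -
  obtain z where z: "\<And>a. a \<in> \<Phi> \<Longrightarrow> a \<in> C \<longleftrightarrow> a \<bullet> z > 0" using chamber_point[OF R C] by metis
  let ?O = "\<Inter>a\<in>C. {x. a \<bullet> x > 0}"
  have "open ?O" using chamber_finite[OF R C] by (intro open_INT) (auto intro: open_halfspace_gt)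
  moreover have "?O \<subseteq> region C" by (auto simp: region_def intro: less_imp_le)
  moreover have "z \<in> ?O" using z chamber_subset[OF C] by auto
  ultimately have "interior (region C) \<noteq> {}" by (metis empty_iff interior_maximal subsetD)
  then show ?thesis by (rule affine_hull_nonempty_interior)
qed

text \<open>The half-spaces of the simple roots describe the region irredundantly: by independence
  some point violates exactly one of them. The facets of such a polyhedron are its intersections
  with the bounding hyperplanes.\<close>

lemma facet_of_region:
  fixes \<Phi> :: "'v::euclidean_space set"
  assumes R: "root_system \<Phi>" and C: "chamber \<Phi> C"
  shows "F facet_of region C \<longleftrightarrow> (\<exists>a\<in>simples C. F = region C \<inter> hyp a)"
proof -
  let ?H = "\<lambda>a::'v. {x. (- a) \<bullet> x \<le> 0}"
  note ind = simples_basis(1)[OF R C]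
  have fin: "finite (simples C)" using chamber_finite[OF R C] simples_subset finite_subset by blast
  have sep: "\<exists>x. a \<bullet> x < 0 \<and> (\<forall>c\<in>simples C. c \<noteq> a \<longrightarrow> 0 \<le> c \<bullet> x)" if "a \<in> simples C" for a
  proof -
    obtain x where "\<forall>c\<in>simples C. c \<bullet> x = (if c = a then - 1 else 1)"
      using independent_dual_point[OF ind, of "\<lambda>c. if c = a then - 1 else 1"] by blast
    then show ?thesis using that by (intro exI[of _ x]) auto
  qed
  have inj: "inj_on ?H (simples C)"
  proof (rule inj_onI)
    fix a c assume ac: "a \<in> simples C" "c \<in> simples C" "?H a = ?H c"
    show "a = c"
    proof (rule ccontr)
      assume "a \<noteq> c"
      obtain x where x: "a \<bullet> x < 0" "\<forall>c\<in>simples C. c \<noteq> a \<longrightarrow> 0 \<le> c \<bullet> x" using sep[OF ac(1)] by blast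
      then have "x \<in> ?H c" "x \<notin> ?H a" using ac(2) \<open>a \<noteq> c\<close> by auto
      then show False using ac(3) by blast
    qed
  qed
  \<comment> \<open>\<open>facet_of_polyhedron_explicit\<close> wants a normal for each half-space
    \<open>h\<close>, so the simple root is recovered from \<open>h\<close> by inverting the
    injection \<open>?H\<close>.\<close>
  define n where "n h = - inv_into (simples C) ?H h" for h
  have n: "n (?H a) = - a" if "a \<in> simples C" for a
    unfolding n_def using inv_into_f_f[OF inj that] by simp
  have eq: "region C = affine hull (region C) \<inter> \<Inter>(?H ` simples C)"
    unfolding affine_hull_region[OF R C] by (subst region_simples[OF R C]) (auto simp: region_def)
  have "F facet_of region C \<longleftrightarrow> (\<exists>h. h \<in> ?H ` simples C \<and> F = region C \<inter> {x. n h \<bullet> x = 0})"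
  proof (rule facet_of_polyhedron_explicit[OF _ eq])
    show "finite (?H ` simples C)" using fin by simp
  next
    fix h assume "h \<in> ?H ` simples C"
    then obtain a where a: "a \<in> simples C" "h = ?H a" by blast
    then have "a \<noteq> 0" using simples_subset chamber_subset[OF C] root_system_nonzero[OF R] by blast
    then show "n h \<noteq> 0 \<and> h = {x. n h \<bullet> x \<le> 0}" using n[OF a(1)] a(2) by simp
  next
    fix F' assume F': "F' \<subset> ?H ` simples C"
    then obtain a where a: "a \<in> simples C" "?H a \<notin> F'" by blast
    obtain x where x: "a \<bullet> x < 0" "\<forall>c\<in>simples C. c \<noteq> a \<longrightarrow> 0 \<le> c \<bullet> x" using sep[OF a(1)] by blast
    have "x \<in> \<Inter>F'"
    proof
      fix h assume "h \<in> F'"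
      then obtain c where "c \<in> simples C" "h = ?H c" using F' by blast
      then show "x \<in> h" using x a \<open>h \<in> F'\<close> by auto
    qed
    moreover have "x \<notin> region C" using x(1) a(1) simples_subset[of C] by (force simp: region_def)
    moreover have "region C \<subseteq> \<Inter>F'" using eq F' by blast
    ultimately show "region C \<subset> affine hull (region C) \<inter> \<Inter>F'"
      unfolding affine_hull_region[OF R C] by blast
  qed
  also have "\<dots> \<longleftrightarrow> (\<exists>a\<in>simples C. F = region C \<inter> hyp a)"
    using n by (auto simp: hyp_def)
  finally show ?thesis .
qed

lemma aff_dim_facet_region:
  fixes \<Phi> :: "'v::euclidean_space set"
  assumes R: "root_system \<Phi>" and C: "chamber \<Phi> C" and a: "a \<in> simples C"
  shows "aff_dim (region C \<inter> hyp a) = int DIM('v) - 1"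
proof -
  have "(region C \<inter> hyp a) facet_of region C" using facet_of_region[OF R C] a by blast
  moreover have "aff_dim (region C) = int DIM('v)"
    using affine_hull_region[OF R C] aff_dim_affine_hull[of "region C"] by simp
  ultimately show ?thesis by (simp add: facet_of_def)
qed

lemma facet_hyperplanes_region:
  fixes \<Phi> :: "'v::euclidean_space set"
  assumes R: "root_system \<Phi>" and C: "chamber \<Phi> C"
  shows "facet_hyperplanes (region C) = hyp ` simples C"
proof -
  have "affine hull (region C \<inter> hyp a) = hyp a" if a: "a \<in> simples C" for a
    using aff_dim_facet_region[OF R C a] root_system_nonzero[OF R, of a] a simples_subset[of C] chamber_subset[OF C]
    by (intro hyp_eq_of_aff_dim) auto
  then show ?thesis unfolding facet_hyperplanes_def facet_of_region[OF R C] by (auto simp: image_iff)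
qed

lemma rank_two_subarrangement_hyp:
  "rank_two_subarrangement (hyp ` \<Phi>) (hyp h) (hyp h') = hyp ` (\<Phi> \<inter> span {h, h'})"
  unfolding rank_two_subarrangement_def using hyp_Int_subset_iff by auto

text \<open>For a lower wall \<open>h\<close> of \<open>C\<close>, this is the shard in
  \<open>hyp h\<close> that contains the facet of \<open>C\<close> there, see
  \<open>lower_shards_region\<close>.\<close>

definition shard_of :: "'v::euclidean_space set \<Rightarrow> 'v set \<Rightarrow> 'v \<Rightarrow> 'v set" where
  "shard_of P C h = {x. h \<bullet> x = 0 \<and> (\<forall>k\<in>cutters P {h}. if k \<in> C then 0 \<le> k \<bullet> x else k \<bullet> x \<le> 0)}"

context based_root_system
begin

lemma hyp_image_P: "hyp ` \<Phi> = hyp ` P"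
proof
  show "hyp ` P \<subseteq> hyp ` \<Phi>" using chamber_subset[OF P] by blast
  show "hyp ` \<Phi> \<subseteq> hyp ` P"
  proof clarify
    fix a assume a: "a \<in> \<Phi>"
    then have "a \<in> P \<or> - a \<in> P" using chamber_uminus_iff[OF R P a] by blast
    then show "hyp a \<in> hyp ` P" using hyp_uminus[of a] by (metis image_eqI)
  qed
qed

lemma P_nonzero: "a \<in> P \<Longrightarrow> a \<noteq> 0"
  using root_system_nonzero[OF R] chamber_subset[OF P] by blast

lemma hyp_subset_inj: "a \<in> P \<Longrightarrow> c \<in> P \<Longrightarrow> hyp a \<subseteq> hyp c \<Longrightarrow> c = a"
  using chamber_parallel[OF R P] hyp_subset_iff by blast

lemma hyp_inj: "a \<in> P \<Longrightarrow> c \<in> P \<Longrightarrow> hyp a = hyp c \<longleftrightarrow> a = c"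
  using hyp_subset_inj by blast

lemma separating_hyperplanes_region:
  assumes C: "chamber \<Phi> C"
  shows "separating_hyperplanes (hyp ` \<Phi>) (region P) (region C) = hyp ` (P - C)"
proof (intro equalityI subsetI)
  fix H assume "H \<in> separating_hyperplanes (hyp ` \<Phi>) (region P) (region C)"
  then obtain c a b where c: "c \<in> P" "H = hyp c" and a: "a \<noteq> 0" "H = {x. a \<bullet> x = b}"
    "region C \<subseteq> {x. a \<bullet> x \<le> b}" "region P \<subseteq> {x. a \<bullet> x \<ge> b}"
    unfolding separating_hyperplanes_def hyp_image_P by blast
  have b: "b = 0" using zero_in_hyp[of c] a(2) c(2) by auto
  then have "hyp c \<subseteq> hyp a" using a c by (auto simp: hyp_def)
  then obtain t where t: "a = t *\<^sub>R c" using hyp_subset_iff[of c a] by (auto simp: span_singleton)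
  have c\<Phi>: "c \<in> \<Phi>" using c chamber_subset[OF P] by blast
  obtain z where z: "c \<bullet> z > 0" "z \<in> region P" using chamber_point[OF R P] c(1) c\<Phi> by metis
  obtain y where y: "c \<in> C \<longleftrightarrow> c \<bullet> y > 0" "y \<in> region C" using chamber_point[OF R C] c\<Phi> by metis
  have "a \<bullet> z \<ge> 0" using z a b by blast
  then have "t \<ge> 0" using z t by (auto simp: zero_le_mult_iff)
  then have "t > 0" using t a(1) by (auto simp: order_less_le)
  have "a \<bullet> y \<le> 0" using y a b by blast
  then have "c \<notin> C" using y t \<open>t > 0\<close> by (auto simp: mult_le_0_iff)
  then show "H \<in> hyp ` (P - C)" using c by blast
next
  fix H assume "H \<in> hyp ` (P - C)"
  then obtain c where c: "c \<in> P" "c \<notin> C" "H = hyp c" by blast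
  have c\<Phi>: "c \<in> \<Phi>" using c chamber_subset[OF P] by blast
  have "- c \<in> C" using chamber_uminus_iff[OF R C c\<Phi>] c by blast
  then have "region C \<subseteq> {x. c \<bullet> x \<le> 0}" by (force simp: region_def)
  moreover have "region P \<subseteq> {x. c \<bullet> x \<ge> 0}" using c by (auto simp: region_def)
  ultimately show "H \<in> separating_hyperplanes (hyp ` \<Phi>) (region P) (region C)"
    unfolding separating_hyperplanes_def using c c\<Phi> P_nonzero[OF c(1)] by (auto simp: hyp_def)
qed

lemma basic_hyperplanes_region:
  "basic_hyperplanes (hyp ` \<Phi>) (region P) (hyp h) (hyp h') = hyp ` simples (P \<inter> span {h, h'})"
proof -
  let ?\<Psi> = "\<Phi> \<inter> span {h, h'}"
  note RS = root_system_span[OF R, of "{h, h'}"] and PS = chamber_span[OF P, of "{h, h'}"]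
  have "(THE R. R \<in> regions (hyp ` ?\<Psi>) \<and> region P \<subseteq> R) = region (P \<inter> span {h, h'})"
  proof (rule the_equality)
    show "region (P \<inter> span {h, h'}) \<in> regions (hyp ` ?\<Psi>) \<and> region P \<subseteq> region (P \<inter> span {h, h'})"
      unfolding regions_root_system[OF RS] using PS by (auto simp: chambers_def region_def)
  next
    fix X assume X: "X \<in> regions (hyp ` ?\<Psi>) \<and> region P \<subseteq> X"
    then obtain E where E: "chamber ?\<Psi> E" "X = region E"
      unfolding regions_root_system[OF RS] by (auto simp: chambers_def)
    then have "E \<subseteq> P" using X chamber_subset[OF E(1)] by (intro region_subset_chamber[OF R P]) auto
    then have "E = P \<inter> span {h, h'}"
      using chamber_subset[OF E(1)] by (intro chamber_eqI[OF RS E(1) PS]) auto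
    then show "X = region (P \<inter> span {h, h'})" using E by simp
  qed
  then show ?thesis
    unfolding basic_hyperplanes_def rank_two_subarrangement_hyp
    using facet_hyperplanes_region[OF RS PS] by simp
qed

lemma cuts_iff_cut:
  assumes "k \<in> P" "h \<in> P"
  shows "cuts (hyp ` \<Phi>) (region P) (hyp k) (hyp h) \<longleftrightarrow> cut P k h"
proof -
  have "hyp a \<in> hyp ` simples (P \<inter> X) \<longleftrightarrow> a \<in> simples (P \<inter> X)" if "a \<in> P" for a X
    using that hyp_inj simples_subset[of "P \<inter> X"] by blast
  moreover have "hyp k \<in> hyp ` \<Phi>" "hyp h \<in> hyp ` \<Phi>" using assms by (auto simp: hyp_image_P)
  ultimately show ?thesis
    unfolding cuts_def basic_hyperplanes_region cut_def using assms hyp_inj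
    by (auto simp: insert_commute)
qed

lemma cutters_subset: "cutters P L \<subseteq> P"
  by (auto simp: cutters_def cut_def)

lemma cutters_singleton_notin_span: "k \<in> cutters P {h} \<Longrightarrow> k \<notin> span {h}"
  using chamber_parallel[OF R P, of h k] by (auto simp: cutters_def cut_def)

lemma shards_in_hyp:
  assumes h: "h \<in> P"
  shows "shards_in (hyp ` \<Phi>) (region P) (hyp h) =
    (\<lambda>z. {x \<in> hyp h. \<forall>k\<in>cutters P {h}. 0 \<le> (k \<bullet> x) * (k \<bullet> z)}) ` {z \<in> hyp h. \<forall>k\<in>cutters P {h}. k \<bullet> z \<noteq> 0}"
proof -
  have "{K \<in> hyp ` \<Phi>. cuts (hyp ` \<Phi>) (region P) K (hyp h)} = hyp ` cutters P {h}"
    using cuts_iff_cut[OF _ h] unfolding hyp_image_P cutters_def by (auto simp: cut_def)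
  then have "hyp h - \<Union>{K \<in> hyp ` \<Phi>. cuts (hyp ` \<Phi>) (region P) K (hyp h)}
      = {x \<in> hyp h. \<forall>k\<in>cutters P {h}. k \<bullet> x \<noteq> 0}" by (auto simp: hyp_def)
  moreover have "convex (hyp h)" "closed (hyp h)"
    unfolding hyp_def by (auto intro: convex_hyperplane closed_hyperplane)
  ultimately show ?thesis
    unfolding shards_in_def by (simp add: components_sign_cells image_image)
      (intro image_cong refl closure_sign_cell; simp)
qed

text \<open>The cell is full-dimensional in \<open>hyp h\<close>: from \<open>z\<close> one can move
  a little in every direction of \<open>hyp h\<close>. So only one hyperplane of the arrangement
  contains it.\<close>

lemma shard_hyperplane_cell:
  assumes h: "h \<in> P" and z: "z \<in> hyp h" "\<forall>k\<in>cutters P {h}. k \<bullet> z \<noteq> 0"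
  shows "shard_hyperplane (hyp ` \<Phi>) {x \<in> hyp h. \<forall>k\<in>cutters P {h}. 0 \<le> (k \<bullet> x) * (k \<bullet> z)} = hyp h"
  unfolding shard_hyperplane_def
proof (rule the_equality)
  let ?S = "{x \<in> hyp h. \<forall>k\<in>cutters P {h}. 0 \<le> (k \<bullet> x) * (k \<bullet> z)}"
  show "hyp h \<in> hyp ` \<Phi> \<and> ?S \<subseteq> hyp h" using h by (auto simp: hyp_image_P)
  fix H assume "H \<in> hyp ` \<Phi> \<and> ?S \<subseteq> H"
  then obtain c where c: "c \<in> P" "H = hyp c" "?S \<subseteq> hyp c" unfolding hyp_image_P by blast
  have "hyp h \<subseteq> hyp c"
  proof
    fix y assume y: "y \<in> hyp h"
    have fc: "finite (cutters P {h})" using cutters_subset fin finite_subset by blast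
    have pos: "(k \<bullet> z) * (k \<bullet> z) > 0" if "k \<in> cutters P {h}" for k
      using z(2) that by (metis not_real_square_gt_zero)
    obtain e where e: "e > 0" "\<And>k. k \<in> cutters P {h} \<Longrightarrow> (k \<bullet> z) * (k \<bullet> z) + e * ((k \<bullet> y) * (k \<bullet> z)) > 0"
      using finite_perturbation[where f = "\<lambda>k. (k \<bullet> z) * (k \<bullet> z)" and g = "\<lambda>k. (k \<bullet> y) * (k \<bullet> z)", OF fc pos] by blast
    have "z + e *\<^sub>R y \<in> ?S"
      using z y e(2) by (auto simp: hyp_def inner_add_right distrib_right mult.assoc intro!: less_imp_le)
    moreover have "z \<in> ?S" using z by auto
    ultimately have "c \<bullet> (z + e *\<^sub>R y) = 0" "c \<bullet> z = 0" using c by (auto simp: hyp_def)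
    then show "y \<in> hyp c" using e(1) by (simp add: hyp_def inner_add_right)
  qed
  then show "H = hyp h" using hyp_subset_inj[OF h c(1)] c(2) by simp
qed

text \<open>A face point of \<open>C\<close> on the lower wall \<open>h\<close> avoids all cutters
  of \<open>h\<close>, so it selects a shard, and this shard contains the whole facet. The converse
  is a dimension argument.\<close>

lemma lower_shards_region:
  assumes C: "chamber \<Phi> C"
  shows "lower_shards (hyp ` \<Phi>) (region P) (region C) = shard_of P C ` lower P C"
proof (intro equalityI subsetI)
  fix \<Sigma> assume "\<Sigma> \<in> shard_of P C ` lower P C"
  then obtain h where h: "h \<in> P" "- h \<in> simples C" "\<Sigma> = shard_of P C h" by (auto simp: lower_def)
  have hC: "- h \<in> C" using h simples_subset by blast
  have h\<Phi>: "h \<in> \<Phi>" using h chamber_subset[OF P] by blast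
  obtain x where x: "\<And>d. d \<in> span {- h} \<Longrightarrow> d \<bullet> x = 0"
    "\<And>a. a \<in> \<Phi> \<Longrightarrow> a \<notin> span {- h} \<Longrightarrow> a \<bullet> x \<noteq> 0"
    "\<And>a. a \<in> \<Phi> \<Longrightarrow> a \<notin> span {- h} \<Longrightarrow> a \<in> C \<longleftrightarrow> a \<bullet> x > 0"
    using face_point[OF R C, of "{- h}"] h(2) by (metis empty_subsetI insert_subset)
  have sp: "span {- h} = span {h}" using span_uminus_image[of "{h}"] by simp
  have xh: "x \<in> hyp h" using x(1)[of "- h"] by (simp add: hyp_def span_base)
  have k: "k \<bullet> x \<noteq> 0" "k \<in> C \<longleftrightarrow> k \<bullet> x > 0" if "k \<in> cutters P {h}" for k
    using x(2,3)[of k] that cutters_subset cutters_singleton_notin_span[OF that] chamber_subset[OF P] sp by blast+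
  have cell: "\<Sigma> = {y \<in> hyp h. \<forall>k\<in>cutters P {h}. 0 \<le> (k \<bullet> y) * (k \<bullet> x)}"
  proof -
    have "(if k \<in> C then 0 \<le> k \<bullet> y else k \<bullet> y \<le> 0) \<longleftrightarrow> 0 \<le> (k \<bullet> y) * (k \<bullet> x)"
      if "k \<in> cutters P {h}" for k y
      using k[OF that] by (auto simp: zero_le_mult_iff not_less order_less_le)
    then show ?thesis unfolding h(3) shard_of_def by (auto simp: hyp_def)
  qed
  have "\<Sigma> \<in> shards_in (hyp ` \<Phi>) (region P) (hyp h)"
    unfolding shards_in_hyp[OF h(1)] using cell xh k(1) by blast
  then have "\<Sigma> \<in> shards (hyp ` \<Phi>) (region P)" using h\<Phi> unfolding shards_def by blast
  moreover have "region C \<inter> \<Sigma> = region C \<inter> hyp (- h)"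
  proof -
    have "if k \<in> C then 0 \<le> k \<bullet> y else k \<bullet> y \<le> 0" if "y \<in> region C" "k \<in> cutters P {h}" for y k
    proof -
      have "k \<in> \<Phi>" using that cutters_subset chamber_subset[OF P] by blast
      then have "k \<in> C \<or> - k \<in> C" using chamber_uminus_iff[OF R C] by blast
      then show ?thesis using that(1) by (fastforce simp: region_def)
    qed
    then show ?thesis unfolding h(3) shard_of_def by (auto simp: hyp_def)
  qed
  then have "aff_dim (region C \<inter> \<Sigma>) = int DIM('v) - 1" using aff_dim_facet_region[OF R C h(2)] by simp
  moreover have "shard_hyperplane (hyp ` \<Phi>) \<Sigma> = hyp h"
    unfolding cell using shard_hyperplane_cell[OF h(1) xh] k(1) by blast
  moreover have "h \<in> P - C" using h hC chamber_uminus_iff[OF R C h\<Phi>] by blast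
  ultimately show "\<Sigma> \<in> lower_shards (hyp ` \<Phi>) (region P) (region C)"
    unfolding lower_shards_def separating_hyperplanes_region[OF C] by simp
next
  fix \<Sigma> assume \<Sigma>: "\<Sigma> \<in> lower_shards (hyp ` \<Phi>) (region P) (region C)"
  then have dim: "aff_dim (region C \<inter> \<Sigma>) = int DIM('v) - 1" by (simp add: lower_shards_def)
  obtain H where H: "H \<in> hyp ` \<Phi>" "\<Sigma> \<in> shards_in (hyp ` \<Phi>) (region P) H"
    using \<Sigma> unfolding lower_shards_def shards_def by blast
  then obtain h where h: "h \<in> P" "H = hyp h" unfolding hyp_image_P by blast
  obtain z where z: "z \<in> hyp h" "\<forall>k\<in>cutters P {h}. k \<bullet> z \<noteq> 0"
    and cell: "\<Sigma> = {x \<in> hyp h. \<forall>k\<in>cutters P {h}. 0 \<le> (k \<bullet> x) * (k \<bullet> z)}"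
    using H(2) unfolding h(2) shards_in_hyp[OF h(1)] by blast
  note h = h(1)
  have "hyp h \<in> hyp ` (P - C)"
    using \<Sigma> shard_hyperplane_cell[OF h z] unfolding lower_shards_def separating_hyperplanes_region[OF C] cell by simp
  then have hC: "h \<notin> C" using hyp_inj[OF h] by blast
  have h\<Phi>: "h \<in> \<Phi>" using h chamber_subset[OF P] by blast
  have mhC: "- h \<in> C" using chamber_uminus_iff[OF R C h\<Phi>] hC by blast
  have sub: "region C \<inter> \<Sigma> \<subseteq> hyp h" using cell by blast
  \<comment> \<open>A set of dimension one less than the space lies in at most one hyperplane. This
    is applied twice: a decomposition of \<open>- h\<close> in \<open>C\<close>, or a cutter with
    the wrong sign, would put \<open>region C \<inter> \<Sigma>\<close> into a second one.\<close>
  have no: False if c: "c \<in> \<Phi>" "c \<noteq> h" "c \<noteq> - h" "region C \<inter> \<Sigma> \<subseteq> hyp c" for c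
  proof -
    have "hyp h = affine hull (region C \<inter> \<Sigma>)" "hyp c = affine hull (region C \<inter> \<Sigma>)"
      using hyp_eq_of_aff_dim[OF sub dim] hyp_eq_of_aff_dim[OF c(4) dim] c(1) h\<Phi> root_system_nonzero[OF R] by blast+
    then have "c \<in> span {h}" using hyp_subset_iff by blast
    then obtain t where "c = t *\<^sub>R h" by (auto simp: span_singleton)
    then show False using root_system_parallel[OF R h\<Phi> c(1)] c by blast
  qed
  have "- h \<in> simples C"
  proof (rule ccontr)
    assume "- h \<notin> simples C"
    then obtain c d p q where c: "c \<in> C" "d \<in> C" "p > 0" "q > 0" "c \<noteq> - h" "- h = p *\<^sub>R c + q *\<^sub>R d"
      using mhC unfolding simples_def by blast
    have "region C \<inter> \<Sigma> \<subseteq> hyp c"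
    proof
      fix x assume x: "x \<in> region C \<inter> \<Sigma>"
      have "h \<bullet> x = 0" using x cell by (auto simp: hyp_def)
      then have "p * (c \<bullet> x) + q * (d \<bullet> x) = 0"
        using arg_cong[OF c(6), of "\<lambda>v. v \<bullet> x"] by (simp add: inner_add_left)
      moreover have "0 \<le> c \<bullet> x" "0 \<le> d \<bullet> x" using x c by (auto simp: region_def)
      ultimately have "c \<bullet> x = 0" using c(3,4) by (smt (verit) mult_nonneg_nonneg mult_pos_pos)
      then show "x \<in> hyp c" by (simp add: hyp_def)
    qed
    moreover have "c \<in> \<Phi>" "c \<noteq> h" using c hC chamber_subset[OF C] by auto
    ultimately show False using no c(5) by blast
  qed
  then have hl: "h \<in> lower P C" using h by (simp add: lower_def)
  have sgn: "k \<in> C \<longleftrightarrow> k \<bullet> z > 0" if k: "k \<in> cutters P {h}" for k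
  proof (rule ccontr)
    assume ne: "\<not> (k \<in> C \<longleftrightarrow> k \<bullet> z > 0)"
    have kP: "k \<in> P" "k \<in> \<Phi>" "k \<noteq> h" using k cutters_subset chamber_subset[OF P] by (auto simp: cutters_def cut_def)
    have kh: "k \<noteq> - h" using kP h P_uminus by blast
    have kz: "k \<bullet> z \<noteq> 0" using z k by blast
    have "region C \<inter> \<Sigma> \<subseteq> hyp k"
    proof
      fix x assume x: "x \<in> region C \<inter> \<Sigma>"
      have 1: "0 \<le> (k \<bullet> x) * (k \<bullet> z)" using x cell k by auto
      have "k \<bullet> x = 0"
      proof (cases "k \<in> C")
        case True
        then have "0 \<le> k \<bullet> x" "k \<bullet> z < 0" using x ne kz by (auto simp: region_def)
        then show ?thesis using 1 by (auto simp: zero_le_mult_iff)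
      next
        case False
        then have "- k \<in> C" using chamber_uminus_iff[OF R C kP(2)] by blast
        then have "k \<bullet> x \<le> 0" using x by (force simp: region_def)
        moreover have "k \<bullet> z > 0" using False ne by blast
        ultimately show ?thesis using 1 by (auto simp: zero_le_mult_iff)
      qed
      then show "x \<in> hyp k" by (simp add: hyp_def)
    qed
    then show False using no kP kh by blast
  qed
  have "(if k \<in> C then 0 \<le> k \<bullet> y else k \<bullet> y \<le> 0) \<longleftrightarrow> 0 \<le> (k \<bullet> y) * (k \<bullet> z)"
      if "k \<in> cutters P {h}" for k y
    using sgn[OF that] z(2) that by (auto simp: zero_le_mult_iff not_less order_less_le)
  then have "\<Sigma> = shard_of P C h" unfolding cell shard_of_def by (auto simp: hyp_def)
  then show "\<Sigma> \<in> shard_of P C ` lower P C" using hl by blast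
qed

lemma Inter_shards:
  "\<Inter>(shard_of P C ` lower P C) = {x. (\<forall>h\<in>lower P C. h \<bullet> x = 0) \<and>
     (\<forall>k\<in>cutters P (lower P C). if k \<in> C then 0 \<le> k \<bullet> x else k \<bullet> x \<le> 0)}"
  by (auto simp: shard_of_def cutters_def)

text \<open>The cone of \<open>D\<close> spans the orthogonal complement of its lower walls, so
  inclusion of cones forces inclusion of flats, and a relative interior point of the cone of
  \<open>D\<close> reveals the signs. For the other direction, \<open>cut_basic_of_cut\<close>
  trades a cutter of a lower wall of \<open>C\<close> for a cutter of a lower wall of
  \<open>D\<close> that is proportional to it modulo the flat.\<close>

theorem Inter_shards_subset_iff:
  assumes C: "chamber \<Phi> C" and D: "chamber \<Phi> D"
  shows "\<Inter>(shard_of P D ` lower P D) \<subseteq> \<Inter>(shard_of P C ` lower P C) \<longleftrightarrow> shard_le P C D"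
proof -
  define L where "L = lower P D"
  have UL: "uminus ` L \<subseteq> simples D" by (auto simp: L_def lower_def)
  have spL: "span (uminus ` L) = span L" by (rule span_uminus_image)
  have flat: "simples (P \<inter> span L) = L" unfolding L_def by (rule lower_flat[OF D])
  obtain x where x: "\<And>d. d \<in> span L \<Longrightarrow> d \<bullet> x = 0"
    "\<And>a. a \<in> \<Phi> \<Longrightarrow> a \<notin> span L \<Longrightarrow> a \<bullet> x \<noteq> 0"
    "\<And>a. a \<in> \<Phi> \<Longrightarrow> a \<notin> span L \<Longrightarrow> a \<in> D \<longleftrightarrow> a \<bullet> x > 0"
    using face_point[OF R D UL] unfolding spL by metis
  have cP: "k \<in> P" "k \<in> \<Phi>" if "k \<in> cutters P M" for k M
    using that cutters_subset chamber_subset[OF P] by blast+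
  show ?thesis
  proof
    assume le: "shard_le P C D"
    show "\<Inter>(shard_of P D ` lower P D) \<subseteq> \<Inter>(shard_of P C ` lower P C)"
    proof
      fix y assume y0: "y \<in> \<Inter>(shard_of P D ` lower P D)"
      then have y: "\<And>h. h \<in> L \<Longrightarrow> h \<bullet> y = 0"
        "\<And>k. k \<in> cutters P L \<Longrightarrow> if k \<in> D then 0 \<le> k \<bullet> y else k \<bullet> y \<le> 0"
        unfolding Inter_shards L_def by auto
      have yL: "a \<bullet> y = 0" if "a \<in> span L" for a using span_inner_zero[OF that] y(1) by blast
      have "if k \<in> C then 0 \<le> k \<bullet> y else k \<bullet> y \<le> 0" if k: "k \<in> cutters P (lower P C)" for k
      proof (cases "k \<in> span L")
        case True then show ?thesis using yL by simp
      next
        case False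
        have kCD: "k \<in> C \<longleftrightarrow> k \<in> D" using le k False by (auto simp: shard_le_def L_def)
        obtain a where a: "a \<in> lower P C" "cut P k a" using k by (auto simp: cutters_def)
        have aL: "a \<in> span L" using a le by (auto simp: shard_le_def L_def)
        obtain k' h where k': "k' \<in> P" "k' \<in> span (insert k L)" "k' \<notin> span L" "h \<in> L" "cut P k' h"
          using cut_basic_of_cut[OF R P flat aL False a(2)] by metis
        obtain r where r: "k' - r *\<^sub>R k \<in> span L" using k'(2) by (auto simp: span_breakdown_eq)
        have kx: "k' \<bullet> x = r * (k \<bullet> x)" "k' \<bullet> y = r * (k \<bullet> y)"
          using x(1)[OF r] yL[OF r] by (auto simp: inner_diff_left)
        have k'\<Phi>: "k' \<in> \<Phi>" using k' chamber_subset[OF P] by blast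
        have "k' \<in> cutters P L" using k' by (auto simp: cutters_def)
        then have "if k' \<in> D then 0 \<le> k' \<bullet> y else k' \<bullet> y \<le> 0" by (rule y(2))
        then show ?thesis
          unfolding kCD x(3)[OF k'\<Phi> k'(3)] x(3)[OF cP(2)[OF k] False] kx
          using x(2)[OF k'\<Phi> k'(3)] x(2)[OF cP(2)[OF k] False] unfolding kx
          by (auto simp: zero_less_mult_iff zero_le_mult_iff mult_le_0_iff split: if_splits)
      qed
      moreover have "h \<bullet> y = 0" if "h \<in> lower P C" for h
        using yL[of h] that le by (auto simp: shard_le_def L_def)
      ultimately show "y \<in> \<Inter>(shard_of P C ` lower P C)" unfolding Inter_shards by auto
    qed
  next
    assume sub: "\<Inter>(shard_of P D ` lower P D) \<subseteq> \<Inter>(shard_of P C ` lower P C)"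
    have kL: "k \<notin> span L" if "k \<in> cutters P L" for k
      using cutters_notin_span[OF _ that, of L] flat by simp
    have "x \<in> \<Inter>(shard_of P D ` lower P D)"
      unfolding Inter_shards unfolding L_def[symmetric]
      using x(1) x(3)[OF cP(2) kL] by (auto simp: span_base not_less intro: less_imp_le)
    then have xC: "x \<in> \<Inter>(shard_of P C ` lower P C)" using sub by blast
    have "lower P C \<subseteq> span L"
    proof
      fix a assume a: "a \<in> lower P C"
      \<comment> \<open>A small move from the interior point \<open>x\<close> along any
        \<open>y\<close> orthogonal to \<open>L\<close> stays in the cone of \<open>D\<close>, so
        \<open>a\<close> must vanish at \<open>y\<close>.\<close>
      show "a \<in> span L" unfolding mem_span_iff_orthogonal
      proof (intro allI impI)
        fix y assume y: "\<forall>h\<in>L. h \<bullet> y = 0"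
        have fc: "finite (cutters P L)" using cutters_subset fin finite_subset by blast
        have pos: "(k \<bullet> x) * (k \<bullet> x) > 0" if "k \<in> cutters P L" for k
          using x(2)[OF cP(2) kL] that by (metis not_real_square_gt_zero)
        obtain e where e: "e > 0" "\<And>k. k \<in> cutters P L \<Longrightarrow> (k \<bullet> x) * (k \<bullet> x) + e * ((k \<bullet> y) * (k \<bullet> x)) > 0"
          using finite_perturbation[where f = "\<lambda>k. (k \<bullet> x) * (k \<bullet> x)" and g = "\<lambda>k. (k \<bullet> y) * (k \<bullet> x)", OF fc pos] by blast
        have "x + e *\<^sub>R y \<in> \<Inter>(shard_of P D ` lower P D)"
        proof -
          have "if k \<in> D then 0 \<le> k \<bullet> (x + e *\<^sub>R y) else k \<bullet> (x + e *\<^sub>R y) \<le> 0" if k: "k \<in> cutters P L" for k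
          proof -
            have "0 < (k \<bullet> (x + e *\<^sub>R y)) * (k \<bullet> x)"
              using e(2)[OF k] by (simp add: inner_add_right distrib_right mult.assoc)
            then show ?thesis using x(3)[OF cP(2)[OF k] kL[OF k]] by (auto simp: zero_less_mult_iff)
          qed
          moreover have "h \<bullet> (x + e *\<^sub>R y) = 0" if "h \<in> L" for h
            using x(1)[OF span_base[OF that]] y that by (simp add: inner_add_right)
          ultimately show ?thesis unfolding Inter_shards unfolding L_def[symmetric] by auto
        qed
        then have "x + e *\<^sub>R y \<in> \<Inter>(shard_of P C ` lower P C)" using sub by blast
        then have "a \<bullet> (x + e *\<^sub>R y) = 0" "a \<bullet> x = 0" using xC a unfolding Inter_shards by auto
        then show "a \<bullet> y = 0" using e(1) by (simp add: inner_add_right)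
      qed
    qed
    moreover have "k \<in> C \<longleftrightarrow> k \<in> D" if k: "k \<in> cutters P (lower P C)" "k \<notin> span L" for k
    proof -
      have "if k \<in> C then 0 \<le> k \<bullet> x else k \<bullet> x \<le> 0" using xC k unfolding Inter_shards by auto
      then show ?thesis using x(2,3)[OF cP(2)[OF k(1)] k(2)] by (auto split: if_splits)
    qed
    ultimately show "shard_le P C D" by (auto simp: shard_le_def L_def)
  qed
qed

end

section \<open>The root system of a finite reflection group\<close>

definition reflect :: "'v::euclidean_space \<Rightarrow> 'v \<Rightarrow> 'v" where
  "reflect a x = x - (2 * (a \<bullet> x)) *\<^sub>R a"

lemma reflect_uminus: "reflect (- a) = reflect a"
  by (auto simp: reflect_def)

lemma hyp_eq_fixed: "norm a = 1 \<Longrightarrow> {x. reflect a x = x} = hyp a"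
  by (auto simp: reflect_def hyp_def)

lemma unit_parallel:
  fixes a c :: "'v::euclidean_space"
  assumes "norm a = 1" "norm c = 1" "hyp a \<subseteq> hyp c" shows "c = a \<or> c = - a"
proof -
  obtain t where t: "c = t *\<^sub>R a" using assms(3) hyp_subset_iff[of a c] by (auto simp: span_singleton)
  then have "\<bar>t\<bar> = 1" using assms by (metis mult.right_neutral norm_scaleR)
  then show ?thesis using t by (auto simp: abs_if split: if_splits)
qed

text \<open>The reflection in \<open>d\<close> changes a root by a multiple of \<open>d\<close>, so
  it keeps the value at a point of the wall of \<open>d\<close>. At an interior point of that wall,
  the sign of this value decides positivity of every root not proportional to
  \<open>d\<close>.\<close>

lemma reflect_positive:
  assumes R: "root_system \<Phi>" and P: "chamber \<Phi> P" and d: "d \<in> simples P" and c: "c \<in> P" "c \<noteq> d"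
  shows "reflect d c \<in> P"
proof -
  have d\<Phi>: "d \<in> P" "d \<in> \<Phi>" using d simples_subset chamber_subset[OF P] by blast+
  have c\<Phi>: "c \<in> \<Phi>" using c chamber_subset[OF P] by blast
  obtain x where x: "\<And>e. e \<in> span {d} \<Longrightarrow> e \<bullet> x = 0"
    "\<And>a. a \<in> \<Phi> \<Longrightarrow> a \<notin> span {d} \<Longrightarrow> a \<in> P \<longleftrightarrow> a \<bullet> x > 0"
    using face_point[OF R P, of "{d}"] d by (metis empty_subsetI insert_subset)
  have "c \<notin> span {d}" using chamber_parallel[OF R P d\<Phi>(1) c(1)] c(2) by blast
  then have "c \<bullet> x > 0" using x(2)[OF c\<Phi>] c(1) by blast
  moreover have "reflect d c \<bullet> x = c \<bullet> x"
    using x(1)[of d] by (simp add: reflect_def inner_diff_left span_base)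
  moreover have "reflect d c \<in> \<Phi>" unfolding reflect_def using root_system_reflect[OF R d\<Phi>(2) c\<Phi>] .
  ultimately show ?thesis using x by (metis less_irrefl)
qed

context finite_coxeter_reflection_group
begin

text \<open>Both unit normals of every reflecting hyperplane.\<close>

definition roots :: "'v set" where
  "roots = {a. norm a = 1 \<and> (\<exists>t\<in>coxeter_reflections W S. \<rho> t = reflect a)}"

lemma rho_mult: "u \<in> carrier W \<Longrightarrow> w \<in> carrier W \<Longrightarrow> \<rho> (u \<otimes> w) x = \<rho> u (\<rho> w x)"
  by (rule composition_rule) auto

lemma rho_one: "\<rho> \<one> x = x"
  using id_eq_one by (metis UNIV_I restrict_apply')

lemma rho_inv: "w \<in> carrier W \<Longrightarrow> \<rho> w (\<rho> (inv w) x) = x" "w \<in> carrier W \<Longrightarrow> \<rho> (inv w) (\<rho> w x) = x"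
  using rho_mult[of w "inv w"] rho_mult[of "inv w" w] by (auto simp: rho_one)

lemma rho_linear: "w \<in> carrier W \<Longrightarrow> linear (\<rho> w)"
  using orthogonal orthogonal_transformation_linear by blast

lemma rho_inner: "w \<in> carrier W \<Longrightarrow> \<rho> w x \<bullet> \<rho> w y = x \<bullet> y"
  using orthogonal by (simp add: orthogonal_transformation_def)

lemma rho_inner_inv: "w \<in> carrier W \<Longrightarrow> \<rho> w x \<bullet> y = x \<bullet> \<rho> (inv w) y"
  using rho_inner[of w x "\<rho> (inv w) y"] by (simp add: rho_inv)

lemma rho_uminus: "w \<in> carrier W \<Longrightarrow> \<rho> w (- x) = - \<rho> w x"
  using rho_linear by (rule linear_neg)

lemma rho_inj_eq: "u \<in> carrier W \<Longrightarrow> w \<in> carrier W \<Longrightarrow> \<rho> u = \<rho> w \<Longrightarrow> u = w"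
  using faithful by (auto simp: inj_on_def)

lemma rho_reflect:
  assumes "w \<in> carrier W" shows "\<rho> w (reflect a (\<rho> (inv w) x)) = reflect (\<rho> w a) x"
  using assms by (simp add: reflect_def linear_diff[OF rho_linear] linear_scale[OF rho_linear] rho_inv rho_inner_inv)

lemma S_in: "s \<in> S \<Longrightarrow> s \<in> carrier W"
  using S_carrier by blast

lemma S_sq: "s \<in> S \<Longrightarrow> s \<otimes> s = \<one>"
  using S_order_two by blast

lemma S_inv: "s \<in> S \<Longrightarrow> inv s = s"
  using S_sq S_in inv_equality by blast

lemma S_root: assumes "s \<in> S" shows "\<exists>a. norm a = 1 \<and> \<rho> s = reflect a"
proof -
  obtain a where a: "a \<noteq> 0" "\<forall>x. \<rho> s x = x - (2 * (a \<bullet> x) / (a \<bullet> a)) *\<^sub>R a"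
    using reflection[OF assms] by (auto simp: is_reflection_def)
  define c where "c = (1 / norm a) *\<^sub>R a"
  have "norm c = 1" using a(1) by (simp add: c_def)
  moreover have "\<rho> s = reflect c"
  proof
    fix x
    have "a \<bullet> a = norm a * norm a" by (simp add: dot_square_norm power2_eq_square)
    then show "\<rho> s x = reflect c x" using a by (simp add: reflect_def c_def)
  qed
  ultimately show ?thesis by blast
qed

lemma reflections_carrier: "t \<in> coxeter_reflections W S \<Longrightarrow> t \<in> carrier W"
  using S_in by (auto simp: coxeter_reflections_def)

lemma reflections_conj:
  assumes "t \<in> coxeter_reflections W S" "u \<in> carrier W"
  shows "u \<otimes> t \<otimes> inv u \<in> coxeter_reflections W S"
proof -
  obtain w s where t: "t = w \<otimes> s \<otimes> inv w" "w \<in> carrier W" "s \<in> S"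
    using assms(1) by (auto simp: coxeter_reflections_def)
  then have "u \<otimes> t \<otimes> inv u = (u \<otimes> w) \<otimes> s \<otimes> inv (u \<otimes> w)"
    using assms(2) S_in by (simp add: inv_mult_group m_assoc)
  then show ?thesis using t assms(2) unfolding coxeter_reflections_def by blast
qed

lemma rho_conj:
  assumes "t \<in> carrier W" "u \<in> carrier W" "\<rho> t = reflect a"
  shows "\<rho> (u \<otimes> t \<otimes> inv u) = reflect (\<rho> u a)"
  using assms rho_reflect by (auto simp: rho_mult)

lemma reflection_root:
  assumes "t \<in> coxeter_reflections W S" shows "\<exists>a. norm a = 1 \<and> \<rho> t = reflect a"
proof -
  obtain w s where t: "t = w \<otimes> s \<otimes> inv w" "w \<in> carrier W" "s \<in> S"
    using assms by (auto simp: coxeter_reflections_def)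
  obtain a where a: "norm a = 1" "\<rho> s = reflect a" using S_root[OF t(3)] by blast
  have "norm (\<rho> w a) = 1" using orthogonal[OF t(2)] a(1) by (simp add: orthogonal_transformation_norm)
  then show ?thesis using rho_conj[OF S_in[OF t(3)] t(2) a(2)] t(1) by blast
qed

lemma rho_roots: assumes "a \<in> roots" "w \<in> carrier W" shows "\<rho> w a \<in> roots"
proof -
  obtain t where t: "t \<in> coxeter_reflections W S" "\<rho> t = reflect a" and a: "norm a = 1"
    using assms(1) by (auto simp: roots_def)
  have "norm (\<rho> w a) = 1" using orthogonal[OF assms(2)] a by (simp add: orthogonal_transformation_norm)
  then show ?thesis unfolding roots_def
    using rho_conj[OF reflections_carrier[OF t(1)] assms(2) t(2)] reflections_conj[OF t(1) assms(2)] by blast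
qed

lemma rho_roots_iff: assumes "w \<in> carrier W" shows "\<rho> w a \<in> roots \<longleftrightarrow> a \<in> roots"
  using rho_roots[of a w] rho_roots[of "\<rho> w a" "inv w"] assms by (auto simp: rho_inv)

lemma root_system_roots: "root_system roots"
  unfolding root_system_def
proof (intro conjI ballI)
  have "finite (coxeter_reflections W S)"
    by (rule finite_subset[OF _ finite_W]) (auto dest: reflections_carrier)
  moreover have "finite {a. norm a = 1 \<and> \<rho> t = reflect a}" for t
  proof (cases "\<exists>a. norm a = 1 \<and> \<rho> t = reflect a")
    case True
    then obtain a where a: "norm a = 1" "\<rho> t = reflect a" by blast
    have "{a. norm a = 1 \<and> \<rho> t = reflect a} \<subseteq> {a, - a}"
    proof
      fix c assume c: "c \<in> {a. norm a = 1 \<and> \<rho> t = reflect a}"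
      then have "hyp a = hyp c" using hyp_eq_fixed[of a] hyp_eq_fixed[of c] a by simp
      then show "c \<in> {a, - a}" using unit_parallel[OF a(1), of c] c by simp
    qed
    then show ?thesis by (rule finite_subset) simp
  next
    case False
    then have "{a. norm a = 1 \<and> \<rho> t = reflect a} = {}" by blast
    then show ?thesis by (simp only: finite.emptyI)
  qed
  moreover have "roots = (\<Union>t\<in>coxeter_reflections W S. {a. norm a = 1 \<and> \<rho> t = reflect a})"
    unfolding roots_def by blast
  ultimately show "finite roots" by simp
next
  fix a assume "a \<in> roots" then show "norm a = 1" by (simp add: roots_def)
next
  fix a c assume ac: "a \<in> roots" "c \<in> roots"
  obtain t where t: "t \<in> coxeter_reflections W S" "\<rho> t = reflect a"
    using ac(1) by (auto simp: roots_def)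
  then have "\<rho> t c = c - (2 * (a \<bullet> c)) *\<^sub>R a" by (simp add: reflect_def)
  then show "c - (2 * (a \<bullet> c)) *\<^sub>R a \<in> roots"
    using rho_roots[OF ac(2) reflections_carrier[OF t(1)]] by simp
qed

lemma arrangement_eq: "reflection_arrangement W S \<rho> = hyp ` roots"
proof (intro equalityI subsetI)
  fix H assume "H \<in> reflection_arrangement W S \<rho>"
  then obtain t where t: "t \<in> coxeter_reflections W S" "H = {x. \<rho> t x = x}"
    by (auto simp: reflection_arrangement_def fixed_hyperplane_def)
  obtain a where a: "norm a = 1" "\<rho> t = reflect a" using reflection_root[OF t(1)] by blast
  then show "H \<in> hyp ` roots" using t hyp_eq_fixed[OF a(1)] by (auto simp: roots_def)
next
  fix H assume "H \<in> hyp ` roots"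
  then obtain a t where a: "norm a = 1" "H = hyp a" "t \<in> coxeter_reflections W S" "\<rho> t = reflect a"
    by (auto simp: roots_def)
  then have "H = fixed_hyperplane \<rho> t" using hyp_eq_fixed[OF a(1)] by (simp add: fixed_hyperplane_def)
  then show "H \<in> reflection_arrangement W S \<rho>" using a(3) by (auto simp: reflection_arrangement_def)
qed

definition base :: "'v set" where
  "base = (SOME P. chamber roots P \<and> B = region P)"

lemma base: "chamber roots base" "region base = B"
proof -
  have "\<exists>P. chamber roots P \<and> B = region P"
    using base_region unfolding arrangement_eq regions_root_system[OF root_system_roots] chambers_def by blast
  then have "chamber roots base \<and> B = region base" unfolding base_def by (rule someI_ex)
  then show "chamber roots base" "region base = B" by auto
qed

lemma mem_B: "x \<in> B \<longleftrightarrow> (\<forall>a\<in>base. 0 \<le> a \<bullet> x)"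
  using eqset_imp_iff[OF base(2), of x] by (simp add: region_def)

sublocale A: based_root_system roots base
  using root_system_roots base(1) by unfold_locales

lemma base_roots: "a \<in> base \<Longrightarrow> a \<in> roots"
  using chamber_subset base(1) by blast

text \<open>The simple root of the wall of \<open>B\<close> fixed by \<open>s\<close>; by
  \<open>\<alpha>_inj\<close> and \<open>\<alpha>_image\<close> this is a bijection from
  \<open>S\<close> to the simple roots.\<close>

definition \<alpha> :: "'g \<Rightarrow> 'v" where
  "\<alpha> s = (SOME a. a \<in> simples base \<and> \<rho> s = reflect a)"

lemma walls: "hyp ` simples base = fixed_hyperplane \<rho> ` S"
  using base_region_walls facet_hyperplanes_region[OF root_system_roots base(1)] base(2) by simp

lemma reflect_simple:
  assumes "s \<in> S" "a \<in> simples base" "hyp a = fixed_hyperplane \<rho> s" shows "\<rho> s = reflect a"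
proof -
  obtain c where c: "norm c = 1" "\<rho> s = reflect c" using S_root[OF assms(1)] by blast
  have "norm a = 1" using assms(2) simples_subset base_roots root_system_norm[OF root_system_roots] by blast
  moreover have "hyp a = hyp c" using assms(3) hyp_eq_fixed[OF c(1)] c(2) by (simp add: fixed_hyperplane_def)
  ultimately have "c = a \<or> c = - a" using unit_parallel[OF _ c(1)] by blast
  then show ?thesis using c(2) reflect_uminus by metis
qed

lemma \<alpha>: assumes "s \<in> S" shows "\<alpha> s \<in> simples base" "\<rho> s = reflect (\<alpha> s)"
proof -
  obtain a where a: "a \<in> simples base" "hyp a = fixed_hyperplane \<rho> s" using walls assms by (metis imageE imageI)
  then have "\<exists>a. a \<in> simples base \<and> \<rho> s = reflect a" using reflect_simple[OF assms] by blast
  then have "\<alpha> s \<in> simples base \<and> \<rho> s = reflect (\<alpha> s)" unfolding \<alpha>_def by (rule someI_ex)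
  then show "\<alpha> s \<in> simples base" "\<rho> s = reflect (\<alpha> s)" by auto
qed

lemma \<alpha>_base: "s \<in> S \<Longrightarrow> \<alpha> s \<in> base"
  using \<alpha>(1) simples_subset by blast

lemma \<alpha>_inj: "inj_on \<alpha> S"
  using \<alpha>(2) rho_inj_eq S_in by (intro inj_onI) metis

lemma \<alpha>_image: "\<alpha> ` S = simples base"
proof
  show "simples base \<subseteq> \<alpha> ` S"
  proof
    fix a assume a: "a \<in> simples base"
    then obtain s where s: "s \<in> S" "hyp a = fixed_hyperplane \<rho> s" using walls by (metis imageE imageI)
    have n: "norm c = 1" if "c \<in> simples base" for c
      using that simples_subset base_roots root_system_norm[OF root_system_roots] by blast
    have "hyp (\<alpha> s) = fixed_hyperplane \<rho> s"
      using hyp_eq_fixed[OF n[OF \<alpha>(1)[OF s(1)]]] \<alpha>(2)[OF s(1)] by (simp add: fixed_hyperplane_def)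
    then have "hyp a = hyp (\<alpha> s)" using s(2) by simp
    then have "a = \<alpha> s" using A.hyp_inj[of a "\<alpha> s"] a \<alpha>(1)[OF s(1)] simples_subset by blast
    then show "a \<in> \<alpha> ` S" using s(1) by blast
  qed
qed (use \<alpha>(1) in blast)

lemma rho_\<alpha>: "s \<in> S \<Longrightarrow> \<rho> s (\<alpha> s) = - \<alpha> s"
  using \<alpha>(2)[of s] root_system_inner_self[OF root_system_roots base_roots[OF \<alpha>_base]]
  by (simp add: reflect_def scaleR_2)

lemma rho_simple_positive: "s \<in> S \<Longrightarrow> c \<in> base \<Longrightarrow> c \<noteq> \<alpha> s \<Longrightarrow> \<rho> s c \<in> base"
  using reflect_positive[OF root_system_roots base(1) \<alpha>(1)] \<alpha>(2) by metis

lemma base_uminus_iff: "a \<in> roots \<Longrightarrow> - a \<in> base \<longleftrightarrow> a \<notin> base"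
  using chamber_uminus_iff[OF root_system_roots base(1)] .

section \<open>Words and chambers\<close>

lemma word_prod_Nil: "word_prod W [] = \<one>" and word_prod_Cons: "word_prod W (x # xs) = x \<otimes> word_prod W xs"
  by (auto simp: word_prod_def)

lemma word_prod_closed: "set xs \<subseteq> carrier W \<Longrightarrow> word_prod W xs \<in> carrier W"
  by (induction xs) (auto simp: word_prod_Nil word_prod_Cons)

lemma word_prod_append:
  "set xs \<subseteq> carrier W \<Longrightarrow> set ys \<subseteq> carrier W \<Longrightarrow> word_prod W (xs @ ys) = word_prod W xs \<otimes> word_prod W ys"
  by (induction xs) (auto simp: word_prod_Nil word_prod_Cons word_prod_closed m_assoc)

lemma lists_carrier: "xs \<in> lists S \<Longrightarrow> set xs \<subseteq> carrier W"
  using S_carrier by auto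

lemma generate_words:
  assumes J: "J \<subseteq> S" shows "generate W J = word_prod W ` lists J"
proof (intro equalityI subsetI)
  have Jc: "set xs \<subseteq> carrier W" if "xs \<in> lists J" for xs using that J S_carrier by auto
  fix w assume "w \<in> generate W J"
  then show "w \<in> word_prod W ` lists J"
  proof (induction rule: generate.induct)
    case one
    have "word_prod W [] \<in> word_prod W ` lists J" by (intro imageI) simp
    then show ?case by (simp add: word_prod_Nil)
  next
    case (incl h)
    have "word_prod W [h] \<in> word_prod W ` lists J" using incl by (intro imageI) simp
    moreover have "h \<in> carrier W" using incl J S_in by blast
    ultimately show ?case by (simp add: word_prod_Nil word_prod_Cons)
  next
    case (inv h)
    have "word_prod W [h] \<in> word_prod W ` lists J" using inv by (intro imageI) simp
    moreover have "h \<in> S" using inv J by blast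
    ultimately show ?case using S_inv S_in by (simp add: word_prod_Nil word_prod_Cons)
  next
    case (eng g h)
    then obtain xs ys where "xs \<in> lists J" "g = word_prod W xs" "ys \<in> lists J" "h = word_prod W ys" by blast
    then have "g \<otimes> h = word_prod W (xs @ ys)" "xs @ ys \<in> lists J" using word_prod_append Jc by auto
    then show ?case by blast
  qed
next
  fix w assume "w \<in> word_prod W ` lists J"
  then obtain xs where "xs \<in> lists J" "w = word_prod W xs" by blast
  then show "w \<in> generate W J"
    by (induction xs arbitrary: w) (auto simp: word_prod_Nil word_prod_Cons intro: generate.intros)
qed

text \<open>Reading the word from the right, some letter \<open>t\<close> makes the positive root
  \<open>\<rho> u (\<alpha> s)\<close> of the tail \<open>u\<close> negative. The only positive root
  that \<open>t\<close> makes negative is \<open>\<alpha> t\<close>, so \<open>t\<close> is the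
  conjugate of \<open>s\<close> by \<open>u\<close>, and \<open>t\<close> cancels against
  \<open>s\<close>.\<close>

lemma deletion:
  assumes "ys \<in> lists S" "s \<in> S" "\<rho> (word_prod W ys) (\<alpha> s) \<notin> base"
  shows "\<exists>zs\<in>lists S. length zs < length ys \<and> word_prod W zs = word_prod W ys \<otimes> s"
  using assms
proof (induction ys rule: list.induct)
  case Nil
  then show ?case using \<alpha>_base by (simp add: word_prod_Nil rho_one)
next
  case (Cons t ys)
  let ?u = "word_prod W ys"
  have t: "t \<in> S" "t \<in> carrier W" and s: "s \<in> S" "s \<in> carrier W" and ys: "ys \<in> lists S"
    using Cons.prems S_in by auto
  have u: "?u \<in> carrier W" using word_prod_closed[OF lists_carrier[OF ys]] .
  show ?case
  proof (cases "\<rho> ?u (\<alpha> s) \<in> base")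
    case False
    then obtain zs where zs: "zs \<in> lists S" "length zs < length ys" "word_prod W zs = ?u \<otimes> s"
      using Cons.IH ys s by blast
    then have "word_prod W (t # zs) = word_prod W (t # ys) \<otimes> s"
      using t s u by (simp add: word_prod_Cons m_assoc)
    then show ?thesis using zs t by (intro bexI[of _ "t # zs"]) auto
  next
    case True
    have "\<rho> t (\<rho> ?u (\<alpha> s)) \<notin> base" using Cons.prems(3) t u by (simp add: word_prod_Cons rho_mult)
    then have eq: "\<rho> ?u (\<alpha> s) = \<alpha> t" using rho_simple_positive[OF t(1) True] by blast
    have "\<rho> (?u \<otimes> s \<otimes> inv ?u) = \<rho> t"
      using rho_conj[OF s(2) u \<alpha>(2)[OF s(1)]] eq \<alpha>(2)[OF t(1)] by simp
    then have "?u \<otimes> s \<otimes> inv ?u = t" using u s t by (intro rho_inj_eq) auto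
    then have "t \<otimes> ?u = ?u \<otimes> s" using u s by (metis inv_solve_right' m_closed inv_closed)
    moreover have "word_prod W (t # ys) \<otimes> s = t \<otimes> (?u \<otimes> s)" using t u s by (simp add: word_prod_Cons m_assoc)
    ultimately have "word_prod W (t # ys) \<otimes> s = t \<otimes> (t \<otimes> ?u)" by simp
    also have "\<dots> = ?u" using t u S_sq[OF t(1)] by (simp add: m_assoc[symmetric])
    finally show ?thesis using ys by (intro bexI[of _ ys]) auto
  qed
qed

lemma length_exists:
  assumes "w \<in> carrier W"
  obtains xs where "xs \<in> lists S" "length xs = coxeter_length W S w" "word_prod W xs = w"
proof -
  have "w \<in> word_prod W ` lists S" using assms generate_words[of S] S_generates by simp
  then have "\<exists>n. \<exists>xs\<in>lists S. length xs = n \<and> word_prod W xs = w" by blast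
  then have "\<exists>xs\<in>lists S. length xs = coxeter_length W S w \<and> word_prod W xs = w"
    unfolding coxeter_length_def by (rule LeastI_ex)
  then show ?thesis using that by blast
qed

lemma length_le: "xs \<in> lists S \<Longrightarrow> coxeter_length W S (word_prod W xs) \<le> length xs"
  unfolding coxeter_length_def by (rule Least_le) blast

text \<open>Otherwise let \<open>s\<close> be the last letter of a shortest word for
  \<open>w\<close> and \<open>u\<close> the product of the preceding letters. Positivity of
  \<open>\<rho> w (\<alpha> s)\<close> makes \<open>\<rho> u (\<alpha> s)\<close> negative, and
  \<open>deletion\<close> gives a shorter word.\<close>

lemma base_fixed_imp_one:
  assumes w: "w \<in> carrier W" and pos: "\<And>s. s \<in> S \<Longrightarrow> \<rho> w (\<alpha> s) \<in> base"
  shows "w = \<one>"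
proof -
  obtain xs where xs: "xs \<in> lists S" "length xs = coxeter_length W S w" "word_prod W xs = w"
    using length_exists[OF w] by blast
  show ?thesis
  proof (cases xs rule: rev_cases)
    case Nil then show ?thesis using xs by (simp add: word_prod_Nil)
  next
    case (snoc ys s)
    then have s: "s \<in> S" "s \<in> carrier W" and ys: "ys \<in> lists S" using xs S_in by auto
    let ?u = "word_prod W ys"
    have u: "?u \<in> carrier W" using word_prod_closed[OF lists_carrier[OF ys]] .
    have wu: "w = ?u \<otimes> s"
      using xs(3) snoc word_prod_append[OF lists_carrier[OF ys], of "[s]"] s by (simp add: word_prod_Cons word_prod_Nil)
    have "\<rho> w (\<alpha> s) = - \<rho> ?u (\<alpha> s)" unfolding wu using u s by (simp add: rho_mult rho_\<alpha> rho_uminus)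
    then have "- \<rho> ?u (\<alpha> s) \<in> base" using pos[OF s(1)] by simp
    then have "\<rho> ?u (\<alpha> s) \<notin> base" using A.P_uminus[of "\<rho> ?u (\<alpha> s)"] by blast
    then obtain zs where "zs \<in> lists S" "length zs < length ys" "word_prod W zs = ?u \<otimes> s"
      using deletion[OF ys s(1)] by blast
    then have "coxeter_length W S w < length ys" using length_le[of zs] wu by simp
    then show ?thesis using xs(2) snoc by simp
  qed
qed

lemma longer_of_positive:
  assumes w: "w \<in> carrier W" and s: "s \<in> S" and pos: "\<rho> w (\<alpha> s) \<in> base"
  shows "coxeter_length W S w < coxeter_length W S (w \<otimes> s)"
proof -
  have sc: "s \<in> carrier W" using S_in s by blast
  obtain xs where xs: "xs \<in> lists S" "length xs = coxeter_length W S (w \<otimes> s)" "word_prod W xs = w \<otimes> s"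
    using length_exists[of "w \<otimes> s"] w sc by blast
  have "\<rho> (w \<otimes> s) (\<alpha> s) = - \<rho> w (\<alpha> s)" using w sc s by (simp add: rho_mult rho_\<alpha> rho_uminus)
  then have "\<rho> (word_prod W xs) (\<alpha> s) \<notin> base" using xs(3) A.P_uminus[OF pos] by simp
  then obtain zs where zs: "zs \<in> lists S" "length zs < length xs" "word_prod W zs = word_prod W xs \<otimes> s"
    using deletion[OF xs(1) s] by blast
  have "word_prod W xs \<otimes> s = w" using xs(3) w sc S_sq[OF s] by (simp add: m_assoc)
  then show ?thesis using length_le[OF zs(1)] zs xs(2) by simp
qed

text \<open>The positive system of the region of \<open>w\<close>, see
  \<open>region_chamber_of\<close>.\<close>

definition chamber_of :: "'g \<Rightarrow> 'v set" where "chamber_of w = \<rho> w ` base"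

lemma mem_chamber_of: assumes "w \<in> carrier W" shows "a \<in> chamber_of w \<longleftrightarrow> \<rho> (inv w) a \<in> base"
  unfolding chamber_of_def using rho_inv[OF assms] by (metis image_iff)

lemma image_chamber:
  assumes w: "w \<in> carrier W" and \<Psi>: "\<And>a. \<rho> w a \<in> \<Psi> \<longleftrightarrow> a \<in> \<Psi>" and C: "chamber \<Psi> C"
  shows "chamber \<Psi> (\<rho> w ` C)"
proof -
  obtain z where z: "\<forall>a\<in>\<Psi>. a \<bullet> z \<noteq> 0" "C = {a \<in> \<Psi>. a \<bullet> z > 0}" using C by (auto simp: chamber_def)
  have "a \<bullet> \<rho> w z = \<rho> (inv w) a \<bullet> z" for a using rho_inner_inv[OF w, of z a] by (simp add: inner_commute)
  moreover have "\<rho> (inv w) a \<in> \<Psi> \<longleftrightarrow> a \<in> \<Psi>" for a using \<Psi>[of "\<rho> (inv w) a"] rho_inv[OF w] by simp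
  moreover have "a \<in> \<rho> w ` C \<longleftrightarrow> \<rho> (inv w) a \<in> C" for a using rho_inv[OF w] by (metis image_iff)
  ultimately have "\<rho> w ` C = {a \<in> \<Psi>. a \<bullet> \<rho> w z > 0}" "\<forall>a\<in>\<Psi>. a \<bullet> \<rho> w z \<noteq> 0" using z by auto
  then show ?thesis unfolding chamber_def by blast
qed

lemma chamber_chamber_of: "w \<in> carrier W \<Longrightarrow> chamber roots (chamber_of w)"
  unfolding chamber_of_def using image_chamber[OF _ rho_roots_iff base(1)] by blast

lemma chamber_of_one: "chamber_of \<one> = base"
  unfolding chamber_of_def by (simp add: rho_one)

lemma chamber_of_mult: "u \<in> carrier W \<Longrightarrow> w \<in> carrier W \<Longrightarrow> chamber_of (u \<otimes> w) = \<rho> u ` chamber_of w"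
  unfolding chamber_of_def image_image by (simp add: rho_mult)

lemma chamber_of_inj: assumes "u \<in> carrier W" "w \<in> carrier W" "chamber_of u = chamber_of w" shows "u = w"
proof -
  have "chamber_of (inv u \<otimes> w) = chamber_of (inv u \<otimes> u)"
    using assms by (simp only: chamber_of_mult inv_closed)
  then have eq: "chamber_of (inv u \<otimes> w) = base" using assms by (simp add: chamber_of_one)
  have "inv u \<otimes> w = \<one>"
  proof (rule base_fixed_imp_one)
    fix s assume "s \<in> S"
    then show "\<rho> (inv u \<otimes> w) (\<alpha> s) \<in> base" using eq \<alpha>_base unfolding chamber_of_def by blast
  qed (use assms in simp)
  then show ?thesis using assms by (metis inv_closed inv_equality inv_inv)
qed

lemma region_chamber_of: assumes "w \<in> carrier W" shows "region (chamber_of w) = \<rho> w ` B"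
proof (intro equalityI subsetI)
  fix x assume "x \<in> region (chamber_of w)"
  then have "\<rho> (inv w) x \<in> B" unfolding mem_B region_def chamber_of_def by (auto simp: rho_inner_inv[OF assms])
  then show "x \<in> \<rho> w ` B" using rho_inv[OF assms] by (metis image_eqI)
next
  fix x assume "x \<in> \<rho> w ` B"
  then show "x \<in> region (chamber_of w)"
    unfolding region_def chamber_of_def by (auto simp: rho_inner[OF assms] mem_B)
qed

section \<open>Parabolic subgroups and parabolic subsystems\<close>

lemma parabolic_carrier: "J \<subseteq> S \<Longrightarrow> w \<in> generate W J \<Longrightarrow> w \<in> carrier W"
  using generate_in_carrier S_carrier by blast

lemma rho_span:
  assumes J: "J \<subseteq> S" and s: "s \<in> J" shows "\<rho> s x \<in> span (\<alpha> ` J) \<longleftrightarrow> x \<in> span (\<alpha> ` J)"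
proof -
  have sS: "s \<in> S" using J s by blast
  have \<alpha>s: "t *\<^sub>R \<alpha> s \<in> span (\<alpha> ` J)" for t using s by (intro span_scale span_base) blast
  have *: "\<rho> s x \<in> span (\<alpha> ` J)" if "x \<in> span (\<alpha> ` J)" for x
    using \<alpha>(2)[OF sS] that \<alpha>s by (simp add: reflect_def span_diff)
  have "\<rho> s (\<rho> s x) = x" using rho_inv(1)[OF S_in[OF sS]] S_inv[OF sS] by simp
  then show ?thesis using * by metis
qed

text \<open>A simple reflection from \<open>J\<close> keeps all positive roots but its own positive,
  and it preserves the span of the simple roots of \<open>J\<close>. This is applied letter by
  letter to a word for the inverse of \<open>w\<close>.\<close>

lemma parabolic_outside:
  assumes J: "J \<subseteq> S" and w: "w \<in> generate W J"
  shows "chamber_of w - span (\<alpha> ` J) = base - span (\<alpha> ` J)"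
proof -
  let ?X = "span (\<alpha> ` J)"
  have step: "\<rho> s ` (base - ?X) \<subseteq> base - ?X" if "s \<in> J" for s
  proof clarify
    fix a assume a: "a \<in> base" "a \<notin> ?X"
    have "a \<noteq> \<alpha> s" using a that by (auto intro: span_base)
    then show "\<rho> s a \<in> base - ?X" using rho_simple_positive[of s a] a that J rho_span[OF J that] by blast
  qed
  obtain xs where xs: "xs \<in> lists J" "w = word_prod W xs" using w generate_words[OF J] by blast
  have sub: "\<rho> (word_prod W xs) ` (base - ?X) \<subseteq> base - ?X" if "xs \<in> lists J" for xs
    using that
  proof (induction xs)
    case Nil show ?case by (simp add: word_prod_Nil rho_one)
  next
    case (Cons s xs)
    then have "s \<in> carrier W" "set xs \<subseteq> carrier W" using J S_carrier by auto
    then have "\<rho> (word_prod W (s # xs)) ` (base - ?X) = \<rho> s ` (\<rho> (word_prod W xs) ` (base - ?X))"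
      by (simp add: word_prod_Cons rho_mult word_prod_closed image_image)
    then show ?case using Cons step[of s] by auto
  qed
  have wc: "w \<in> carrier W" using parabolic_carrier[OF J w] .
  have "inv w \<in> generate W J" using generate_m_inv_closed[of J w] J S_carrier w by blast
  then obtain ys where ys: "ys \<in> lists J" "inv w = word_prod W ys" using generate_words[OF J] by blast
  show ?thesis
  proof (intro equalityI subsetI)
    fix a assume a: "a \<in> base - ?X"
    then have "\<rho> (inv w) a \<in> base" using sub[OF ys(1)] ys(2) by auto
    then show "a \<in> chamber_of w - ?X" using mem_chamber_of[OF wc] a by blast
  next
    fix a assume a: "a \<in> chamber_of w - ?X"
    then have ar: "a \<in> roots" using chamber_subset[OF chamber_chamber_of[OF wc]] by blast
    show "a \<in> base - ?X"
    proof (rule ccontr)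
      assume "a \<notin> base - ?X"
      then have "- a \<in> base - ?X" using a base_uminus_iff[OF ar] span_neg[of "- a" "\<alpha> ` J"] by auto
      then have "\<rho> (inv w) (- a) \<in> base" using sub[OF ys(1)] ys(2) by auto
      then have "- a \<in> chamber_of w" using mem_chamber_of[OF wc] by blast
      then show False using a chamber_uminus_iff[OF root_system_roots chamber_chamber_of[OF wc] ar] by blast
    qed
  qed
qed

text \<open>If a simple root of \<open>J\<close> is negative for \<open>E\<close>, applying its
  reflection removes this inversion and maps the remaining ones injectively into the old ones.
  Induction on the number of inversions ends at the chamber of the identity.\<close>

lemma parabolic_surj:
  assumes J: "J \<subseteq> S" and E: "chamber (roots \<inter> span (\<alpha> ` J)) E"
  shows "\<exists>w\<in>generate W J. chamber_of w \<inter> span (\<alpha> ` J) = E"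
  using E
proof (induction "card (base \<inter> span (\<alpha> ` J) - E)" arbitrary: E rule: less_induct)
  case less
  let ?X = "span (\<alpha> ` J)"
  let ?\<Psi> = "roots \<inter> ?X"
  let ?Q = "base \<inter> ?X"
  note RX = root_system_span[OF root_system_roots, of "\<alpha> ` J"] and QX = chamber_span[OF base(1), of "\<alpha> ` J"]
  have sQ: "simples ?Q = \<alpha> ` J"
    using \<alpha>(1) J by (intro simples_span[OF root_system_roots base(1)]) blast
  show ?case
  proof (cases "\<alpha> ` J \<subseteq> E")
    case True
    then have "?Q = E" using chamber_eq_of_simples[OF RX QX less.prems] sQ by simp
    then show ?thesis using generate.one chamber_of_one by metis
  next
    case False
    then obtain s where s: "s \<in> J" "\<alpha> s \<notin> E" by blast
    have sS: "s \<in> S" "s \<in> carrier W" using s J S_in by blast+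
    have inv: "\<rho> s (\<rho> s x) = x" for x using rho_inv(1)[OF sS(2)] S_inv[OF sS(1)] by simp
    have \<Psi>: "\<rho> s a \<in> ?\<Psi> \<longleftrightarrow> a \<in> ?\<Psi>" for a using rho_roots_iff[OF sS(2)] rho_span[OF J s(1)] by blast
    define E' where "E' = \<rho> s ` E"
    have E': "chamber ?\<Psi> E'" unfolding E'_def by (rule image_chamber[OF sS(2) \<Psi> less.prems])
    have mE': "a \<in> E' \<longleftrightarrow> \<rho> s a \<in> E" for a unfolding E'_def using inv by (metis image_iff)
    have \<alpha>Q: "\<alpha> s \<in> ?Q" using s \<alpha>_base[OF sS(1)] by (auto intro: span_base)
    have \<alpha>\<Psi>: "\<alpha> s \<in> ?\<Psi>" using \<alpha>Q base_roots by blast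
    have "- \<alpha> s \<in> E" using chamber_uminus_iff[OF RX less.prems \<alpha>\<Psi>] s(2) by blast
    then have \<alpha>E': "\<alpha> s \<in> E'" using mE' rho_\<alpha>[OF sS(1)] by simp
    have "\<rho> s ` (?Q - E') \<subseteq> ?Q - E - {\<alpha> s}"
    proof clarify
      fix q assume q: "q \<in> base" "q \<in> ?X" "q \<notin> E'"
      have "q \<noteq> \<alpha> s" using q \<alpha>E' by blast
      then have "\<rho> s q \<in> base" "\<rho> s q \<in> ?X" "\<rho> s q \<notin> E"
        using rho_simple_positive[OF sS(1) q(1)] rho_span[OF J s(1)] q mE' by blast+
      moreover have "\<rho> s q \<noteq> \<alpha> s"
      proof
        assume "\<rho> s q = \<alpha> s"
        then have "q = - \<alpha> s" using inv[of q] rho_\<alpha>[OF sS(1)] by simp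
        then show False using q(1) A.P_uminus[OF \<alpha>_base[OF sS(1)]] by blast
      qed
      ultimately show "\<rho> s q \<in> ?Q - E - {\<alpha> s}" by blast
    qed
    moreover have fQ: "finite ?Q" using A.fin by blast
    moreover have "inj_on (\<rho> s) (?Q - E')" using inv by (metis inj_onI)
    ultimately have "card (?Q - E') \<le> card (?Q - E - {\<alpha> s})" by (intro card_inj_on_le[of "\<rho> s"]) auto
    also have "\<dots> < card (?Q - E)" using fQ \<alpha>Q s(2) by (intro card_Diff1_less) auto
    finally obtain w where w: "w \<in> generate W J" "chamber_of w \<inter> ?X = E'" using less.hyps[OF _ E'] by blast
    have "chamber_of (s \<otimes> w) \<inter> ?X = \<rho> s ` (chamber_of w \<inter> ?X)"
      unfolding chamber_of_mult[OF sS(2) parabolic_carrier[OF J w(1)]] using rho_span[OF J s(1)] by blast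
    also have "\<dots> = E" using w(2) inv by (simp add: E'_def image_image)
    finally show ?thesis using w(1) s(1) by (intro bexI[of _ "s \<otimes> w"]) (auto intro: generate.intros)
  qed
qed

text \<open>All elements of the parabolic subgroup have the same chamber outside the flat, so the
  part inside determines them. With \<open>J = S\<close> this is the simple transitivity of
  \<open>W\<close> on chambers.\<close>

lemma parabolic_chambers:
  assumes J: "J \<subseteq> S"
  shows "bij_betw (\<lambda>w. chamber_of w \<inter> span (\<alpha> ` J)) (generate W J) (chambers (roots \<inter> span (\<alpha> ` J)))"
  unfolding bij_betw_def
proof
  show "inj_on (\<lambda>w. chamber_of w \<inter> span (\<alpha> ` J)) (generate W J)"
  proof (rule inj_onI)
    fix u w assume uw: "u \<in> generate W J" "w \<in> generate W J"
      "chamber_of u \<inter> span (\<alpha> ` J) = chamber_of w \<inter> span (\<alpha> ` J)"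
    then have "chamber_of u = chamber_of w"
      using parabolic_outside[OF J uw(1)] parabolic_outside[OF J uw(2)] by blast
    then show "u = w" using chamber_of_inj parabolic_carrier[OF J] uw by blast
  qed
  show "(\<lambda>w. chamber_of w \<inter> span (\<alpha> ` J)) ` generate W J = chambers (roots \<inter> span (\<alpha> ` J))"
  proof
    show "(\<lambda>w. chamber_of w \<inter> span (\<alpha> ` J)) ` generate W J \<subseteq> chambers (roots \<inter> span (\<alpha> ` J))"
      using chamber_span[OF chamber_chamber_of[OF parabolic_carrier[OF J]]] by (auto simp: chambers_def)
    show "chambers (roots \<inter> span (\<alpha> ` J)) \<subseteq> (\<lambda>w. chamber_of w \<inter> span (\<alpha> ` J)) ` generate W J"
      using parabolic_surj[OF J] by (force simp: chambers_def)
  qed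
qed

lemma card_parabolic: "J \<subseteq> S \<Longrightarrow> card (generate W J) = card (chambers (roots \<inter> span (\<alpha> ` J)))"
  using parabolic_chambers by (rule bij_betw_same_card)

lemma span_\<alpha>: "span (\<alpha> ` S) = span roots"
  unfolding \<alpha>_image by (rule span_simples[OF root_system_roots base(1)])

lemma chamber_of_bij: "bij_betw chamber_of (carrier W) (chambers roots)"
proof -
  have "roots \<inter> span (\<alpha> ` S) = roots" unfolding span_\<alpha> using span_superset by blast
  moreover have "chamber_of w \<inter> span (\<alpha> ` S) = chamber_of w" if "w \<in> carrier W" for w
    unfolding span_\<alpha> using chamber_subset[OF chamber_chamber_of[OF that]] span_superset by blast
  ultimately show ?thesis using parabolic_chambers[of S] S_generates
    bij_betw_cong[of "carrier W" "\<lambda>w. chamber_of w \<inter> span (\<alpha> ` S)" chamber_of "chambers roots"] by simp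
qed

text \<open>If all inversions lie in the flat, \<open>parabolic_surj\<close> yields an element of
  the subgroup with the same chamber inside the flat, and outside it both chambers agree with
  \<open>base\<close>.\<close>

lemma parabolic_iff:
  assumes J: "J \<subseteq> S" and w: "w \<in> carrier W"
  shows "w \<in> generate W J \<longleftrightarrow> base - chamber_of w \<subseteq> span (\<alpha> ` J)"
proof
  assume "w \<in> generate W J" then show "base - chamber_of w \<subseteq> span (\<alpha> ` J)"
    using parabolic_outside[OF J] by blast
next
  let ?X = "span (\<alpha> ` J)"
  assume N: "base - chamber_of w \<subseteq> ?X"
  note cw = chamber_chamber_of[OF w]
  obtain u where u: "u \<in> generate W J" "chamber_of u \<inter> ?X = chamber_of w \<inter> ?X"
    using parabolic_surj[OF J chamber_span[OF cw]] by blast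
  have uc: "u \<in> carrier W" using parabolic_carrier[OF J u(1)] .
  have "chamber_of u \<subseteq> chamber_of w" using u N parabolic_outside[OF J u(1)] by blast
  then have "chamber_of u = chamber_of w"
    by (rule chamber_eqI[OF root_system_roots chamber_chamber_of[OF uc] cw])
  then have "u = w" using chamber_of_inj uc w by blast
  then show "w \<in> generate W J" using u by simp
qed

text \<open>\<open>K w\<close> is the support of \<open>w\<close>, the least set of generators whose
  parabolic subgroup contains \<open>w\<close>: those whose simple roots occur in some root of
  \<open>base - chamber_of w\<close>. The dual point \<open>x s\<close> reads off the coefficient at
  \<open>\<alpha> s\<close>.\<close>

lemma support_exists:
  obtains K where "\<And>w. K w \<subseteq> S" "\<And>J w. J \<subseteq> S \<Longrightarrow> w \<in> carrier W \<Longrightarrow> w \<in> generate W J \<longleftrightarrow> K w \<subseteq> J"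
proof -
  note ind = simples_basis(1)[OF root_system_roots base(1)]
  have finS: "finite S" by (rule finite_subset[OF S_carrier finite_W])
  have "\<forall>s. \<exists>x. \<forall>d\<in>simples base. d \<bullet> x = (if d = \<alpha> s then 1 else 0)"
    by (intro allI independent_dual_point[OF ind])
  then obtain x where x: "\<And>s d. d \<in> simples base \<Longrightarrow> d \<bullet> x s = (if d = \<alpha> s then 1 else 0)" by metis
  have x': "\<alpha> t \<bullet> x s = (if t = s then 1 else 0)" if "s \<in> S" "t \<in> S" for s t
    using x[OF \<alpha>(1)[OF that(2)], of s] \<alpha>_inj that by (auto simp: inj_on_def)
  have span_iff: "p \<in> span (\<alpha> ` J) \<longleftrightarrow> (\<forall>s\<in>S - J. p \<bullet> x s = 0)" if J: "J \<subseteq> S" and p: "p \<in> base" for p J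
  proof
    assume "p \<in> span (\<alpha> ` J)"
    then show "\<forall>s\<in>S - J. p \<bullet> x s = 0"
      using x' J by (intro ballI span_inner_zero[of p]) auto
  next
    assume z: "\<forall>s\<in>S - J. p \<bullet> x s = 0"
    obtain f where f: "p = (\<Sum>d\<in>simples base. f d *\<^sub>R d)"
      using subsetD[OF simples_basis(2)[OF root_system_roots base(1)] p] unfolding nncone_def by blast
    have f': "p = (\<Sum>t\<in>S. f (\<alpha> t) *\<^sub>R \<alpha> t)"
      unfolding f \<alpha>_image[symmetric] using \<alpha>_inj by (simp add: sum.reindex)
    have "p \<bullet> x s = f (\<alpha> s)" if "s \<in> S" for s
    proof -
      have "p \<bullet> x s = (\<Sum>t\<in>S. f (\<alpha> t) * (if t = s then 1 else 0))"
        unfolding f' inner_sum_left using x'[OF that] by (intro sum.cong) auto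
      then show ?thesis using finS that by (simp add: if_distrib cong: if_cong)
    qed
    then have fz: "f (\<alpha> s) = 0" if "s \<in> S - J" for s using z that by auto
    have "f (\<alpha> t) *\<^sub>R \<alpha> t \<in> span (\<alpha> ` J)" if "t \<in> S" for t
      using fz[of t] that by (cases "t \<in> J") (auto simp: span_zero intro: span_scale span_base)
    then show "p \<in> span (\<alpha> ` J)" unfolding f' by (rule span_sum)
  qed
  define K where "K w = {s \<in> S. \<exists>p\<in>base - chamber_of w. p \<bullet> x s \<noteq> 0}" for w
  have "w \<in> generate W J \<longleftrightarrow> K w \<subseteq> J" if J: "J \<subseteq> S" and w: "w \<in> carrier W" for J w
    unfolding parabolic_iff[OF J w] using span_iff[OF J] by (auto simp: K_def)
  moreover have "K w \<subseteq> S" for w by (auto simp: K_def)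
  ultimately show ?thesis using that by blast
qed

text \<open>Sorting by support makes the order of a parabolic subgroup a sum over the subsets of
  \<open>J\<close>. Moebius inversion in the Boolean lattice then counts the elements of full
  support, which are those in no proper parabolic subgroup.\<close>

lemma alternating_parabolic_sum:
  "(\<Sum>J\<in>Pow S. (-1) ^ card J * int (card (generate W J)))
   = (-1) ^ card S * int (card (carrier W - (\<Union>J\<in>{J. J \<subset> S}. generate W J)))"
proof -
  have finS: "finite S" by (rule finite_subset[OF S_carrier finite_W])
  obtain K where K: "\<And>w. K w \<subseteq> S" "\<And>J w. J \<subseteq> S \<Longrightarrow> w \<in> carrier W \<Longrightarrow> w \<in> generate W J \<longleftrightarrow> K w \<subseteq> J"
    using support_exists by blast
  define f where "f T = int (card {w \<in> carrier W. K w = T})" for T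
  define g where "g T = sum f (Pow T)" for T
  have g: "g J = int (card (generate W J))" if J: "J \<subseteq> S" for J
  proof -
    have fJ: "finite J" using J finS finite_subset by blast
    have "generate W J = (\<Union>T\<in>Pow J. {w \<in> carrier W. K w = T})"
      using K(2)[OF J] parabolic_carrier[OF J] by auto
    moreover have "card (\<Union>T\<in>Pow J. {w \<in> carrier W. K w = T}) = (\<Sum>T\<in>Pow J. card {w \<in> carrier W. K w = T})"
      using fJ finite_W by (intro card_UN_disjoint) auto
    ultimately show ?thesis by (simp add: g_def f_def)
  qed
  have "f S = (\<Sum>T\<in>Pow S. (-1) ^ (card S - card T) * g T)"
    using finS by (intro inclusion_exclusion_mobius) (auto simp: g_def)
  also have "\<dots> = (\<Sum>T\<in>Pow S. (-1) ^ card S * ((-1) ^ card T * g T))"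
  proof (intro sum.cong refl)
    fix T assume "T \<in> Pow S"
    then have "card T \<le> card S" using finS by (auto intro: card_mono)
    then show "(-1) ^ (card S - card T) * g T = (-1) ^ card S * ((-1) ^ card T * g T)"
      by (simp add: neg_one_power_add_eq_neg_one_power_diff[symmetric] power_add)
  qed
  finally have "f S = (-1) ^ card S * (\<Sum>T\<in>Pow S. (-1) ^ card T * g T)" by (simp add: sum_distrib_left)
  moreover have "(-1) ^ card S * (-1) ^ card S = (1::int)" by (simp flip: power_add)
  ultimately have "(-1) ^ card S * f S = (\<Sum>T\<in>Pow S. (-1) ^ card T * g T)"
    by (simp only: mult.assoc[symmetric] mult_1)
  moreover have "{w \<in> carrier W. K w = S} = carrier W - (\<Union>J\<in>{J. J \<subset> S}. generate W J)"
  proof (intro equalityI subsetI)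
    fix w assume w: "w \<in> {w \<in> carrier W. K w = S}"
    have "w \<notin> generate W J" if "J \<subset> S" for J using K(2)[of J w] that w by auto
    then show "w \<in> carrier W - (\<Union>J\<in>{J. J \<subset> S}. generate W J)" using w by blast
  next
    fix w assume w: "w \<in> carrier W - (\<Union>J\<in>{J. J \<subset> S}. generate W J)"
    have "w \<in> generate W (K w)" using K(2)[OF K(1)] w by blast
    then have "\<not> K w \<subset> S" using w by blast
    then show "w \<in> {w \<in> carrier W. K w = S}" using K(1)[of w] w by blast
  qed
  ultimately show ?thesis using g by (simp add: f_def)
qed

section \<open>The Moebius number\<close>

text \<open>No product of the longest element with a generator is longer, so by
  \<open>longer_of_positive\<close> it makes every simple root negative. A chamber is determined by
  its simple roots.\<close>

lemma longest:
  "longest_element W S \<in> carrier W" "chamber_of (longest_element W S) = uminus ` base"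
proof -
  let ?l = "coxeter_length W S" and ?w = "longest_element W S"
  \<comment> \<open>\<open>arg_max_nat_lemma\<close> asks for a strict bound, hence the successor of
    the maximum.\<close>
  have "\<forall>y. y \<in> carrier W \<longrightarrow> ?l y < Suc (Max (?l ` carrier W))"
    using finite_W by (auto intro!: le_imp_less_Suc)
  then have m: "?w \<in> carrier W \<and> (\<forall>y. y \<in> carrier W \<longrightarrow> ?l y \<le> ?l ?w)"
    unfolding longest_element_def arg_max_on_def by (intro arg_max_nat_lemma[of _ "\<one>"]) auto
  then show w: "?w \<in> carrier W" by blast
  have neg: "\<rho> ?w (\<alpha> s) \<notin> base" if "s \<in> S" for s
    using longer_of_positive[OF w that] m w S_in[OF that] by (meson leD m_closed)
  let ?C = "\<rho> (inv ?w) ` uminus ` base"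
  have "chamber roots ?C"
    using image_chamber[of "inv ?w" roots] rho_roots_iff[of "inv ?w"] w chamber_uminus[OF root_system_roots base(1)] by blast
  moreover have "simples base \<subseteq> ?C"
  proof
    fix a assume "a \<in> simples base"
    then obtain s where s: "s \<in> S" "a = \<alpha> s" using \<alpha>_image by blast
    have "\<rho> ?w (\<alpha> s) \<in> roots" using rho_roots[OF base_roots[OF \<alpha>_base[OF s(1)]] w] .
    then have "- \<rho> ?w (\<alpha> s) \<in> base" using base_uminus_iff neg[OF s(1)] by blast
    then have "\<rho> ?w (\<alpha> s) \<in> uminus ` base" by (simp add: uminus_mem_image_iff)
    then have "\<rho> (inv ?w) (\<rho> ?w (\<alpha> s)) \<in> ?C" by blast
    then show "a \<in> ?C" using rho_inv(2)[OF w] s(2) by simp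
  qed
  ultimately have "base = ?C" using chamber_eq_of_simples[OF root_system_roots base(1)] by blast
  then have "chamber_of ?w = \<rho> ?w ` ?C" unfolding chamber_of_def by simp
  also have "\<dots> = uminus ` base" unfolding image_image[of "\<rho> ?w"] using rho_inv(1)[OF w] by simp
  finally show "chamber_of ?w = uminus ` base" .
qed

text \<open>Every simple root of \<open>base\<close> is a lower wall of the opposite chamber, so the
  sum runs over all subsets of \<open>S\<close>.\<close>

lemma face_sum_longest:
  "face_sum roots base (uminus ` base) = (\<Sum>J\<in>Pow S. (-1) ^ card J * int (card (generate W J)))"
proof -
  have "lower base (uminus ` base) = simples base"
    unfolding lower_def simples_uminus using simples_subset by (auto simp: uminus_eq_image_iff)
  then have "face_sum roots base (uminus ` base) =
    (\<Sum>I\<in>Pow (\<alpha> ` S). (-1) ^ card I * int (card (chambers (roots \<inter> span I))))"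
    by (simp add: face_sum_def \<alpha>_image)
  also have "\<dots> = (\<Sum>J\<in>Pow S. (-1) ^ card (\<alpha> ` J) * int (card (chambers (roots \<inter> span (\<alpha> ` J)))))"
    using bij_betw_Pow[of \<alpha> S "\<alpha> ` S"] \<alpha>_inj
    by (intro sum.reindex_bij_betw[symmetric]) (simp add: bij_betw_def)
  also have "\<dots> = (\<Sum>J\<in>Pow S. (-1) ^ card J * int (card (generate W J)))"
  proof (intro sum.cong refl)
    fix J assume "J \<in> Pow S"
    then have "card (\<alpha> ` J) = card J" using \<alpha>_inj by (intro card_image) (auto intro: inj_on_subset)
    then show "(-1) ^ card (\<alpha> ` J) * int (card (chambers (roots \<inter> span (\<alpha> ` J)))) =
      (-1) ^ card J * int (card (generate W J))" using card_parabolic \<open>J \<in> Pow S\<close> by simp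
  qed
  finally show ?thesis .
qed

lemma shard_order_iff:
  "(u, w) \<in> shard_order W S \<rho> B \<longleftrightarrow>
     u \<in> carrier W \<and> w \<in> carrier W \<and> shard_le base (chamber_of u) (chamber_of w)"
proof -
  have "shard_intersection W S \<rho> B w = \<Inter>(shard_of base (chamber_of w) ` lower base (chamber_of w))"
    if "w \<in> carrier W" for w
    using A.lower_shards_region[OF chamber_chamber_of[OF that]]
    by (simp add: shard_intersection_def arrangement_eq region_chamber_of[OF that] base(2))
  then have "shard_intersection W S \<rho> B w \<subseteq> shard_intersection W S \<rho> B u
      \<longleftrightarrow> shard_le base (chamber_of u) (chamber_of w)"
    if "u \<in> carrier W" "w \<in> carrier W"
    using A.Inter_shards_subset_iff[OF chamber_chamber_of[OF that(1)] chamber_chamber_of[OF that(2)]] that by metis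
  then show ?thesis by (auto simp: shard_order_def)
qed

lemma shard_order_partial: "Partial_order (shard_order W S \<rho> B)" "finite (shard_order W S \<rho> B)"
proof -
  let ?r = "shard_order W S \<rho> B"
  have sub: "?r \<subseteq> carrier W \<times> carrier W" by (auto simp: shard_order_def)
  then show "finite ?r" by (rule finite_subset) (simp add: finite_W)
  have F: "Field ?r \<subseteq> carrier W" using sub by (auto simp: Field_def)
  have "refl_on (Field ?r) ?r" using F by (auto simp: refl_on_def shard_order_def)
  moreover have "trans ?r" by (rule transI) (auto simp: shard_order_def)
  moreover have "antisym ?r"
    using A.shard_le_antisym[OF chamber_chamber_of chamber_chamber_of] chamber_of_inj
    by (intro antisymI) (auto simp: shard_order_iff)
  moreover have "?r \<subseteq> Field ?r \<times> Field ?r" by (auto simp: Field_def)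
  ultimately show "Partial_order ?r" by (simp add: partial_order_on_def preorder_on_def)
qed

text \<open>By \<open>sum_face_sum_interval\<close> the values of \<open>face_sum\<close> over the
  interval below \<open>w\<close> sum to 0 unless \<open>w\<close> is the identity, which is the
  recursion of the Moebius function from the bottom element.\<close>

lemma moebius_eq_face_sum:
  assumes "w \<in> carrier W"
  shows "poset_moebius (shard_order W S \<rho> B) \<one> w = face_sum roots base (chamber_of w)"
  using assms
proof (induction "card {z. (z, w) \<in> shard_order W S \<rho> B}" arbitrary: w rule: less_induct)
  case less
  let ?r = "shard_order W S \<rho> B"
  have po: "refl_on (Field ?r) ?r" "trans ?r" "antisym ?r"
    using partial_order_onD[OF shard_order_partial(1)] by auto
  have one: "(\<one>, z) \<in> ?r" if "z \<in> carrier W" for z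
    using that A.shard_le_self by (simp add: shard_order_iff chamber_of_one)
  have refl: "(w, w) \<in> ?r" using less.prems by (simp add: shard_order_def)
  show ?case
  proof (cases "w = \<one>")
    case True
    then show ?thesis using one shard_order_partial A.face_sum_self
      by (subst poset_moebius.simps) (simp add: chamber_of_one)
  next
    case False
    let ?Z = "{z. (z, w) \<in> ?r}"
    have finZ: "finite ?Z" using finite_W by (rule finite_subset[rotated]) (auto simp: shard_order_def)
    have IH: "poset_moebius ?r \<one> z = face_sum roots base (chamber_of z)" if z: "z \<in> ?Z - {w}" for z
    proof (rule less.hyps)
      show "z \<in> carrier W" using z by (auto simp: shard_order_def)
      have "{v. (v, z) \<in> ?r} \<subseteq> ?Z" using z po(2) by (auto dest: transD)
      moreover have "(w, z) \<notin> ?r" using z po(3) by (auto dest: antisymD)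
      ultimately have "{v. (v, z) \<in> ?r} \<subset> ?Z" using refl by blast
      then show "card {v. (v, z) \<in> ?r} < card ?Z" using finZ by (rule psubset_card_mono[rotated])
    qed
    have Z: "{z. (\<one>, z) \<in> ?r \<and> (z, w) \<in> ?r \<and> z \<noteq> w} = ?Z - {w}"
      using one by (auto simp: shard_order_def)
    have "poset_moebius ?r \<one> w = - (\<Sum>z\<in>?Z - {w}. poset_moebius ?r \<one> z)"
      using one[OF less.prems] shard_order_partial False
      by (subst poset_moebius.simps) (simp add: Z)
    also have "\<dots> = - (\<Sum>z\<in>?Z - {w}. face_sum roots base (chamber_of z))" using IH by simp
    also have "\<dots> = face_sum roots base (chamber_of w) - (\<Sum>z\<in>?Z. face_sum roots base (chamber_of z))"
      using sum.remove[OF finZ, of w "\<lambda>z. face_sum roots base (chamber_of z)"] refl by simp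
    also have "(\<Sum>z\<in>?Z. face_sum roots base (chamber_of z)) =
      (\<Sum>C\<in>{C. chamber roots C \<and> shard_le base C (chamber_of w)}. face_sum roots base C)"
    proof (rule sum.reindex_bij_betw)
      have im: "chamber_of ` carrier W = chambers roots" and inj: "inj_on chamber_of (carrier W)"
        using chamber_of_bij by (auto simp: bij_betw_def)
      have "?Z = {z \<in> carrier W. shard_le base (chamber_of z) (chamber_of w)}"
        using less.prems by (auto simp: shard_order_iff)
      moreover have "chamber_of ` {z \<in> carrier W. shard_le base (chamber_of z) (chamber_of w)}
        = {C. chamber roots C \<and> shard_le base C (chamber_of w)}"
      proof (intro equalityI subsetI)
        fix C assume C: "C \<in> {C. chamber roots C \<and> shard_le base C (chamber_of w)}"
        then have "C \<in> chamber_of ` carrier W" unfolding im by (simp add: chambers_def)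
        then show "C \<in> chamber_of ` {z \<in> carrier W. shard_le base (chamber_of z) (chamber_of w)}"
          using C by blast
      qed (use chamber_chamber_of in auto)
      ultimately show "bij_betw chamber_of ?Z {C. chamber roots C \<and> shard_le base C (chamber_of w)}"
        using inj_on_subset[OF inj, of ?Z] by (auto simp: bij_betw_def)
    qed
    also have "\<dots> = 0"
    proof (rule A.sum_face_sum_interval[OF chamber_chamber_of[OF less.prems]])
      show "chamber_of w \<noteq> base" using chamber_of_inj[OF less.prems one_closed] False chamber_of_one by blast
    qed
    finally show ?thesis by simp
  qed
qed

lemma moebius_number:
  "poset_moebius (shard_order W S \<rho> B) \<one> (longest_element W S)
   = (\<Sum>J\<in>Pow S. (-1) ^ card J * int (card (generate W J)))"
  using moebius_eq_face_sum[OF longest(1)] longest(2) face_sum_longest by simp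

end

theorem theorem1p3:
  fixes W :: "('g, 'm) monoid_scheme"
    and S :: "'g set"
    and \<rho> :: "'g \<Rightarrow> 'v::euclidean_space \<Rightarrow> 'v"
    and B :: "'v set"
  assumes "finite_coxeter_reflection_group W S \<rho> B"
  shows "poset_moebius (shard_order W S \<rho> B) \<one>\<^bsub>W\<^esub> (longest_element W S)
           = (-1) ^ card S * int (card (carrier W - (\<Union>J\<in>{J. J \<subset> S}. parabolic W J)))
       \<and> poset_moebius (shard_order W S \<rho> B) \<one>\<^bsub>W\<^esub> (longest_element W S)
           = (\<Sum>J\<in>Pow S. (-1) ^ card J * int (card (parabolic W J)))"
proof -
  interpret finite_coxeter_reflection_group W S \<rho> B by fact
  show ?thesis using moebius_number alternating_parabolic_sum by (simp add: parabolic_def)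
qed

end
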